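(* Let $k$ be a positive integer. Let $U=[\sigma_1,\sigma_2]$ be an interval in the weak Bruhat order on $\mathcal{S}_n$. If $\sigma_1^{-1}\sigma_2$ has intrinsic width bounded by $k$, then $|U|$ can be computed in $O(n^{\max(4,k+1)})$ time.
   Context: $\mathcal{S}_n$ is the set of permutations (bijections) of $[n]=\{1,\dots,n\}$; composition is $(fg)(x)=f(g(x))$. The width of a permutation $\sigma$ is the length of a longest decreasing subsequence of the word $\sigma(1)\cdots\sigma(n)$. Weak Bruhat order $\prec$ on $\mathcal{S}_n$: the reflexive and transitive closure of the covering relation $\lessdot$, where $\sigma_1\lessdot\sigma_2$ if and only if there is an adjacent transposition $\tau$ exchanging $k$ and $l$ (so $|k-l|=1$) with $\sigma_1=\sigma_2\tau$, $k<l$ and $\sigma_1(k)<\sigma_1(l)$. The interval $[\sigma_1,\sigma_2]$ is $\{\rho\in\mathcal{S}_n:\sigma_1\prec\rho\prec\sigma_2\}$. Inflation: for $\sigma\in\mathcal{S}_n$ and permutations $\tau_i\in\mathcal{S}_{m_i}$ ($1\le i\le n$), let $A_j=[1+\sum_{i=1}^{j-1}m_i,\ \sum_{i=1}^{j}m_i]$. The inflation $\sigma[\tau_1,\dots,\tau_n]$ is the permutation of $[\sum_i m_i]$ given, for $x\in A_j$, by $$\sigma[\tau_1,\dots,\tau_n](x)=\sum_{i:\sigma(i)<\sigma(j)}m_i+\tau_j\Big(x-\sum_{i=1}^{j-1}m_i\Big).$$ A block of $\pi\in\mathcal{S}_n$ is a set of consecutive indices $\{i,i+1,\dots,i+k\}$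 whose image under $\pi$ is a contiguous subset of $[n]$; $\pi$ is simple if its only blocks have size $1$ or $n$. Intrinsic width $\mathrm{iw}$ of permutations is defined recursively: any monotone permutation has intrinsic width $1$; any simple non-monotone permutation of width $k$ has intrinsic width $k$; and $\mathrm{iw}(\sigma[\tau_1,\dots,\tau_n])=\max\{\mathrm{iw}(\sigma),\mathrm{iw}(\tau_1),\dots,\mathrm{iw}(\tau_n)\}$. (Every permutation is obtained by recursively inflating simple permutations.) Running times are in the usual sense of algorithm analysis (the algorithm takes $\sigma_1,\sigma_2$ as input and outputs the integer $|U|$; $k$ is fixed); no particular machine model is specified. *)

theory Defs
  imports Complex_Main "HOL-Combinatorics.Permutations" "HOL-Library.Landau_Symbols"
begin

section \<open>Permutations of \<open>{1..n}\<close>\<close>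

text \<open>
  An element of the symmetric group on \<open>{1..n}\<close> is a function \<open>\<pi> :: nat \<Rightarrow> nat\<close> with
  \<open>\<pi> permutes {1..n}\<close>, i.e. a bijection of \<open>{1..n}\<close> that is the identity elsewhere.  Hence
  composition is \<open>\<circ>\<close>, the inverse is \<open>inv\<close>, and distinct permutations of \<open>{1..n}\<close> are distinct
  functions, so that they can be counted with \<open>card\<close>.
\<close>

definition monotone_perm :: "nat \<Rightarrow> (nat \<Rightarrow> nat) \<Rightarrow> bool" where
  "monotone_perm n \<pi> \<longleftrightarrow>
     monotone_on {1..n} (<) (<) \<pi> \<or> monotone_on {1..n} (<) (>) \<pi>"

definition perm_width :: "nat \<Rightarrow> (nat \<Rightarrow> nat) \<Rightarrow> nat" where
  "perm_width n \<pi> = Max {card S | S. S \<subseteq> {1..n} \<and> monotone_on S (<) (>) \<pi>}"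

definition is_block :: "nat \<Rightarrow> (nat \<Rightarrow> nat) \<Rightarrow> nat set \<Rightarrow> bool" where
  "is_block n \<pi> B \<longleftrightarrow>
     B \<noteq> {} \<and> B \<subseteq> {1..n} \<and> (\<exists>a b. B = {a..b}) \<and> (\<exists>c d. \<pi> ` B = {c..d})"

definition simple_perm :: "nat \<Rightarrow> (nat \<Rightarrow> nat) \<Rightarrow> bool" where
  "simple_perm n \<pi> \<longleftrightarrow> (\<forall>B. is_block n \<pi> B \<longrightarrow> card B = 1 \<or> card B = n)"

definition segment :: "(nat \<Rightarrow> nat) \<Rightarrow> nat \<Rightarrow> nat set" where
  "segment m j = {1 + (\<Sum>i\<in>{1..<j}. m i)..(\<Sum>i\<in>{1..j}. m i)}"

definition inflation ::
    "nat \<Rightarrow> (nat \<Rightarrow> nat) \<Rightarrow> (nat \<Rightarrow> nat) \<Rightarrow> (nat \<Rightarrow> nat \<Rightarrow> nat) \<Rightarrow> nat \<Rightarrow> nat" where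
  "inflation n \<sigma> m \<tau> x =
     (if x \<in> {1..(\<Sum>i\<in>{1..n}. m i)}
      then let j = (THE j. j \<in> {1..n} \<and> x \<in> segment m j)
           in (\<Sum>i | i \<in> {1..n} \<and> \<sigma> i < \<sigma> j. m i) + \<tau> j (x - (\<Sum>i\<in>{1..<j}. m i))
      else x)"

text \<open>
  \<open>has_intrinsic_width n \<pi> w\<close>: the permutation \<open>\<pi>\<close> of \<open>{1..n}\<close> has intrinsic width \<open>w\<close>.
  The recursion defining intrinsic width runs over arbitrary (non-unique) ways of writing a
  permutation as an inflation, so it is recorded as a relation.  The inflating permutations
  must be non-empty, since inflating by an empty permutation deletes an entry.
\<close>

inductive has_intrinsic_width :: "nat \<Rightarrow> (nat \<Rightarrow> nat) \<Rightarrow> nat \<Rightarrow> bool" where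
  monotone:
    "\<pi> permutes {1..n} \<Longrightarrow> monotone_perm n \<pi> \<Longrightarrow> has_intrinsic_width n \<pi> 1"
| simple:
    "\<pi> permutes {1..n} \<Longrightarrow> simple_perm n \<pi> \<Longrightarrow> \<not> monotone_perm n \<pi> \<Longrightarrow>
     has_intrinsic_width n \<pi> (perm_width n \<pi>)"
| inflate:
    "has_intrinsic_width n \<sigma> w \<Longrightarrow>
     (\<forall>i\<in>{1..n}. m i \<ge> 1 \<and> has_intrinsic_width (m i) (\<tau> i) (v i)) \<Longrightarrow>
     has_intrinsic_width (\<Sum>i\<in>{1..n}. m i) (inflation n \<sigma> m \<tau>) (Max (insert w (v ` {1..n})))"


section \<open>The weak Bruhat order\<close>

definition weak_cover :: "nat \<Rightarrow> (nat \<Rightarrow> nat) \<Rightarrow> (nat \<Rightarrow> nat) \<Rightarrow> bool" where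
  "weak_cover n \<sigma>\<^sub>1 \<sigma>\<^sub>2 \<longleftrightarrow>
     \<sigma>\<^sub>1 permutes {1..n} \<and> \<sigma>\<^sub>2 permutes {1..n} \<and>
     (\<exists>k\<in>{1..n}. \<exists>l\<in>{1..n}. \<bar>int k - int l\<bar> = 1 \<and>
        \<sigma>\<^sub>1 = \<sigma>\<^sub>2 \<circ> transpose k l \<and> k < l \<and> \<sigma>\<^sub>1 k < \<sigma>\<^sub>1 l)"

definition weak_le :: "nat \<Rightarrow> (nat \<Rightarrow> nat) \<Rightarrow> (nat \<Rightarrow> nat) \<Rightarrow> bool" where
  "weak_le n = (weak_cover n)\<^sup>*\<^sup>*"

definition weak_interval :: "nat \<Rightarrow> (nat \<Rightarrow> nat) \<Rightarrow> (nat \<Rightarrow> nat) \<Rightarrow> (nat \<Rightarrow> nat) set" where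
  "weak_interval n \<sigma>\<^sub>1 \<sigma>\<^sub>2 = {\<rho>. \<rho> permutes {1..n} \<and> weak_le n \<sigma>\<^sub>1 \<rho> \<and> weak_le n \<rho> \<sigma>\<^sub>2}"


section \<open>Programs and running time\<close>

text \<open>
  The machine model is a random access machine with uniform cost, presented as a structured
  while language.  Every variable is an array of natural numbers indexed by natural numbers;
  a scalar is kept in cell 0.  A program mentions only finitely many variables.  The
  arithmetic operations are addition and truncated subtraction; as in the machines of Cook
  and Reckhow there is no multiplication, which at unit cost would make it possible to build
  numbers whose length is exponential in the running time.
\<close>

type_synonym vname = string
type_synonym state = "vname \<Rightarrow> nat \<Rightarrow> nat"

datatype aexp = Const nat | Elem vname aexp | Plus aexp aexp | Minus aexp aexp

datatype bexp = Less aexp aexp | Neg bexp | And bexp bexp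

datatype com =
    Skip
  | Assign vname aexp aexp
  | Seq com com
  | Cond bexp com com
  | While bexp com

fun aval :: "aexp \<Rightarrow> state \<Rightarrow> nat" where
  "aval (Const c) s = c"
| "aval (Elem x e) s = s x (aval e s)"
| "aval (Plus e\<^sub>1 e\<^sub>2) s = aval e\<^sub>1 s + aval e\<^sub>2 s"
| "aval (Minus e\<^sub>1 e\<^sub>2) s = aval e\<^sub>1 s - aval e\<^sub>2 s"

fun bval :: "bexp \<Rightarrow> state \<Rightarrow> bool" where
  "bval (Less e\<^sub>1 e\<^sub>2) s \<longleftrightarrow> aval e\<^sub>1 s < aval e\<^sub>2 s"
| "bval (Neg b) s \<longleftrightarrow> \<not> bval b s"
| "bval (And b\<^sub>1 b\<^sub>2) s \<longleftrightarrow> bval b\<^sub>1 s \<and> bval b\<^sub>2 s"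

fun acost :: "aexp \<Rightarrow> nat" where
  "acost (Const c) = 1"
| "acost (Elem x e) = acost e + 1"
| "acost (Plus e\<^sub>1 e\<^sub>2) = acost e\<^sub>1 + acost e\<^sub>2 + 1"
| "acost (Minus e\<^sub>1 e\<^sub>2) = acost e\<^sub>1 + acost e\<^sub>2 + 1"

fun bcost :: "bexp \<Rightarrow> nat" where
  "bcost (Less e\<^sub>1 e\<^sub>2) = acost e\<^sub>1 + acost e\<^sub>2 + 1"
| "bcost (Neg b) = bcost b + 1"
| "bcost (And b\<^sub>1 b\<^sub>2) = bcost b\<^sub>1 + bcost b\<^sub>2 + 1"

text \<open>
  \<open>exec c s t s'\<close>: started in state \<open>s\<close>, the program \<open>c\<close> halts after exactly \<open>t\<close> elementary
  steps in state \<open>s'\<close>.  The command \<open>Assign x i e\<close> stores the value of \<open>e\<close> in the cell of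
  \<open>x\<close> whose index is the value of \<open>i\<close>.
\<close>

inductive exec :: "com \<Rightarrow> state \<Rightarrow> nat \<Rightarrow> state \<Rightarrow> bool" where
  Skip: "exec Skip s 1 s"
| Assign:
    "exec (Assign x i e) s (acost i + acost e + 1) (s(x := (s x)(aval i s := aval e s)))"
| Seq: "exec c\<^sub>1 s t\<^sub>1 s' \<Longrightarrow> exec c\<^sub>2 s' t\<^sub>2 s'' \<Longrightarrow> exec (Seq c\<^sub>1 c\<^sub>2) s (t\<^sub>1 + t\<^sub>2) s''"
| CondTrue: "bval b s \<Longrightarrow> exec c\<^sub>1 s t s' \<Longrightarrow> exec (Cond b c\<^sub>1 c\<^sub>2) s (bcost b + 1 + t) s'"
| CondFalse: "\<not> bval b s \<Longrightarrow> exec c\<^sub>2 s t s' \<Longrightarrow> exec (Cond b c\<^sub>1 c\<^sub>2) s (bcost b + 1 + t) s'"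
| WhileFalse: "\<not> bval b s \<Longrightarrow> exec (While b c) s (bcost b + 1) s"
| WhileTrue:
    "bval b s \<Longrightarrow> exec c s t\<^sub>1 s' \<Longrightarrow> exec (While b c) s' t\<^sub>2 s'' \<Longrightarrow>
     exec (While b c) s (bcost b + 1 + t\<^sub>1 + t\<^sub>2) s''"

inductive_cases exec_SkipE: "exec Skip s t s'"
inductive_cases exec_AssignE: "exec (Assign x i e) s t s'"
inductive_cases exec_SeqE: "exec (Seq c\<^sub>1 c\<^sub>2) s t s'"
inductive_cases exec_CondE: "exec (Cond b c\<^sub>1 c\<^sub>2) s t s'"
inductive_cases exec_WhileE: "exec (While b c) s t s'"

lemma exec_deterministic:
  "exec c s t s' \<Longrightarrow> exec c s u s'' \<Longrightarrow> u = t \<and> s'' = s'"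
proof (induction arbitrary: u s'' rule: exec.induct)
  case (Skip s)
  then show ?case by (rule exec_SkipE) simp
next
  case (Assign x i e s)
  then show ?case by (rule exec_AssignE) simp
next
  case (Seq c\<^sub>1 s t\<^sub>1 r c\<^sub>2 t\<^sub>2 r')
  from Seq.prems obtain v\<^sub>1 v\<^sub>2 q
    where "u = v\<^sub>1 + v\<^sub>2" and 1: "exec c\<^sub>1 s v\<^sub>1 q" and 2: "exec c\<^sub>2 q v\<^sub>2 s''"
    by (rule exec_SeqE)
  moreover from Seq.IH(1)[OF 1] have "v\<^sub>1 = t\<^sub>1" "q = r" by simp_all
  ultimately show ?case using Seq.IH(2)[of v\<^sub>2 s''] by simp
next
  case (CondTrue b s c\<^sub>1 t r c\<^sub>2)
  from CondTrue.prems CondTrue.hyps(1)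
  obtain v where "u = bcost b + 1 + v" and 1: "exec c\<^sub>1 s v s''"
    by (auto elim: exec_CondE)
  with CondTrue.IH[OF 1] show ?case by simp
next
  case (CondFalse b s c\<^sub>2 t r c\<^sub>1)
  from CondFalse.prems CondFalse.hyps(1)
  obtain v where "u = bcost b + 1 + v" and 1: "exec c\<^sub>2 s v s''"
    by (auto elim: exec_CondE)
  with CondFalse.IH[OF 1] show ?case by simp
next
  case (WhileFalse b s c)
  from WhileFalse.prems show ?case
    by (rule exec_WhileE) (use WhileFalse.hyps in simp_all)
next
  case (WhileTrue b s c t\<^sub>1 r t\<^sub>2 r')
  have "\<exists>v\<^sub>1 v\<^sub>2 q. u = bcost b + 1 + v\<^sub>1 + v\<^sub>2 \<and> exec c s v\<^sub>1 q \<and> exec (While b c) q v\<^sub>2 s''"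
    by (rule exec_WhileE[OF WhileTrue.prems]) (use WhileTrue.hyps(1) in auto)
  then obtain v\<^sub>1 v\<^sub>2 q where "u = bcost b + 1 + v\<^sub>1 + v\<^sub>2"
    and 1: "exec c s v\<^sub>1 q" and 2: "exec (While b c) q v\<^sub>2 s''"
    by blast
  moreover from WhileTrue.IH(1)[OF 1] have "v\<^sub>1 = t\<^sub>1" "q = r" by simp_all
  ultimately show ?case using WhileTrue.IH(2)[of v\<^sub>2 s''] by simp
qed

text \<open>The initial state for a pair of permutations; all cells not listed contain 0.\<close>

definition perm_pair_input :: "nat \<Rightarrow> (nat \<Rightarrow> nat) \<Rightarrow> (nat \<Rightarrow> nat) \<Rightarrow> state" where
  "perm_pair_input n \<sigma>\<^sub>1 \<sigma>\<^sub>2 x i =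
     (if x = ''n'' \<and> i = 0 then n
      else if x = ''sigma1'' \<and> i \<in> {1..n} then \<sigma>\<^sub>1 i
      else if x = ''sigma2'' \<and> i \<in> {1..n} then \<sigma>\<^sub>2 i
      else 0)"

definition outputs_within :: "com \<Rightarrow> state \<Rightarrow> nat \<Rightarrow> nat \<Rightarrow> bool" where
  "outputs_within P s r T \<longleftrightarrow> (\<exists>t s'. exec P s t s' \<and> t \<le> T \<and> s' ''result'' 0 = r)"

end

theory Submission
  imports Defs
begin

text \<open>
  The interval is in bijection with the linear extensions of the poset on positions in which
  \<open>x\<close> lies below \<open>y\<close> iff \<open>x < y\<close> and \<open>\<pi> x < \<pi> y\<close>, for \<open>\<pi> = \<sigma>\<^sub>1\<^sup>-\<^sup>1\<sigma>\<^sub>2\<close>.  If an inclusion-minimal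
  non-increasing block of \<open>\<pi>\<close> is sorted, the number of linear extensions is divided by that of the
  block.  Contracting its runs of consecutive values turns such a block into a simple pattern of \<open>\<pi>\<close>,
  so the block is covered by \<open>max k 2\<close> chains and its linear extensions can be counted by dynamic
  programming over the position reached in each chain.  The recurrence is
  linear, hence starting it from the product obtained so far accumulates the product over all blocks
  without multiplications.  Every sorted block increases the number of \<open>i\<close> with
  \<open>\<pi> (i + 1) = \<pi> i + 1\<close>, so that fewer than \<open>n\<close> blocks are sorted, each in time
  \<open>O(n\<^sup>2 + n\<^bsup>max k 2\<^esup>)\<close>.
\<close>

section \<open>Intervals of the weak order as sets of linear extensions\<close>

text \<open>Intrinsic width is defined through arbitrary inflations, but the algorithm never
  computes one. All that is extracted from the width is a hereditary condition,
  \<open>simple_bound\<close>: in every simple non-monotone pattern a decreasing subset has at most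
  k points. It is proved by induction over any derivation, so the ambiguity of decompositions does
  no harm, and it survives the sorting of a block, which would be awkward to follow on
  decompositions. Minimality of the block enters through its proper sub-blocks: they are all
  increasing, hence already runs of consecutive values, so contracting the runs leaves no proper
  block. The condition is silent about monotone patterns. Increasing is excluded because the block
  is unsorted, and a decreasing simple pattern has at most two points; this is where the 2 in
  \<open>max k 2\<close> comes from. A table address is the numeral of the thresholds in base n + 1.
  Lowering a threshold subtracts a power from the address, so increasing addresses meet the
  recurrence in a valid order and look-ups need only the arithmetic of the machine.\<close>

definition linexts :: "nat set \<Rightarrow> (nat \<Rightarrow> nat) \<Rightarrow> (nat \<Rightarrow> nat) set" where
  "linexts S \<pi> = {\<gamma>. \<gamma> permutes S \<and> (\<forall>x\<in>S. \<forall>y\<in>S. x < y \<and> \<pi> x < \<pi> y \<longrightarrow> \<gamma> x < \<gamma> y)}"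

text \<open>The pairs consist of values, not of positions: a cover multiplies by a transposition of
  positions on the right, so a pair of values keeps its meaning along a chain of covers, and each
  cover upwards adds one pair.\<close>

definition inversions :: "nat \<Rightarrow> (nat \<Rightarrow> nat) \<Rightarrow> (nat \<times> nat) set" where
  "inversions n \<sigma> = {(a, b). a \<in> {1..n} \<and> b \<in> {1..n} \<and> a < b \<and> inv \<sigma> b < inv \<sigma> a}"

lemma finite_inversions: "finite (inversions n \<sigma>)"
  by (rule finite_subset[of _ "{1..n} \<times> {1..n}"]) (auto simp: inversions_def)

lemma linexts_cong: "(\<And>x. x \<in> S \<Longrightarrow> \<pi> x = \<pi>' x) \<Longrightarrow> linexts S \<pi> = linexts S \<pi>'"
  by (auto simp: linexts_def)

lemma increasing_permutes_id:
  fixes n :: nat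
  assumes "p permutes {1..n}" "monotone_on {1..n} (<) (<) p"
  shows "p = id"
proof -
  have ge: "x \<le> p x" if "x \<le> n" for x
    using that
  proof (induction x)
    case (Suc x)
    show ?case
    proof (cases "x = 0")
      case True
      then show ?thesis using permutes_in_image[OF assms(1), of "Suc 0"] Suc.prems by auto
    next
      case False
      then have "p x < p (Suc x)" using assms(2) Suc.prems by (auto simp: monotone_on_def)
      then show ?thesis using Suc by simp
    qed
  qed simp
  show ?thesis
    by (rule permutes_natset_ge[OF assms(1)]) (use ge in auto)
qed

text \<open>A transposition of neighbours preserves the order of all pairs of positions except the
  two swapped ones, so only the pair of values standing there changes its status.\<close>

lemma adjacent_swap_inversions:
  assumes p: "\<rho> permutes {1..n}" and k: "1 \<le> k" "Suc k \<le> n" and d: "\<rho> (Suc k) < \<rho> k"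
  shows "inversions n \<rho> = insert (\<rho> (Suc k), \<rho> k) (inversions n (\<rho> \<circ> transpose k (Suc k)))"
    and "(\<rho> (Suc k), \<rho> k) \<notin> inversions n (\<rho> \<circ> transpose k (Suc k))"
proof -
  let ?\<rho> = "\<rho> \<circ> transpose k (Suc k)"
  have inv': "inv ?\<rho> = transpose k (Suc k) \<circ> inv \<rho>"
    using p by (simp add: o_inv_distrib permutes_bij)
  have ik: "inv \<rho> x = k \<longleftrightarrow> x = \<rho> k" "inv \<rho> x = Suc k \<longleftrightarrow> x = \<rho> (Suc k)" for x
    using p by (metis permutes_inverses)+
  have rng: "\<rho> k \<in> {1..n}" "\<rho> (Suc k) \<in> {1..n}"
    using k permutes_in_image[OF p, of k] permutes_in_image[OF p, of "Suc k"] by auto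
  have tr: "transpose k (Suc k) u < transpose k (Suc k) v \<longleftrightarrow>
      (if u = k \<and> v = Suc k then False else if u = Suc k \<and> v = k then True else u < v)" for u v
    by (auto simp: transpose_def)
  show "inversions n \<rho> = insert (\<rho> (Suc k), \<rho> k) (inversions n ?\<rho>)"
    using d rng by (auto simp: inversions_def inv' tr ik permutes_inverses[OF p] split: if_splits)
  show "(\<rho> (Suc k), \<rho> k) \<notin> inversions n ?\<rho>"
    by (auto simp: inversions_def inv' tr permutes_inverses[OF p])
qed

lemma weak_cover_adjacent:
  assumes "weak_cover n \<sigma>1 \<sigma>2"
  obtains k where "1 \<le> k" "Suc k \<le> n" "\<sigma>2 (Suc k) < \<sigma>2 k" "\<sigma>1 = \<sigma>2 \<circ> transpose k (Suc k)"
proof -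
  obtain k l where *: "k \<in> {1..n}" "l \<in> {1..n}" "\<bar>int k - int l\<bar> = 1" 
    "\<sigma>1 = \<sigma>2 \<circ> transpose k l" "k < l" "\<sigma>1 k < \<sigma>1 l"
    using assms by (auto simp: weak_cover_def)
  moreover from * have "l = Suc k" by linarith
  ultimately show ?thesis by (intro that[of k]) (auto simp: transpose_def)
qed

lemma weak_le_inversions:
  assumes "weak_le n \<sigma>1 \<sigma>2"
  shows "inversions n \<sigma>1 \<subseteq> inversions n \<sigma>2"
  using assms unfolding weak_le_def
proof (induction rule: rtranclp_induct)
  case (step \<rho> \<rho>')
  then have p: "\<rho>' permutes {1..n}" by (auto simp: weak_cover_def)
  from step(2) obtain k where "1 \<le> k" "Suc k \<le> n" "\<rho>' (Suc k) < \<rho>' k" "\<rho> = \<rho>' \<circ> transpose k (Suc k)"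
    by (rule weak_cover_adjacent)
  with adjacent_swap_inversions(1)[OF p, of k] step(3) show ?case by (metis insert_subset subset_insertI2 subset_insertI order_trans)
qed simp

text \<open>Induction on the number of inversions of \<open>\<sigma>2\<close>. If the two differ,
  \<open>inv \<sigma>1 \<circ> \<sigma>2\<close> has a descent at some k. By the inclusion, k is
  also a descent of \<open>\<sigma>2\<close>, and its pair of values is no inversion of
  \<open>\<sigma>1\<close>; undoing it is a cover below \<open>\<sigma>2\<close> that keeps the
  inclusion.\<close>

lemma inversions_weak_le:
  assumes p1: "\<sigma>1 permutes {1..n}" and "\<sigma>2 permutes {1..n}"
    and "inversions n \<sigma>1 \<subseteq> inversions n \<sigma>2"
  shows "weak_le n \<sigma>1 \<sigma>2"
  using assms(2,3)
proof (induction "card (inversions n \<sigma>2)" arbitrary: \<sigma>2 rule: less_induct)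
  case less
  note p2 = less.prems(1)
  have q: "inv \<sigma>1 \<circ> \<sigma>2 permutes {1..n}"
    by (rule permutes_compose[OF p2 permutes_inv[OF p1]])
  show ?case
  proof (cases "\<sigma>1 = \<sigma>2")
    case True
    then show ?thesis by (simp add: weak_le_def)
  next
    case False
    have "inv \<sigma>1 \<circ> \<sigma>2 \<noteq> id"
    proof
      assume "inv \<sigma>1 \<circ> \<sigma>2 = id"
      then have "\<sigma>1 \<circ> (inv \<sigma>1 \<circ> \<sigma>2) = \<sigma>1" by simp
      then show False using False permutes_inv_o(1)[OF p1] by (simp add: o_assoc)
    qed
    then have "\<not> monotone_on {1..n} (<) (<) (inv \<sigma>1 \<circ> \<sigma>2)"
      using increasing_permutes_id[OF q] by blast
    then have "\<exists>k. 1 \<le> k \<and> Suc k \<le> n \<and> \<not> (inv \<sigma>1 \<circ> \<sigma>2) k < (inv \<sigma>1 \<circ> \<sigma>2) (Suc k)"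
    proof (rule contrapos_np)
      assume no: "\<nexists>k. 1 \<le> k \<and> Suc k \<le> n \<and> \<not> (inv \<sigma>1 \<circ> \<sigma>2) k < (inv \<sigma>1 \<circ> \<sigma>2) (Suc k)"
      have "(inv \<sigma>1 \<circ> \<sigma>2) x < (inv \<sigma>1 \<circ> \<sigma>2) y" if "x < y" "1 \<le> x" "y \<le> n" for x y
        using that
      proof (induction y)
        case (Suc y)
        then have "(inv \<sigma>1 \<circ> \<sigma>2) y < (inv \<sigma>1 \<circ> \<sigma>2) (Suc y)" using no by auto
        then show ?case using Suc by (cases "x = y") auto
      qed simp
      then show "monotone_on {1..n} (<) (<) (inv \<sigma>1 \<circ> \<sigma>2)" by (auto simp: monotone_on_def)
    qed
    then obtain k where k: "1 \<le> k" "Suc k \<le> n" and nl: "\<not> (inv \<sigma>1 \<circ> \<sigma>2) k < (inv \<sigma>1 \<circ> \<sigma>2) (Suc k)"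
      by blast
    have "(inv \<sigma>1 \<circ> \<sigma>2) k \<noteq> (inv \<sigma>1 \<circ> \<sigma>2) (Suc k)"
      using permutes_inj[OF q] by (metis injD n_not_Suc_n)
    with nl have lt: "inv \<sigma>1 (\<sigma>2 (Suc k)) < inv \<sigma>1 (\<sigma>2 k)" by simp
    have rng: "\<sigma>2 k \<in> {1..n}" "\<sigma>2 (Suc k) \<in> {1..n}"
      using k permutes_in_image[OF p2, of k] permutes_in_image[OF p2, of "Suc k"] by auto
    have ne: "\<sigma>2 k \<noteq> \<sigma>2 (Suc k)" using permutes_inj[OF p2] by (metis injD n_not_Suc_n)
    have d: "\<sigma>2 (Suc k) < \<sigma>2 k"
    proof (rule ccontr)
      assume "\<not> \<sigma>2 (Suc k) < \<sigma>2 k"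
      with ne rng lt have "(\<sigma>2 k, \<sigma>2 (Suc k)) \<in> inversions n \<sigma>1" by (auto simp: inversions_def)
      then have "(\<sigma>2 k, \<sigma>2 (Suc k)) \<in> inversions n \<sigma>2" using less.prems by auto
      then show False by (simp add: inversions_def permutes_inverses[OF p2])
    qed
    let ?\<rho> = "\<sigma>2 \<circ> transpose k (Suc k)"
    have pr: "?\<rho> permutes {1..n}"
      using k by (intro permutes_compose[OF permutes_swap_id p2]) auto
    note sw = adjacent_swap_inversions[OF p2 k d]
    have "(\<sigma>2 (Suc k), \<sigma>2 k) \<notin> inversions n \<sigma>1" using lt by (auto simp: inversions_def)
    then have sub: "inversions n \<sigma>1 \<subseteq> inversions n ?\<rho>" using less.prems(2) sw by auto
    have "card (inversions n ?\<rho>) < card (inversions n \<sigma>2)"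
      by (subst sw(1)) (use sw(2) finite_inversions in simp)
    from less.hyps[OF this pr sub] have "weak_le n \<sigma>1 ?\<rho>" .
    moreover have "weak_cover n ?\<rho> \<sigma>2"
      using p2 pr k d unfolding weak_cover_def by (intro conjI bexI[of _ k] bexI[of _ "Suc k"]) auto
    ultimately show ?thesis by (auto simp: weak_le_def)
  qed
qed

text \<open>Position 0 is included because the program scans the cells from 0 on; permutations of
  {1..n} fix it, so it adds no condition for them.\<close>

definition weak_ok :: "nat \<Rightarrow> (nat \<Rightarrow> nat) \<Rightarrow> (nat \<Rightarrow> nat) \<Rightarrow> bool" where
  "weak_ok n \<sigma> \<pi> \<longleftrightarrow> (\<forall>x y. x < y \<and> y \<le> n \<and> \<sigma> x < \<sigma> y \<longrightarrow> \<pi> x < \<pi> y)"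

text \<open>A pair of values is translated into the positions it occupies in
  \<open>\<sigma>2\<close>; the composite then gives the positions in
  \<open>\<sigma>1\<close>.\<close>

lemma inversions_subset_iff:
  assumes p1: "\<sigma>1 permutes {1..n}" and p2: "\<sigma>2 permutes {1..n}"
  shows "inversions n \<sigma>1 \<subseteq> inversions n \<sigma>2 \<longleftrightarrow> weak_ok n \<sigma>2 (inv \<sigma>1 \<circ> \<sigma>2)"
proof
  have q: "inv \<sigma>1 \<circ> \<sigma>2 permutes {1..n}"
    by (rule permutes_compose[OF p2 permutes_inv[OF p1]])
  assume sub: "inversions n \<sigma>1 \<subseteq> inversions n \<sigma>2"
  show "weak_ok n \<sigma>2 (inv \<sigma>1 \<circ> \<sigma>2)"
    unfolding weak_ok_def
  proof (intro allI impI, elim conjE, rule ccontr)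
    fix x y assume xy: "x < y" "y \<le> n" "\<sigma>2 x < \<sigma>2 y"
      and nl: "\<not> (inv \<sigma>1 \<circ> \<sigma>2) x < (inv \<sigma>1 \<circ> \<sigma>2) y"
    have ne: "(inv \<sigma>1 \<circ> \<sigma>2) x \<noteq> (inv \<sigma>1 \<circ> \<sigma>2) y"
      using permutes_inj[OF q] xy by (metis injD less_irrefl)
    have "x \<noteq> 0"
      using nl ne permutes_not_in[OF q, of 0] by (cases x) auto
    then have "\<sigma>2 x \<in> {1..n}" "\<sigma>2 y \<in> {1..n}"
      using xy permutes_in_image[OF p2, of x] permutes_in_image[OF p2, of y] by auto
    then have "(\<sigma>2 x, \<sigma>2 y) \<in> inversions n \<sigma>1"
      using nl ne xy by (auto simp: inversions_def)
    then have "(\<sigma>2 x, \<sigma>2 y) \<in> inversions n \<sigma>2" using sub by auto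
    then show False using xy by (simp add: inversions_def permutes_inverses[OF p2])
  qed
next
  assume ok: "weak_ok n \<sigma>2 (inv \<sigma>1 \<circ> \<sigma>2)"
  show "inversions n \<sigma>1 \<subseteq> inversions n \<sigma>2"
  proof (rule subrelI)
    fix a b assume ab: "(a, b) \<in> inversions n \<sigma>1"
    have i2: "inv \<sigma>2 a \<in> {1..n}" "inv \<sigma>2 b \<in> {1..n}"
      using ab permutes_in_image[OF permutes_inv[OF p2], of a] permutes_in_image[OF permutes_inv[OF p2], of b]
      by (auto simp: inversions_def)
    have "\<not> inv \<sigma>2 a < inv \<sigma>2 b"
      using ok[unfolded weak_ok_def, rule_format, of "inv \<sigma>2 a" "inv \<sigma>2 b"] ab i2
      by (auto simp: inversions_def permutes_inverses[OF p2])
    moreover have "inv \<sigma>2 a \<noteq> inv \<sigma>2 b"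
      using ab permutes_inverses[OF p2] by (auto simp: inversions_def) (metis less_irrefl)
    ultimately show "(a, b) \<in> inversions n \<sigma>2" using ab by (auto simp: inversions_def)
  qed
qed

text \<open>Given the inclusion of inversions, \<open>\<rho>\<close> lies in the interval iff it
  orders each pair of values on which \<open>\<sigma>1\<close> and \<open>\<sigma>2\<close> agree as
  they do; pairs on which they disagree are free. Named by their positions in
  \<open>\<sigma>2\<close>, agreeing pairs are those increasing in both x and
  \<open>\<pi> x\<close>, and \<open>\<rho>\<close> corresponds to the extension
  \<open>inv \<rho> \<circ> \<sigma>2\<close>.\<close>

lemma card_weak_interval:
  assumes p1: "\<sigma>1 permutes {1..n}" and p2: "\<sigma>2 permutes {1..n}"
  defines "\<pi> \<equiv> inv \<sigma>1 \<circ> \<sigma>2"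
  shows "card (weak_interval n \<sigma>1 \<sigma>2) =
    (if weak_ok n \<sigma>2 \<pi> then card (linexts {1..n} \<pi>) else 0)"
proof -
  have int: "weak_interval n \<sigma>1 \<sigma>2 =
      {\<rho>. \<rho> permutes {1..n} \<and> inversions n \<sigma>1 \<subseteq> inversions n \<rho> \<and> inversions n \<rho> \<subseteq> inversions n \<sigma>2}"
    using weak_le_inversions inversions_weak_le p1 p2 by (auto simp: weak_interval_def)
  show ?thesis
  proof (cases "weak_ok n \<sigma>2 \<pi>")
    case False
    then have "weak_interval n \<sigma>1 \<sigma>2 = {}"
      using inversions_subset_iff[OF p1 p2] unfolding int \<pi>_def by blast
    with False show ?thesis by simp
  next
    case True
    then have sub: "inversions n \<sigma>1 \<subseteq> inversions n \<sigma>2"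
      using inversions_subset_iff[OF p1 p2] unfolding \<pi>_def by blast
    have img: "\<sigma>2 x \<in> {1..n} \<longleftrightarrow> x \<in> {1..n}" for x by (rule permutes_in_image[OF p2])
    have char: "\<rho> \<in> weak_interval n \<sigma>1 \<sigma>2 \<longleftrightarrow> inv \<rho> \<circ> \<sigma>2 \<in> linexts {1..n} \<pi>"
      if pr: "\<rho> permutes {1..n}" for \<rho>
    proof
      assume "\<rho> \<in> weak_interval n \<sigma>1 \<sigma>2"
      then have s: "inversions n \<sigma>1 \<subseteq> inversions n \<rho>" "inversions n \<rho> \<subseteq> inversions n \<sigma>2"
        by (auto simp: int)
      have "inv \<rho> (\<sigma>2 x) < inv \<rho> (\<sigma>2 y)"
        if xy: "x \<in> {1..n}" "y \<in> {1..n}" "x < y" "\<pi> x < \<pi> y" for x y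
      proof (rule ccontr)
        assume nl: "\<not> inv \<rho> (\<sigma>2 x) < inv \<rho> (\<sigma>2 y)"
        have ne2: "\<sigma>2 x \<noteq> \<sigma>2 y" using permutes_inj[OF p2] xy by (metis injD less_irrefl)
        then have "inv \<rho> (\<sigma>2 x) \<noteq> inv \<rho> (\<sigma>2 y)"
          by (metis permutes_inverses(1)[OF pr])
        with nl have g: "inv \<rho> (\<sigma>2 y) < inv \<rho> (\<sigma>2 x)" by simp
        have i: "\<sigma>2 x \<in> {1..n}" "\<sigma>2 y \<in> {1..n}" using xy(1,2) by (simp_all only: img)
        show False
        proof (cases "\<sigma>2 x < \<sigma>2 y")
          case True
          with g i have "(\<sigma>2 x, \<sigma>2 y) \<in> inversions n \<rho>" by (auto simp: inversions_def)
          then have "(\<sigma>2 x, \<sigma>2 y) \<in> inversions n \<sigma>2" using s by auto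
          then show False using xy by (auto simp: inversions_def permutes_inverses[OF p2])
        next
          case False
          with ne2 have "\<sigma>2 y < \<sigma>2 x" by simp
          with xy i have "(\<sigma>2 y, \<sigma>2 x) \<in> inversions n \<sigma>1" by (auto simp: inversions_def \<pi>_def)
          then have "(\<sigma>2 y, \<sigma>2 x) \<in> inversions n \<rho>" using s by auto
          then show False using g by (auto simp: inversions_def)
        qed
      qed
      then show "inv \<rho> \<circ> \<sigma>2 \<in> linexts {1..n} \<pi>"
        using permutes_compose[OF p2 permutes_inv[OF pr]] by (auto simp: linexts_def)
    next
      assume L: "inv \<rho> \<circ> \<sigma>2 \<in> linexts {1..n} \<pi>"
      have key: "inv \<rho> a < inv \<rho> b"
        if ab: "a \<in> {1..n}" "b \<in> {1..n}" "inv \<sigma>2 a < inv \<sigma>2 b" "inv \<sigma>1 a < inv \<sigma>1 b" for a b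
      proof -
        have i: "inv \<sigma>2 a \<in> {1..n}" "inv \<sigma>2 b \<in> {1..n}"
          using ab(1,2) by (simp_all only: permutes_in_image[OF permutes_inv[OF p2]])
        have L': "\<forall>x\<in>{1..n}. \<forall>y\<in>{1..n}. x < y \<and> \<pi> x < \<pi> y \<longrightarrow> (inv \<rho> \<circ> \<sigma>2) x < (inv \<rho> \<circ> \<sigma>2) y"
          using L by (simp add: linexts_def)
        have "(inv \<rho> \<circ> \<sigma>2) (inv \<sigma>2 a) < (inv \<rho> \<circ> \<sigma>2) (inv \<sigma>2 b)"
          using L'[rule_format, OF i] ab(3,4) by (simp add: \<pi>_def permutes_inverses[OF p2])
        then show ?thesis by (simp add: permutes_inverses[OF p2])
      qed
      have "inversions n \<sigma>1 \<subseteq> inversions n \<rho>"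
        using key sub by (auto simp: inversions_def)
      moreover have "(a, b) \<in> inversions n \<sigma>2" if ab: "(a, b) \<in> inversions n \<rho>" for a b
      proof (rule ccontr)
        assume no: "(a, b) \<notin> inversions n \<sigma>2"
        have ne: "inv \<sigma>1 a \<noteq> inv \<sigma>1 b" "inv \<sigma>2 a \<noteq> inv \<sigma>2 b"
          using ab by (auto simp: inversions_def) (metis less_irrefl permutes_inverses(1)[OF p1], metis less_irrefl permutes_inverses(1)[OF p2])
        moreover have "(a, b) \<notin> inversions n \<sigma>1" using sub no by auto
        ultimately show False using no ab key[of a b] by (auto simp: inversions_def)
      qed
      ultimately show "\<rho> \<in> weak_interval n \<sigma>1 \<sigma>2" using pr by (auto simp: int)
    qed
    have "bij_betw (\<lambda>\<rho>. inv \<rho> \<circ> \<sigma>2) (weak_interval n \<sigma>1 \<sigma>2) (linexts {1..n} \<pi>)"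
    proof (rule bij_betwI[where g = "\<lambda>\<gamma>. \<sigma>2 \<circ> inv \<gamma>"])
      have inv_back: "inv (\<sigma>2 \<circ> inv \<gamma>) \<circ> \<sigma>2 = \<gamma>" if "\<gamma> permutes {1..n}" for \<gamma>
      proof -
        have "inv (\<sigma>2 \<circ> inv \<gamma>) = \<gamma> \<circ> inv \<sigma>2"
          using that p2 by (simp add: o_inv_distrib permutes_bij[OF p2] permutes_bij[OF permutes_inv[OF that]] permutes_inv_inv)
        then show ?thesis using permutes_inv_o(2)[OF p2] by (simp add: o_assoc[symmetric])
      qed
      show "(\<lambda>\<rho>. inv \<rho> \<circ> \<sigma>2) \<in> weak_interval n \<sigma>1 \<sigma>2 \<rightarrow> linexts {1..n} \<pi>"
        using char by (auto simp: weak_interval_def)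
      show "(\<lambda>\<gamma>. \<sigma>2 \<circ> inv \<gamma>) \<in> linexts {1..n} \<pi> \<rightarrow> weak_interval n \<sigma>1 \<sigma>2"
      proof
        fix \<gamma> assume g: "\<gamma> \<in> linexts {1..n} \<pi>"
        then have gp: "\<gamma> permutes {1..n}" by (simp add: linexts_def)
        have "\<sigma>2 \<circ> inv \<gamma> permutes {1..n}"
          using permutes_compose[OF permutes_inv[OF gp] p2] .
        then show "\<sigma>2 \<circ> inv \<gamma> \<in> weak_interval n \<sigma>1 \<sigma>2"
          using char[of "\<sigma>2 \<circ> inv \<gamma>"] g inv_back[OF gp] by simp
      qed
      show "\<sigma>2 \<circ> inv (inv \<rho> \<circ> \<sigma>2) = \<rho>" if "\<rho> \<in> weak_interval n \<sigma>1 \<sigma>2" for \<rho>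
      proof -
        from that have pr: "\<rho> permutes {1..n}" by (simp add: weak_interval_def)
        have "inv (inv \<rho> \<circ> \<sigma>2) = inv \<sigma>2 \<circ> \<rho>"
          using pr p2 by (simp add: o_inv_distrib permutes_bij[OF p2] permutes_bij[OF permutes_inv[OF pr]] permutes_inv_inv)
        then show ?thesis using permutes_inv_o(1)[OF p2] by (simp add: o_assoc)
      qed
      show "inv (\<sigma>2 \<circ> inv \<gamma>) \<circ> \<sigma>2 = \<gamma>" if "\<gamma> \<in> linexts {1..n} \<pi>" for \<gamma>
        using inv_back that by (simp add: linexts_def)
    qed
    then show ?thesis using True by (simp add: bij_betw_same_card)
  qed
qed

section \<open>Intrinsic width bounds the width of simple patterns\<close>

text \<open>Blocks relative to a pattern: convexity within S in both orders replaces contiguity, so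
  patterns can be treated as subsets of positions without being renumbered.\<close>

definition module_on :: "(nat \<Rightarrow> nat) \<Rightarrow> nat set \<Rightarrow> nat set \<Rightarrow> bool" where
  "module_on \<pi> S T \<longleftrightarrow> T \<subseteq> S \<and>
     (\<forall>x\<in>T. \<forall>z\<in>T. \<forall>y\<in>S. x < y \<and> y < z \<longrightarrow> y \<in> T) \<and>
     (\<forall>x\<in>T. \<forall>z\<in>T. \<forall>y\<in>S. \<pi> x < \<pi> y \<and> \<pi> y < \<pi> z \<longrightarrow> y \<in> T)"

definition simple_on :: "(nat \<Rightarrow> nat) \<Rightarrow> nat set \<Rightarrow> bool" where
  "simple_on \<pi> S \<longleftrightarrow> (\<forall>T. module_on \<pi> S T \<longrightarrow> card T \<le> 1 \<or> T = S)"

abbreviation increasing_on :: "nat set \<Rightarrow> (nat \<Rightarrow> nat) \<Rightarrow> bool" where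
  "increasing_on S \<equiv> monotone_on S (<) (<)"

abbreviation decreasing_on :: "nat set \<Rightarrow> (nat \<Rightarrow> nat) \<Rightarrow> bool" where
  "decreasing_on S \<equiv> monotone_on S (<) (>)"

definition pattern_bound :: "(nat \<Rightarrow> nat) \<Rightarrow> nat set \<Rightarrow> nat \<Rightarrow> bool" where
  "pattern_bound \<pi> S k \<longleftrightarrow>
     (simple_on \<pi> S \<longrightarrow> \<not> increasing_on S \<pi> \<longrightarrow> \<not> decreasing_on S \<pi> \<longrightarrow>
      (\<forall>D\<subseteq>S. decreasing_on D \<pi> \<longrightarrow> card D \<le> k))"

text \<open>The consequence of bounded intrinsic width on which everything later rests. Monotone
  patterns are exempt because a monotone permutation has intrinsic width 1 whatever its
  length.\<close>

definition simple_bound :: "nat \<Rightarrow> (nat \<Rightarrow> nat) \<Rightarrow> nat \<Rightarrow> bool" where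
  "simple_bound n \<pi> k \<longleftrightarrow> (\<forall>S\<subseteq>{1..n}. pattern_bound \<pi> S k)"

lemma simple_bound_mono: "simple_bound n \<pi> k \<Longrightarrow> k \<le> l \<Longrightarrow> simple_bound n \<pi> l"
  unfolding simple_bound_def pattern_bound_def by (meson order_trans)

text \<open>The condition depends only on the relative orders of positions and values. It is applied
  with the position inside a segment, with the number of the segment, and with the identity.\<close>

lemma pattern_bound_iso:
  assumes pos: "\<And>x y. x \<in> S \<Longrightarrow> y \<in> S \<Longrightarrow> x < y \<longleftrightarrow> g x < g y"
    and val: "\<And>x y. x \<in> S \<Longrightarrow> y \<in> S \<Longrightarrow> \<pi> x < \<pi> y \<longleftrightarrow> \<pi>' (g x) < \<pi>' (g y)"
    and b: "pattern_bound \<pi>' (g ` S) k"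
  shows "pattern_bound \<pi> S k"
  unfolding pattern_bound_def
proof (intro impI allI)
  assume s: "simple_on \<pi> S" and ni: "\<not> increasing_on S \<pi>" and nd: "\<not> decreasing_on S \<pi>"
  have inj: "inj_on g S"
    by (rule inj_onI) (metis pos less_irrefl linorder_cases)
  have dec: "decreasing_on (g ` D) \<pi>' \<longleftrightarrow> decreasing_on D \<pi>" if "D \<subseteq> S" for D
    using that pos val unfolding monotone_on_def by (simp add: subset_iff)
  have inc: "increasing_on (g ` D) \<pi>' \<longleftrightarrow> increasing_on D \<pi>" if "D \<subseteq> S" for D
    using that pos val unfolding monotone_on_def by (simp add: subset_iff)
  have "simple_on \<pi>' (g ` S)"
    unfolding simple_on_def
  proof (intro allI impI)
    fix T assume T: "module_on \<pi>' (g ` S) T"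
    define U where "U = {x \<in> S. g x \<in> T}"
    have gU: "g ` U = T" using T by (auto simp: U_def module_on_def)
    have "module_on \<pi> S U"
      unfolding module_on_def
    proof (intro conjI ballI impI)
      show "U \<subseteq> S" by (auto simp: U_def)
    next
      fix x z y assume "x \<in> U" "z \<in> U" "y \<in> S" "x < y \<and> y < z"
      moreover from this have "g x < g y" "g y < g z" using pos by (auto simp: U_def)
      ultimately show "y \<in> U" using T by (auto simp: U_def module_on_def)
    next
      fix x z y assume "x \<in> U" "z \<in> U" "y \<in> S" "\<pi> x < \<pi> y \<and> \<pi> y < \<pi> z"
      moreover from this have "\<pi>' (g x) < \<pi>' (g y)" "\<pi>' (g y) < \<pi>' (g z)" using val by (auto simp: U_def)
      ultimately show "y \<in> U" using T unfolding U_def module_on_def by blast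
    qed
    then have "card U \<le> 1 \<or> U = S" using s by (auto simp: simple_on_def)
    then show "card T \<le> 1 \<or> T = g ` S"
      using gU card_image[OF inj_on_subset[OF inj, of U]] by (auto simp: U_def)
  qed
  with b ni nd dec inc have "\<forall>D\<subseteq>g ` S. decreasing_on D \<pi>' \<longrightarrow> card D \<le> k"
    by (auto simp: pattern_bound_def)
  moreover fix D assume D: "D \<subseteq> S" "decreasing_on D \<pi>"
  ultimately have "card (g ` D) \<le> k" using dec by (metis image_mono)
  then show "card D \<le> k" using card_image[OF inj_on_subset[OF inj D(1)]] by simp
qed

section \<open>The two orders of an inflation\<close>

locale inflate =
  fixes n :: nat and \<sigma> :: "nat \<Rightarrow> nat" and m :: "nat \<Rightarrow> nat" and \<tau> :: "nat \<Rightarrow> nat \<Rightarrow> nat"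
  assumes s_inj: "inj_on \<sigma> {1..n}"
    and t_inj: "i \<in> {1..n} \<Longrightarrow> inj_on (\<tau> i) {1..m i}"
    and t_rng: "i \<in> {1..n} \<Longrightarrow> \<tau> i ` {1..m i} \<subseteq> {1..m i}"
begin

abbreviation "off j \<equiv> \<Sum>i\<in>{1..<j}. m i"
abbreviation "N \<equiv> \<Sum>i\<in>{1..n}. m i"

lemma segment_off: "1 \<le> j \<Longrightarrow> x \<in> segment m j \<longleftrightarrow> off j < x \<and> x \<le> off j + m j"
  by (cases j) (auto simp: segment_def atLeastLessThanSuc_atLeastAtMost)

lemma off_step: "1 \<le> i \<Longrightarrow> i < j \<Longrightarrow> off i + m i \<le> off j"
proof -
  assume *: "1 \<le> i" "i < j"
  have "off i + m i = off (Suc i)" using * by simp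
  also have "\<dots> \<le> off j" using * by (intro sum_mono2) auto
  finally show ?thesis .
qed

lemma segment_exists: "x \<in> {1..N} \<Longrightarrow> \<exists>j\<in>{1..n}. x \<in> segment m j"
proof -
  have "1 \<le> x \<Longrightarrow> x \<le> (\<Sum>i\<in>{1..l}. m i) \<Longrightarrow> \<exists>j\<in>{1..l}. x \<in> segment m j" for l
  proof (induction l)
    case (Suc l)
    show ?case
    proof (cases "x \<le> (\<Sum>i\<in>{1..l}. m i)")
      case True
      then show ?thesis using Suc by fastforce
    next
      case False
      then have "x \<in> segment m (Suc l)"
        using Suc.prems by (auto simp: segment_def atLeastLessThanSuc_atLeastAtMost)
      then show ?thesis by auto
    qed
  qed simp
  then show "x \<in> {1..N} \<Longrightarrow> ?thesis" by auto
qed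

definition seg :: "nat \<Rightarrow> nat" where
  "seg x = (THE j. j \<in> {1..n} \<and> x \<in> segment m j)"

lemma seg_unique: "i \<in> {1..n} \<Longrightarrow> j \<in> {1..n} \<Longrightarrow> x \<in> segment m i \<Longrightarrow> x \<in> segment m j \<Longrightarrow> i = j"
  using off_step[of i j] off_step[of j i] by (cases i j rule: linorder_cases) (auto simp: segment_off)

lemma seg_in: "x \<in> {1..N} \<Longrightarrow> seg x \<in> {1..n} \<and> x \<in> segment m (seg x)"
  unfolding seg_def by (rule theI') (use segment_exists seg_unique in blast)

abbreviation "loc x \<equiv> x - off (seg x)"

lemma seg_bounds:
  "x \<in> {1..N} \<Longrightarrow> off (seg x) < x \<and> x \<le> off (seg x) + m (seg x)"
  using seg_in[of x] segment_off[of "seg x" x] by auto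

lemma loc_in: "x \<in> {1..N} \<Longrightarrow> loc x \<in> {1..m (seg x)}"
  using seg_bounds[of x] by auto

lemma seg_less: "x \<in> {1..N} \<Longrightarrow> y \<in> {1..N} \<Longrightarrow> seg x \<noteq> seg y \<Longrightarrow> x < y \<longleftrightarrow> seg x < seg y"
  using seg_bounds[of x] seg_bounds[of y] seg_in[of x] seg_in[of y]
    off_step[of "seg x" "seg y"] off_step[of "seg y" "seg x"]
  by (cases "seg x" "seg y" rule: linorder_cases) auto

lemma seg_mono: "x \<in> {1..N} \<Longrightarrow> y \<in> {1..N} \<Longrightarrow> x \<le> y \<Longrightarrow> seg x \<le> seg y"
  using seg_less[of x y] by (cases "x = y") (force)+

abbreviation "base j \<equiv> \<Sum>i | i \<in> {1..n} \<and> \<sigma> i < \<sigma> j. m i"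

lemma inflation_eq: "x \<in> {1..N} \<Longrightarrow> inflation n \<sigma> m \<tau> x = base (seg x) + \<tau> (seg x) (loc x)"
  by (simp add: inflation_def seg_def Let_def)

lemma base_step:
  assumes "i \<in> {1..n}" "\<sigma> i < \<sigma> j"
  shows "base i + m i \<le> base j"
proof -
  have "base i + m i = sum m (insert i {l. l \<in> {1..n} \<and> \<sigma> l < \<sigma> i})" by simp
  also have "\<dots> \<le> base j" using assms by (intro sum_mono2) auto
  finally show ?thesis .
qed

lemma base_total: "i \<in> {1..n} \<Longrightarrow> base i + m i \<le> N"
proof -
  assume i: "i \<in> {1..n}"
  have "base i + m i = sum m (insert i {l. l \<in> {1..n} \<and> \<sigma> l < \<sigma> i})" by simp
  also have "\<dots> \<le> N" using i by (intro sum_mono2) auto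
  finally show ?thesis .
qed

lemma tau_loc: "x \<in> {1..N} \<Longrightarrow> 1 \<le> \<tau> (seg x) (loc x) \<and> \<tau> (seg x) (loc x) \<le> m (seg x)"
  using t_rng[of "seg x"] loc_in[of x] seg_in[of x] by fastforce

lemma inflation_less_diff:
  assumes "x \<in> {1..N}" "y \<in> {1..N}" "seg x \<noteq> seg y"
  shows "inflation n \<sigma> m \<tau> x < inflation n \<sigma> m \<tau> y \<longleftrightarrow> \<sigma> (seg x) < \<sigma> (seg y)"
proof -
  have "\<sigma> (seg x) \<noteq> \<sigma> (seg y)"
    using s_inj seg_in assms by (meson inj_onD)
  then show ?thesis
    using base_step[of "seg x" "seg y"] base_step[of "seg y" "seg x"] seg_in[OF assms(1)] seg_in[OF assms(2)]
      tau_loc[OF assms(1)] tau_loc[OF assms(2)] assms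
    by (cases "\<sigma> (seg x)" "\<sigma> (seg y)" rule: linorder_cases) (auto simp: inflation_eq)
qed

lemma inflation_less_same:
  assumes "x \<in> {1..N}" "y \<in> {1..N}" "seg x = seg y"
  shows "inflation n \<sigma> m \<tau> x < inflation n \<sigma> m \<tau> y \<longleftrightarrow> \<tau> (seg x) (loc x) < \<tau> (seg x) (loc y)"
  using assms by (simp add: inflation_eq)

lemma inflation_inj: "inj_on (inflation n \<sigma> m \<tau>) {1..N}"
proof (rule inj_onI)
  fix x y assume xy: "x \<in> {1..N}" "y \<in> {1..N}" and e: "inflation n \<sigma> m \<tau> x = inflation n \<sigma> m \<tau> y"
  have s: "seg x = seg y"
  proof (rule ccontr)
    assume ne: "seg x \<noteq> seg y"
    then have "\<sigma> (seg x) = \<sigma> (seg y)"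
      using inflation_less_diff[OF xy ne] inflation_less_diff[OF xy(2,1) ne[symmetric]] e by auto
    then show False using ne s_inj seg_in xy by (meson inj_onD)
  qed
  then have "\<tau> (seg x) (loc x) = \<tau> (seg x) (loc y)"
    using e xy by (simp add: inflation_eq)
  then have "loc x = loc y"
    using t_inj[of "seg x"] loc_in xy s seg_in by (metis inj_onD)
  then show "x = y" using s seg_bounds xy by (metis le_add_diff_inverse less_imp_le)
qed

lemma inflation_range: "inflation n \<sigma> m \<tau> ` {1..N} \<subseteq> {1..N}"
proof
  fix v assume "v \<in> inflation n \<sigma> m \<tau> ` {1..N}"
  then obtain x where x: "x \<in> {1..N}" "v = inflation n \<sigma> m \<tau> x" by auto
  then show "v \<in> {1..N}"
    using tau_loc[OF x(1)] base_total[of "seg x"] seg_in[OF x(1)] by (auto simp: inflation_eq)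
qed

lemma segment_module:
  assumes S: "S \<subseteq> {1..N}"
  shows "module_on (inflation n \<sigma> m \<tau>) S {x \<in> S. seg x = j}"
  unfolding module_on_def
proof (intro conjI ballI impI)
  fix x z y assume "x \<in> {x \<in> S. seg x = j}" "z \<in> {x \<in> S. seg x = j}" "y \<in> S" "x < y \<and> y < z"
  then show "y \<in> {x \<in> S. seg x = j}"
    using seg_mono[of x y] seg_mono[of y z] S by (auto simp: subset_iff)
next
  fix x z y assume *: "x \<in> {x \<in> S. seg x = j}" "z \<in> {x \<in> S. seg x = j}" "y \<in> S"
    "inflation n \<sigma> m \<tau> x < inflation n \<sigma> m \<tau> y \<and> inflation n \<sigma> m \<tau> y < inflation n \<sigma> m \<tau> z"
  then have "x \<in> {1..N}" "y \<in> {1..N}" "z \<in> {1..N}" using S by auto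
  then show "y \<in> {x \<in> S. seg x = j}"
    using inflation_less_diff[of x y] inflation_less_diff[of y z] *
    by (cases "seg y = j") auto
qed auto

text \<open>Each segment cuts a module out of the pattern S. If S is simple, either one segment
  contains all of S, which is then a pattern of one of the inflating permutations, or every segment
  contains at most one point, and S is a pattern of \<open>\<sigma>\<close>.\<close>

lemma inflation_simple_bound:
  assumes sb: "simple_bound n \<sigma> k" and tb: "\<And>i. i \<in> {1..n} \<Longrightarrow> simple_bound (m i) (\<tau> i) k"
  shows "simple_bound N (inflation n \<sigma> m \<tau>) k"
  unfolding simple_bound_def
proof (intro allI impI)
  fix S assume S: "S \<subseteq> {1..N}"
  let ?\<theta> = "inflation n \<sigma> m \<tau>"
  show "pattern_bound ?\<theta> S k"
  proof (cases "simple_on ?\<theta> S")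
    case False
    then show ?thesis by (simp add: pattern_bound_def)
  next
    case True
    then have cs: "card {x \<in> S. seg x = j} \<le> 1 \<or> {x \<in> S. seg x = j} = S" for j
      using segment_module[OF S, of j] by (auto simp: simple_on_def)
    show ?thesis
    proof (cases "\<exists>j. {x \<in> S. seg x = j} = S")
      case True
      then obtain j where j: "\<And>x. x \<in> S \<Longrightarrow> seg x = j" by blast
      show ?thesis
      proof (cases "S = {}")
        case True
        then show ?thesis by (auto simp: pattern_bound_def)
      next
        case False
        then have jn: "j \<in> {1..n}" using j seg_in S by blast
        show ?thesis
        proof (rule pattern_bound_iso[where g = loc and \<pi>' = "\<tau> j"])
          fix x y assume "x \<in> S" "y \<in> S"
          then have xy: "x \<in> {1..N}" "y \<in> {1..N}" "seg x = j" "seg y = j" using S j by auto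
          show "x < y \<longleftrightarrow> loc x < loc y"
            using xy seg_bounds[OF xy(1)] seg_bounds[OF xy(2)] by auto
          show "?\<theta> x < ?\<theta> y \<longleftrightarrow> \<tau> j (loc x) < \<tau> j (loc y)"
            using inflation_less_same[OF xy(1,2)] xy by simp
        next
          have "loc ` S \<subseteq> {1..m j}" using loc_in j S by force
          then show "pattern_bound (\<tau> j) (loc ` S) k"
            using tb[OF jn] by (simp add: simple_bound_def)
        qed
      qed
    next
      case False
      then have c1: "card {x \<in> S. seg x = j} \<le> 1" for j using cs by blast
      have fin: "finite S" using S finite_subset by blast
      have ne: "seg x \<noteq> seg y" if "x \<in> S" "y \<in> S" "x \<noteq> y" for x y
      proof
        assume "seg x = seg y"
        then have "card {x, y} \<le> card {z \<in> S. seg z = seg x}"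
          using that fin by (intro card_mono) auto
        with c1[of "seg x"] that show False by simp
      qed
      show ?thesis
      proof (rule pattern_bound_iso[where g = seg and \<pi>' = \<sigma>])
        fix x y assume xy: "x \<in> S" "y \<in> S"
        then have xyN: "x \<in> {1..N}" "y \<in> {1..N}" using S by auto
        show "x < y \<longleftrightarrow> seg x < seg y"
          using ne[OF xy] seg_less[OF xyN] by (cases "x = y") auto
        show "?\<theta> x < ?\<theta> y \<longleftrightarrow> \<sigma> (seg x) < \<sigma> (seg y)"
          using ne[OF xy] inflation_less_diff[OF xyN] by (cases "x = y") auto
      next
        have "seg ` S \<subseteq> {1..n}" using seg_in S by blast
        then show "pattern_bound \<sigma> (seg ` S) k"
          using sb by (simp add: simple_bound_def)
      qed
    qed
  qed
qed

end

lemma perm_width_ge: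
  assumes "D \<subseteq> {1..n}" "decreasing_on D \<pi>"
  shows "card D \<le> perm_width n \<pi>"
proof -
  have "{card S | S. S \<subseteq> {1..n} \<and> decreasing_on S \<pi>} \<subseteq> card ` Pow {1..n}" by auto
  then have "finite {card S | S. S \<subseteq> {1..n} \<and> decreasing_on S \<pi>}"
    by (rule finite_subset) simp
  then show ?thesis unfolding perm_width_def by (rule Max_ge) (use assms in blast)
qed

text \<open>Injectivity and range are carried through the induction because the comparison of values
  across segments rests on them. In the base cases a pattern inherits monotonicity, or its
  decreasing subsets are decreasing subsets of the whole permutation.\<close>

lemma intrinsic_width_simple_bound:
  "has_intrinsic_width n \<pi> w \<Longrightarrow>
     inj_on \<pi> {1..n} \<and> \<pi> ` {1..n} \<subseteq> {1..n} \<and> simple_bound n \<pi> w"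
proof (induction rule: has_intrinsic_width.induct)
  case (monotone \<pi> n)
  then have "pattern_bound \<pi> S 1" if "S \<subseteq> {1..n}" for S
    using that monotone_on_subset[of "{1..n}" _ _ \<pi> S] by (auto simp: pattern_bound_def monotone_perm_def)
  then have "simple_bound n \<pi> 1" by (simp add: simple_bound_def)
  then show ?case
    using permutes_inj_on[OF monotone(1)] permutes_image[OF monotone(1)] by simp
next
  case (simple \<pi> n)
  then have "simple_bound n \<pi> (perm_width n \<pi>)"
    using perm_width_ge unfolding simple_bound_def pattern_bound_def by (meson order_trans)
  then show ?case
    using permutes_inj_on[OF simple(1)] permutes_image[OF simple(1)] by simp
next
  case (inflate n \<sigma> w m \<tau> v)
  interpret inflate n \<sigma> m \<tau> using inflate.IH by unfold_locales auto
  let ?k = "Max (insert w (v ` {1..n}))"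
  have "simple_bound n \<sigma> ?k" using inflate.IH by (auto intro: simple_bound_mono)
  moreover have "simple_bound (m i) (\<tau> i) ?k" if "i \<in> {1..n}" for i
  proof (rule simple_bound_mono)
    show "simple_bound (m i) (\<tau> i) (v i)" using inflate.IH(2) that by auto
    show "v i \<le> ?k" using that by (intro Max_ge) auto
  qed
  ultimately show ?case
    using inflation_inj inflation_range inflation_simple_bound by blast
qed

section \<open>Sorting a minimal non-increasing block\<close>

text \<open>Stated with maximum and minimum because the program keeps just these two numbers; for
  injective maps on a nonempty interval it means that the image is an interval.\<close>

definition contiguous :: "(nat \<Rightarrow> nat) \<Rightarrow> nat \<Rightarrow> nat \<Rightarrow> bool" where
  "contiguous \<tau> a b \<longleftrightarrow> Max (\<tau> ` {a..b}) = Min (\<tau> ` {a..b}) + (b - a)"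

lemma contiguous_iff:
  assumes "inj_on \<tau> {a..b}" "a \<le> b"
  shows "contiguous \<tau> a b \<longleftrightarrow> \<tau> ` {a..b} = {Min (\<tau> ` {a..b})..Min (\<tau> ` {a..b}) + (b - a)}"
proof
  assume *: "contiguous \<tau> a b"
  show "\<tau> ` {a..b} = {Min (\<tau> ` {a..b})..Min (\<tau> ` {a..b}) + (b - a)}"
  proof (rule card_subset_eq)
    show "\<tau> ` {a..b} \<subseteq> {Min (\<tau> ` {a..b})..Min (\<tau> ` {a..b}) + (b - a)}"
      unfolding *[unfolded contiguous_def, symmetric] by (auto intro: Min_le Max_ge)
    show "card (\<tau> ` {a..b}) = card {Min (\<tau> ` {a..b})..Min (\<tau> ` {a..b}) + (b - a)}"
      using assms by (simp add: card_image)
  qed simp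
next
  assume *: "\<tau> ` {a..b} = {Min (\<tau> ` {a..b})..Min (\<tau> ` {a..b}) + (b - a)}"
  show "contiguous \<tau> a b"
    unfolding contiguous_def by (subst (1) *) (rule Max_eqI, auto)
qed

lemma contiguousI:
  assumes "inj_on \<tau> {a..b}" "a \<le> b" "\<tau> ` {a..b} = {c..d}"
  shows "contiguous \<tau> a b"
proof -
  have "card {c..d} = Suc (b - a)" using card_image[OF assms(1)] assms(2,3) by simp
  then have "d = c + (b - a)" by simp
  moreover have "Min {c..d} = c" "Max {c..d} = d" by (rule Min_eqI Max_eqI; use calculation in auto)+
  ultimately show ?thesis by (simp add: contiguous_def assms(3))
qed

definition unsorted_block :: "(nat \<Rightarrow> nat) \<Rightarrow> nat \<Rightarrow> nat \<Rightarrow> bool" where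
  "unsorted_block \<tau> a b \<longleftrightarrow> 1 \<le> a \<and> a \<le> b \<and> \<not> increasing_on {a..b} \<tau> \<and> contiguous \<tau> a b"

definition minimal_block :: "(nat \<Rightarrow> nat) \<Rightarrow> nat \<Rightarrow> nat \<Rightarrow> bool" where
  "minimal_block \<tau> a b \<longleftrightarrow> unsorted_block \<tau> a b \<and>
     (\<forall>a' b'. a \<le> a' \<and> b' \<le> b \<and> (a' \<noteq> a \<or> b' \<noteq> b) \<longrightarrow> \<not> unsorted_block \<tau> a' b')"

definition sort_block :: "nat \<Rightarrow> nat \<Rightarrow> nat \<Rightarrow> (nat \<Rightarrow> nat) \<Rightarrow> nat \<Rightarrow> nat" where
  "sort_block a b c \<tau> x = (if a \<le> x \<and> x \<le> b then c + (x - a) else \<tau> x)"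

definition successions :: "nat \<Rightarrow> (nat \<Rightarrow> nat) \<Rightarrow> nat set" where
  "successions n \<tau> = {i \<in> {1..<n}. \<tau> (Suc i) = Suc (\<tau> i)}"

lemma increasing_onI_Suc:
  assumes "\<And>x. a \<le> x \<Longrightarrow> x < b \<Longrightarrow> \<tau> x < \<tau> (Suc x)"
  shows "increasing_on {a..b} \<tau>"
proof -
  have "\<tau> x < \<tau> y" if "x < y" "a \<le> x" "y \<le> b" for x y
    using that
  proof (induction y)
    case (Suc y)
    then show ?case using assms[of y] by (cases "x = y") auto
  qed simp
  then show ?thesis by (auto simp: monotone_on_def)
qed

section \<open>Sorting one contiguous block\<close>

locale block =
  fixes n :: nat and \<tau> :: "nat \<Rightarrow> nat" and a b c :: nat
  assumes bij: "bij_betw \<tau> {1..n} {1..n}"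
    and ab: "1 \<le> a" "a \<le> b" "b \<le> n"
    and img: "\<tau> ` {a..b} = {c..c + (b - a)}"
begin

abbreviation "B \<equiv> {a..b}"
abbreviation "\<tau>' \<equiv> sort_block a b c \<tau>"

lemma B_sub: "B \<subseteq> {1..n}" using ab by auto

lemma inj: "inj_on \<tau> {1..n}" using bij by (rule bij_betw_imp_inj_on)

lemma injB: "inj_on \<tau> B" using inj B_sub by (rule inj_on_subset)

lemma val_in: "x \<in> {1..n} \<Longrightarrow> \<tau> x \<in> {c..c + (b - a)} \<longleftrightarrow> x \<in> B"
  using inj_on_image_mem_iff[OF inj _ B_sub, of x] img by simp

lemma sort_in: "x \<in> B \<Longrightarrow> \<tau>' x = c + (x - a)" and sort_out: "x \<notin> B \<Longrightarrow> \<tau>' x = \<tau> x"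
  by (auto simp: sort_block_def)

lemma sort_in_range: "x \<in> B \<Longrightarrow> c \<le> \<tau>' x \<and> \<tau>' x \<le> c + (b - a)"
  by (auto simp: sort_in)

lemma val_out: "x \<in> {1..n} \<Longrightarrow> x \<notin> B \<Longrightarrow> \<tau> x < c \<or> c + (b - a) < \<tau> x"
  using val_in[of x] by auto

lemma val_range: "x \<in> B \<Longrightarrow> c \<le> \<tau> x \<and> \<tau> x \<le> c + (b - a)"
  using img by (metis atLeastAtMost_iff imageI)

text \<open>Sorting permutes the values of B among themselves, and the value at a position outside B
  is below all of them or above all of them.\<close>

lemma sort_less:
  assumes "x \<in> {1..n}" "y \<in> {1..n}" "\<not> (x \<in> B \<and> y \<in> B)"
  shows "\<tau>' x < \<tau>' y \<longleftrightarrow> \<tau> x < \<tau> y"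
  using val_range[of x] val_range[of y] val_out[OF assms(1)] val_out[OF assms(2)]
    sort_in_range[of x] sort_in_range[of y] assms(3)
  by (cases "x \<in> B"; cases "y \<in> B") (auto simp: sort_out)

lemma sort_image: "\<tau>' ` B = {c..c + (b - a)}"
proof
  show "{c..c + (b - a)} \<subseteq> \<tau>' ` B"
  proof
    fix v assume "v \<in> {c..c + (b - a)}"
    then have "v = \<tau>' (a + (v - c))" "a + (v - c) \<in> B" using ab by (auto simp: sort_block_def)
    then show "v \<in> \<tau>' ` B" by blast
  qed
qed (use sort_in_range in auto)

lemma sort_bij: "bij_betw \<tau>' {1..n} {1..n}"
proof -
  have "bij_betw \<tau> ({1..n} - B) ({1..n} - {c..c + (b - a)})"
    using bij_betw_subset[OF bij, of "{1..n} - B"] inj_on_image_set_diff[OF inj _ B_sub, of "{1..n}"]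
      bij_betw_imp_surj_on[OF bij] img by (simp add: Diff_subset)
  then have 1: "bij_betw \<tau>' ({1..n} - B) ({1..n} - {c..c + (b - a)})"
    by (rule bij_betw_cong[THEN iffD1, rotated]) (simp add: sort_out)
  have "inj_on \<tau>' B" by (rule inj_onI) (auto simp: sort_in)
  then have "bij_betw \<tau>' B {c..c + (b - a)}" using sort_image by (simp add: bij_betw_def)
  from bij_betw_combine[OF 1 this] have *: "bij_betw \<tau>' ({1..n} - B \<union> B) ({1..n} - {c..c + (b - a)} \<union> {c..c + (b - a)})"
    by blast
  have "{c..c + (b - a)} \<subseteq> {1..n}"
    using image_mono[OF B_sub, of \<tau>] img bij_betw_imp_surj_on[OF bij] by simp
  then have "{1..n} - {c..c + (b - a)} \<union> {c..c + (b - a)} = {1..n}" by blast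
  moreover have "{1..n} - B \<union> B = {1..n}" using B_sub by blast
  ultimately show ?thesis using * by simp
qed

lemma sort_increasing: "increasing_on B \<tau>'"
  by (auto simp: monotone_on_def sort_block_def)

text \<open>B meets every pattern S of the sorted map in a module. For simple S either at most one
  point lies in B, and then S looks the same before sorting, or S lies inside B and is increasing,
  hence exempt.\<close>

lemma sort_simple_bound:
  assumes "simple_bound n \<tau> k"
  shows "simple_bound n \<tau>' k"
  unfolding simple_bound_def
proof (intro allI impI)
  fix S assume S: "S \<subseteq> {1..n}"
  show "pattern_bound \<tau>' S k"
  proof (cases "simple_on \<tau>' S")
    case False
    then show ?thesis by (simp add: pattern_bound_def)
  next
    case True
    have "module_on \<tau>' S (S \<inter> B)"
      unfolding module_on_def
    proof (intro conjI ballI impI)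
      fix x z y assume *: "x \<in> S \<inter> B" "z \<in> S \<inter> B" "y \<in> S" "\<tau>' x < \<tau>' y \<and> \<tau>' y < \<tau>' z"
      show "y \<in> S \<inter> B"
      proof (rule ccontr)
        assume "y \<notin> S \<inter> B"
        then have "y \<notin> B" "y \<in> {1..n}" using * S by auto
        then show False
          using val_out[of y] sort_in_range[of x] sort_in_range[of z] * by (auto simp: sort_out)
      qed
    qed auto
    then consider "card (S \<inter> B) \<le> 1" | "S \<inter> B = S" using True by (auto simp: simple_on_def)
    then show ?thesis
    proof cases
      case 1
      have fin: "finite (S \<inter> B)" by simp
      have eq: "x = y" if "x \<in> S" "y \<in> S" "x \<in> B" "y \<in> B" for x y
        using 1 that card_le_Suc0_iff_eq[OF fin] by auto
      show ?thesis
      proof (rule pattern_bound_iso[where g = id and \<pi>' = \<tau>])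
        show "pattern_bound \<tau> (id ` S) k" using assms S by (simp add: simple_bound_def)
        show "\<tau>' x < \<tau>' y \<longleftrightarrow> \<tau> (id x) < \<tau> (id y)" if "x \<in> S" "y \<in> S" for x y
          using eq[OF that] sort_less[OF subsetD[OF S that(1)] subsetD[OF S that(2)]] by (cases "x = y") auto
      qed simp
    next
      case 2
      then have "increasing_on S \<tau>'" using sort_increasing monotone_on_subset[of B _ _ \<tau>' S] by blast
      then show ?thesis by (simp add: pattern_bound_def)
    qed
  qed
qed

text \<open>No succession is lost: one that crosses the border of B forces the value at that end of
  B to be the extreme value of the block, and sorting leaves it there. A descent inside B becomes a
  new succession.\<close>

lemma sort_successions:
  assumes "\<not> increasing_on B \<tau>"
  shows "card (successions n \<tau>) < card (successions n \<tau>')"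
proof (rule psubset_card_mono)
  show "finite (successions n \<tau>')" by (simp add: successions_def)
  obtain x where x: "a \<le> x" "x < b" "\<not> \<tau> x < \<tau> (Suc x)"
    using assms increasing_onI_Suc[of a b \<tau>] by blast
  then have "x \<notin> successions n \<tau>" "x \<in> successions n \<tau>'"
    using ab by (auto simp: successions_def sort_block_def)
  moreover have "successions n \<tau> \<subseteq> successions n \<tau>'"
  proof
    fix i assume "i \<in> successions n \<tau>"
    then have i: "1 \<le> i" "i < n" "\<tau> (Suc i) = Suc (\<tau> i)" by (auto simp: successions_def)
    have in1: "i \<in> {1..n}" and in2: "Suc i \<in> {1..n}" using i by auto
    have "\<tau>' (Suc i) = Suc (\<tau>' i)"
    proof (cases "i \<in> B"; cases "Suc i \<in> B")
      assume "i \<in> B" "Suc i \<notin> B"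
      then have "i = b" by auto
      then show ?thesis
        using val_out[OF in2 \<open>Suc i \<notin> B\<close>] val_range[OF \<open>i \<in> B\<close>] i ab by (auto simp: sort_block_def)
    next
      assume "i \<notin> B" "Suc i \<in> B"
      then have "Suc i = a" by auto
      then show ?thesis
        using val_out[OF in1 \<open>i \<notin> B\<close>] val_range[OF \<open>Suc i \<in> B\<close>] i ab by (auto simp: sort_block_def)
    qed (use i in \<open>auto simp: sort_block_def\<close>)
    then show "i \<in> successions n \<tau>'" using i by (auto simp: successions_def)
  qed
  ultimately show "successions n \<tau> \<subset> successions n \<tau>'" by blast
qed

text \<open>
  Every linear extension of the whole poset splits uniquely as \<open>\<rho> \<circ> \<gamma>\<close>, where \<open>\<rho>\<close> traverses the
  block in increasing order and \<open>\<gamma>\<close> rearranges only the block.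
\<close>

lemma card_linexts_factor:
  "card (linexts {1..n} \<tau>) = card (linexts B \<tau>) * card (linexts {1..n} \<tau>')"
proof -
  let ?f = "\<lambda>(\<rho>, \<gamma>). \<rho> \<circ> \<gamma> :: nat \<Rightarrow> nat"
  have inc: "\<rho> x < \<rho> y \<longleftrightarrow> x < y" if "\<rho> \<in> linexts {1..n} \<tau>'" "x \<in> B" "y \<in> B" for \<rho> x y
  proof -
    have lt: "u \<in> B \<Longrightarrow> v \<in> B \<Longrightarrow> u < v \<Longrightarrow> \<rho> u < \<rho> v" for u v
      using that(1) B_sub sort_increasing unfolding linexts_def monotone_on_def by blast
    show ?thesis using lt[OF that(2,3)] lt[OF that(3,2)] by (cases x y rule: linorder_cases) auto
  qed
  have memB: "\<gamma> x \<in> B \<longleftrightarrow> x \<in> B" if "\<gamma> \<in> linexts B \<tau>" for \<gamma> x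
    using that permutes_in_image[of \<gamma> B x] by (simp add: linexts_def)
  have out: "\<gamma> x = x" if "\<gamma> \<in> linexts B \<tau>" "x \<notin> B" for \<gamma> x
    using that permutes_not_in[of \<gamma> B x] by (simp add: linexts_def)
  have "bij_betw ?f (linexts {1..n} \<tau>' \<times> linexts B \<tau>) (linexts {1..n} \<tau>)"
  proof (rule bij_betw_imageI)
    show "inj_on ?f (linexts {1..n} \<tau>' \<times> linexts B \<tau>)"
    proof (rule inj_onI, clarify)
      fix \<rho> \<gamma> \<rho>2 \<gamma>2
      assume r: "\<rho> \<in> linexts {1..n} \<tau>'" "\<rho>2 \<in> linexts {1..n} \<tau>'"
        and g: "\<gamma> \<in> linexts B \<tau>" "\<gamma>2 \<in> linexts B \<tau>" and e: "\<rho> \<circ> \<gamma> = \<rho>2 \<circ> \<gamma>2"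
      have gp: "\<gamma> permutes B" "\<gamma>2 permutes B" using g by (auto simp: linexts_def)
      have rk: "\<gamma> x = \<gamma>2 x" for x
      proof (cases "x \<in> B")
        case False
        then show ?thesis using out[OF g(1) False] out[OF g(2) False] by simp
      next
        case True
        have less: "\<gamma> y < \<gamma> x \<longleftrightarrow> \<gamma>2 y < \<gamma>2 x" if "y \<in> B" for y
          using inc[OF r(1), of "\<gamma> y" "\<gamma> x"] inc[OF r(2), of "\<gamma>2 y" "\<gamma>2 x"] memB g that True
            fun_cong[OF e, of x] fun_cong[OF e, of y] by simp
        \<comment> \<open>The composite determines \<open>\<gamma>\<close>: since
          \<open>\<rho>\<close> is increasing on B, the composite orders B as
          \<open>\<gamma>\<close> does, and a permutation of B is recovered from the order it
          induces.\<close>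
        have rank: "\<delta> x = a + card {y \<in> B. \<delta> y < \<delta> x}" if d: "\<delta> permutes B" for \<delta>
        proof -
          have "\<delta> ` {y \<in> B. \<delta> y < \<delta> x} = {v \<in> \<delta> ` B. v < \<delta> x}" by auto
          also have "\<dots> = {a..<\<delta> x}" using permutes_image[OF d] permutes_in_image[OF d, of x] True by auto
          finally have "card {y \<in> B. \<delta> y < \<delta> x} = \<delta> x - a"
            using card_image[OF permutes_inj_on[OF d], of "{y \<in> B. \<delta> y < \<delta> x}"] by simp
          then show ?thesis using permutes_in_image[OF d, of x] True by auto
        qed
        have "{y \<in> B. \<gamma> y < \<gamma> x} = {y \<in> B. \<gamma>2 y < \<gamma>2 x}" using less by auto
        then show ?thesis using rank[OF gp(1)] rank[OF gp(2)] by simp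
      qed
      then have "\<gamma> = \<gamma>2" by auto
      moreover have "\<rho> = \<rho>2"
      proof
        fix x
        have "\<rho> (\<gamma> (inv \<gamma> x)) = \<rho>2 (\<gamma> (inv \<gamma> x))"
          using fun_cong[OF e, of "inv \<gamma> x"] \<open>\<gamma> = \<gamma>2\<close> by simp
        then show "\<rho> x = \<rho>2 x" by (simp add: permutes_inverses[OF gp(1)])
      qed
      ultimately show "\<rho> = \<rho>2 \<and> \<gamma> = \<gamma>2" by simp
    qed
    show "?f ` (linexts {1..n} \<tau>' \<times> linexts B \<tau>) = linexts {1..n} \<tau>"
    proof (rule set_eqI, rule iffI)
      fix \<theta> assume "\<theta> \<in> ?f ` (linexts {1..n} \<tau>' \<times> linexts B \<tau>)"
      then obtain \<rho> \<gamma> where r: "\<rho> \<in> linexts {1..n} \<tau>'" and g: "\<gamma> \<in> linexts B \<tau>" and t: "\<theta> = \<rho> \<circ> \<gamma>"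
        by auto
      have "\<theta> permutes {1..n}"
        using r g t permutes_compose[of \<gamma> "{1..n}" \<rho>] permutes_subset[of \<gamma> B "{1..n}"] B_sub
        by (simp add: linexts_def)
      moreover have "\<rho> (\<gamma> x) < \<rho> (\<gamma> y)" if xy: "x \<in> {1..n}" "y \<in> {1..n}" "x < y" "\<tau> x < \<tau> y" for x y
      proof (cases "x \<in> B \<and> y \<in> B")
        case True
        then have "\<gamma> x < \<gamma> y" using g xy by (auto simp: linexts_def)
        then show ?thesis using inc[OF r] memB[OF g] True by simp
      next
        case False
        have gin: "\<gamma> z \<in> {1..n}" if "z \<in> {1..n}" for z
          using that memB[OF g, of z] out[OF g, of z] B_sub by (cases "z \<in> B") auto
        have nB: "\<not> (\<gamma> x \<in> B \<and> \<gamma> y \<in> B)" using False memB[OF g] by simp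
        \<comment> \<open>An outside point compares in the same way with all points of B, in
          position and in value, so moving the other point within B keeps both inequalities.\<close>
        have "\<gamma> x < \<gamma> y \<and> \<tau> (\<gamma> x) < \<tau> (\<gamma> y)"
        proof (cases "x \<in> B")
          case True
          then have y: "y \<notin> B" "\<gamma> y = y" using False out[OF g] by auto
          have "\<gamma> x \<in> B" using True memB[OF g] by simp
          then show ?thesis
            using y xy True val_range[of x] val_range[of "\<gamma> x"] val_out[of y] by auto
        next
          case x: False
          show ?thesis
          proof (cases "y \<in> B")
            case True
            then have "\<gamma> y \<in> B" using memB[OF g] by simp
            then show ?thesis
              using x out[OF g x] xy True val_range[of y] val_range[of "\<gamma> y"] val_out[of x] by auto
          next
            case False
            then show ?thesis using x out[OF g] xy by simp
          qed
        qed
        then show ?thesis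
          using r gin[OF xy(1)] gin[OF xy(2)] sort_less[OF gin[OF xy(1)] gin[OF xy(2)] nB]
          by (auto simp: linexts_def)
      qed
      ultimately show "\<theta> \<in> linexts {1..n} \<tau>" by (auto simp: linexts_def t)
    next
      fix \<theta> assume th: "\<theta> \<in> linexts {1..n} \<tau>"
      then have tp: "\<theta> permutes {1..n}" by (simp add: linexts_def)
      have tinj: "\<theta> x = \<theta> y \<longleftrightarrow> x = y" for x y using permutes_inj[OF tp] by (auto dest: injD)
      \<comment> \<open>The rank of \<open>\<theta>\<close> among the points of B, shifted by a, is
        the only candidate: it orders B as \<open>\<theta>\<close> does and takes its values in
        {a..b}.\<close>
      define rk where "rk x = a + card {y \<in> B. \<theta> y < \<theta> x}" for x
      define \<gamma> where "\<gamma> x = (if x \<in> B then rk x else x)" for x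
      have rk_less: "rk x < rk y" if "x \<in> B" "y \<in> B" "\<theta> x < \<theta> y" for x y
        unfolding rk_def using that by (auto intro!: psubset_card_mono)
      have rk_iff: "rk x < rk y \<longleftrightarrow> \<theta> x < \<theta> y" if "x \<in> B" "y \<in> B" for x y
        using rk_less[OF that] rk_less[OF that(2,1)] tinj[of x y]
        by (cases "\<theta> x" "\<theta> y" rule: linorder_cases) auto
      have "inj_on rk B"
        by (rule inj_onI) (metis rk_iff less_irrefl linorder_cases tinj)
      moreover have "rk ` B \<subseteq> B"
      proof clarify
        fix x assume x: "x \<in> B"
        have "card {y \<in> B. \<theta> y < \<theta> x} \<le> card (B - {x})"
          by (rule card_mono) auto
        also have "\<dots> < card B" using x by (intro card_Diff1_less) simp_all
        finally show "rk x \<in> B" using ab by (simp add: rk_def)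
      qed
      ultimately have "bij_betw rk B B"
        by (simp add: bij_betw_def endo_inj_surj)
      then have "bij_betw \<gamma> B B"
        by (rule bij_betw_cong[THEN iffD1, rotated]) (simp add: \<gamma>_def)
      then have gp: "\<gamma> permutes B" by (rule bij_imp_permutes) (auto simp: \<gamma>_def)
      have giff: "\<gamma> x < \<gamma> y \<longleftrightarrow> \<theta> x < \<theta> y" if "x \<in> B" "y \<in> B" for x y
        using that rk_iff by (simp add: \<gamma>_def)
      have g: "\<gamma> \<in> linexts B \<tau>"
        using gp giff th B_sub unfolding linexts_def by blast
      let ?\<rho> = "\<theta> \<circ> inv \<gamma>"
      have igB: "inv \<gamma> x \<in> B \<longleftrightarrow> x \<in> B" for x by (rule permutes_in_image[OF permutes_inv[OF gp]])
      have ign: "inv \<gamma> x \<in> {1..n}" if "x \<in> {1..n}" for x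
        using that permutes_in_image[OF permutes_subset[OF permutes_inv[OF gp] B_sub], of x] by blast
      have igo: "inv \<gamma> x = x" if "x \<notin> B" for x
        using permutes_not_in[OF permutes_inv[OF gp]] that .
      have "?\<rho> permutes {1..n}"
        by (rule permutes_compose[OF permutes_subset[OF permutes_inv[OF gp] B_sub] tp])
      moreover have "?\<rho> x < ?\<rho> y"
        if xy: "x \<in> {1..n}" "y \<in> {1..n}" "x < y" "\<tau>' x < \<tau>' y" for x y
      proof (cases "x \<in> B \<and> y \<in> B")
        case True
        then show ?thesis
          using giff[of "inv \<gamma> x" "inv \<gamma> y"] igB xy by (simp add: permutes_inverses[OF gp])
      next
        case False
        then have t: "\<tau> x < \<tau> y" using sort_less[OF xy(1,2) False] xy by simp
        have "inv \<gamma> x < inv \<gamma> y \<and> \<tau> (inv \<gamma> x) < \<tau> (inv \<gamma> y)"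
        proof (cases "x \<in> B")
          case True
          then have y: "y \<notin> B" "inv \<gamma> y = y" using False igo by auto
          have "inv \<gamma> x \<in> B" using True igB by simp
          then show ?thesis
            using y xy t True val_range[of x] val_range[of "inv \<gamma> x"] val_out[of y] by auto
        next
          case x: False
          show ?thesis
          proof (cases "y \<in> B")
            case True
            then have "inv \<gamma> y \<in> B" using igB by simp
            then show ?thesis
              using x igo[OF x] xy t True val_range[of y] val_range[of "inv \<gamma> y"] val_out[of x] by auto
          next
            case False
            then show ?thesis using x igo xy t by simp
          qed
        qed
        then show ?thesis using th ign[OF xy(1)] ign[OF xy(2)] by (auto simp: linexts_def)
      qed
      ultimately have "?\<rho> \<in> linexts {1..n} \<tau>'" by (auto simp: linexts_def)
      moreover have "\<theta> = ?\<rho> \<circ> \<gamma>" by (auto simp: permutes_inverses[OF gp])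
      ultimately show "\<theta> \<in> ?f ` (linexts {1..n} \<tau>' \<times> linexts B \<tau>)"
        using g by (intro image_eqI[of _ _ "(?\<rho>, \<gamma>)"]) simp_all
    qed
  qed
  then have "card (linexts {1..n} \<tau>' \<times> linexts B \<tau>) = card (linexts {1..n} \<tau>)"
    by (rule bij_betw_same_card)
  then show ?thesis by (simp add: card_cartesian_product mult.commute)
qed

end

lemma card_ge2_obtain:
  assumes "\<not> card T \<le> 1"
  obtains x y where "x \<in> T" "y \<in> T" "x < (y::nat)"
proof -
  have "finite T" using assms card.infinite[of T] by fastforce
  then obtain x y where "x \<in> T" "y \<in> T" "x \<noteq> y" using assms card_le_Suc0_iff_eq[of T] by auto
  then show ?thesis using that[of x y] that[of y x] by (cases x y rule: linorder_cases) auto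
qed

section \<open>Runs of consecutive values in a minimal block\<close>

locale min_block =
  fixes n :: nat and \<tau> :: "nat \<Rightarrow> nat" and a b :: nat
  assumes bij: "bij_betw \<tau> {1..n} {1..n}" and bn: "b \<le> n" and mb: "minimal_block \<tau> a b"
begin

lemma unsorted: "1 \<le> a" "a \<le> b" "\<not> increasing_on {a..b} \<tau>" "contiguous \<tau> a b"
  using mb by (auto simp: minimal_block_def unsorted_block_def)

lemma inj: "inj_on \<tau> {a..b}"
  by (rule inj_on_subset[OF bij_betw_imp_inj_on[OF bij]]) (use unsorted bn in auto)

sublocale block n \<tau> a b "Min (\<tau> ` {a..b})"
  by unfold_locales (use bij bn unsorted contiguous_iff[OF inj] in auto)

text \<open>
  The maximal runs of consecutive values partition the block; the starting points of the runs
  form a simple pattern because a union of several, but not all, runs is no sorted block.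
\<close>

definition starts :: "nat set" where
  "starts = {x \<in> B. x = a \<or> \<tau> x \<noteq> Suc (\<tau> (x - 1))}"

definition start :: "nat \<Rightarrow> nat" where
  "start x = Max {y \<in> starts. y \<le> x}"

lemma starts_sub: "starts \<subseteq> B" by (auto simp: starts_def)

lemma finite_starts: "finite starts" using starts_sub finite_subset by blast

lemma start_set: "x \<in> B \<Longrightarrow> finite {y \<in> starts. y \<le> x} \<and> a \<in> {y \<in> starts. y \<le> x}"
  using finite_starts by (auto simp: starts_def)

lemma start_in: "x \<in> B \<Longrightarrow> start x \<in> starts \<and> start x \<le> x"
  using Max_in[of "{y \<in> starts. y \<le> x}"] start_set[of x] unfolding start_def by blast

lemma start_ge: "x \<in> B \<Longrightarrow> y \<in> starts \<Longrightarrow> y \<le> x \<Longrightarrow> y \<le> start x"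
  unfolding start_def using start_set[of x] by (intro Max_ge) auto

lemma start_mono: "x \<in> B \<Longrightarrow> y \<in> B \<Longrightarrow> x \<le> y \<Longrightarrow> start x \<le> start y"
  using start_ge[of y "start x"] start_in[of x] by auto

lemma start_id: "x \<in> starts \<Longrightarrow> start x = x"
  using start_ge[of x x] start_in[of x] starts_sub by force

lemma run:
  assumes "x \<in> B" "start x \<le> y" "y \<le> x"
  shows "\<tau> y = \<tau> (start x) + (y - start x)"
  using assms(2,3)
proof (induction rule: dec_induct)
  case (step z)
  have "Suc z \<notin> starts" using start_ge[OF assms(1), of "Suc z"] step by auto
  moreover have "Suc z \<in> B" using step assms(1) start_in[OF assms(1)] starts_sub by auto
  ultimately have "\<tau> (Suc z) = Suc (\<tau> z)" by (auto simp: starts_def)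
  then show ?case using step by simp
qed simp

text \<open>Different runs occupy disjoint intervals of values. Otherwise the value at the start of
  the run of x would be taken strictly inside the run of y, and a start would lie in the interior of
  a run.\<close>

lemma start_val_mono:
  assumes "x \<in> B" "y \<in> B" "\<tau> x < \<tau> y"
  shows "\<tau> (start x) \<le> \<tau> (start y)"
proof (rule ccontr)
  assume "\<not> \<tau> (start x) \<le> \<tau> (start y)"
  then have l: "\<tau> (start y) < \<tau> (start x)" by simp
  let ?z = "start y + (\<tau> (start x) - \<tau> (start y))"
  have "\<tau> (start x) \<le> \<tau> x" using run[OF assms(1), of x] start_in[OF assms(1)] by (metis le_add1 order_refl)
  then have z: "?z \<le> y" using run[OF assms(2), of y] start_in[OF assms(2)] assms(3) l by simp
  then have "\<tau> ?z = \<tau> (start x)" using run[OF assms(2), of ?z] l by simp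
  moreover have "?z \<in> B" "start x \<in> B" using z assms start_in starts_sub by auto (meson atLeastAtMost_iff start_in starts_sub subsetD trans_le_add1)+
  ultimately have "?z = start x" using injB by (meson inj_onD)
  then have "?z \<le> start y" using start_ge[OF assms(2) _ z] start_in[OF assms(1)] by simp
  then show False using l by simp
qed

text \<open>A module of B is an interval of positions, and of values since the image of B is one, so
  a proper one is a smaller contiguous block. By minimality it is increasing, and an increasing map
  onto an interval advances in steps of 1.\<close>

lemma sub_block_increasing:
  assumes T: "T \<noteq> {}" "T \<subset> B" and m: "module_on \<tau> B T"
  shows "\<exists>a' b'. T = {a'..b'} \<and> (\<forall>x. a' \<le> x \<longrightarrow> x < b' \<longrightarrow> \<tau> (Suc x) = Suc (\<tau> x))"
proof -
  have fin: "finite T" using T finite_subset by blast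
  define a' b' where "a' = Min T" and "b' = Max T"
  have in1: "a' \<in> T" "b' \<in> T" using fin T by (auto simp: a'_def b'_def)
  have bd: "a' \<le> x" "x \<le> b'" if "x \<in> T" for x using fin that by (auto simp: a'_def b'_def)
  have Teq: "T = {a'..b'}"
  proof
    show "{a'..b'} \<subseteq> T"
    proof
      fix x assume x: "x \<in> {a'..b'}"
      then have "x \<in> B" using in1 T by fastforce
      then show "x \<in> T" using m in1 x unfolding module_on_def by (metis atLeastAtMost_iff le_neq_implies_less)
    qed
  qed (use bd in auto)
  have injT: "inj_on \<tau> T" using injB T by (meson inj_on_subset psubset_imp_subset)
  have imgT: "\<tau> ` T = {Min (\<tau> ` T)..Max (\<tau> ` T)}"
  proof
    show "{Min (\<tau> ` T)..Max (\<tau> ` T)} \<subseteq> \<tau> ` T"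
    proof
      fix v assume v: "v \<in> {Min (\<tau> ` T)..Max (\<tau> ` T)}"
      have mm: "Min (\<tau> ` T) \<in> \<tau> ` T" "Max (\<tau> ` T) \<in> \<tau> ` T" using fin T by auto
      then obtain x z where xz: "x \<in> T" "z \<in> T" "\<tau> x = Min (\<tau> ` T)" "\<tau> z = Max (\<tau> ` T)" by (metis imageE)
      then have "x \<in> B" "z \<in> B" using T by auto
      then have "v \<in> {Min (\<tau> ` B)..Min (\<tau> ` B) + (b - a)}"
        using v xz val_range[of x] val_range[of z] by auto
      then have "v \<in> \<tau> ` B" by (simp only: img[symmetric])
      then obtain y where y: "y \<in> B" "v = \<tau> y" by (rule imageE) auto
      show "v \<in> \<tau> ` T"
      proof (cases "v = \<tau> x \<or> v = \<tau> z")
        case False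
        then have "\<tau> x < \<tau> y \<and> \<tau> y < \<tau> z" using v xz y by auto
        then show ?thesis using m xz y unfolding module_on_def by blast
      qed (use mm xz in auto)
    qed
  qed (use fin in auto)
  have ct: "contiguous \<tau> a' b'"
    by (rule contiguousI[of \<tau> a' b', OF _ _ imgT[unfolded Teq]]) (use injT Teq bd in1 in blast)+
  have "a' \<in> B" "b' \<in> B" using in1 T(2) by blast+
  then have ab': "a \<le> a'" "b' \<le> b" by simp_all
  have "a' \<noteq> a \<or> b' \<noteq> b" using T(2) Teq by blast
  moreover have "a' \<le> b'" using bd in1 by blast
  moreover note ab'
  ultimately have "\<not> unsorted_block \<tau> a' b'" "a' \<le> b'" using mb unfolding minimal_block_def by blast+
  then have inc: "increasing_on T \<tau>" using ct ab' unsorted(1) by (simp add: unsorted_block_def Teq)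
  have "\<tau> (Suc x) = Suc (\<tau> x)" if x: "a' \<le> x" "x < b'" for x
  proof -
    have xT: "x \<in> T" "Suc x \<in> T" using x Teq by auto
    then have lt: "\<tau> x < \<tau> (Suc x)" using inc by (auto simp: monotone_on_def)
    show ?thesis
    proof (rule ccontr)
      assume "\<tau> (Suc x) \<noteq> Suc (\<tau> x)"
      with lt have l2: "Suc (\<tau> x) < \<tau> (Suc x)" by simp
      have "Suc (\<tau> x) \<in> {Min (\<tau> ` T)..Max (\<tau> ` T)}"
        using l2 fin xT by (auto intro: le_trans[OF Min_le le_SucI] le_trans[OF less_imp_le Max_ge])
      then have "Suc (\<tau> x) \<in> \<tau> ` T" by (subst imgT)
      then obtain y where y: "y \<in> T" "Suc (\<tau> x) = \<tau> y" by (rule imageE)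
      have "\<not> y < x" "y \<noteq> x" using inc y xT unfolding monotone_on_def by fastforce+
      moreover have "\<not> Suc x < y" "y \<noteq> Suc x" using inc y xT l2 unfolding monotone_on_def by fastforce+
      ultimately show False by simp
    qed
  qed
  then show ?thesis using Teq by blast
qed

text \<open>The runs starting in a module T form a module U of B. If T had two points without being
  everything, U would be proper and hence consist of consecutive values; then the later of the two
  points could not start a run.\<close>

lemma starts_simple: "simple_on \<tau> starts"
  unfolding simple_on_def
proof (intro allI impI)
  fix T assume m: "module_on \<tau> starts T"
  show "card T \<le> 1 \<or> T = starts"
  proof (rule ccontr)
    assume "\<not> (card T \<le> 1 \<or> T = starts)"
    then have c2: "\<not> card T \<le> 1" and ne: "T \<noteq> starts" by auto
    have Ts: "T \<subseteq> starts" using m by (simp add: module_on_def)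
    define U where "U = {x \<in> B. start x \<in> T}"
    have TU: "T \<subseteq> U" using Ts start_id starts_sub by (auto simp: U_def)
    have "module_on \<tau> B U"
      unfolding module_on_def
    proof (intro conjI ballI impI)
      fix x z y assume *: "x \<in> U" "z \<in> U" "y \<in> B" "x < y \<and> y < z"
      then have "start x \<le> start y" "start y \<le> start z" using start_mono by (auto simp: U_def)
      moreover have "start y \<in> starts" using start_in * by blast
      ultimately have "start y \<in> T"
        using m * unfolding module_on_def U_def by (metis (mono_tags, lifting) le_neq_implies_less mem_Collect_eq)
      then show "y \<in> U" using * by (simp add: U_def)
    next
      fix x z y assume *: "x \<in> U" "z \<in> U" "y \<in> B" "\<tau> x < \<tau> y \<and> \<tau> y < \<tau> z"
      then have xz: "x \<in> B" "z \<in> B" "start x \<in> T" "start z \<in> T" by (auto simp: U_def)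
      have s: "start x \<in> B" "start y \<in> B" "start z \<in> B" "start y \<in> starts"
        using start_in starts_sub xz * by blast+
      have le: "\<tau> (start x) \<le> \<tau> (start y)" "\<tau> (start y) \<le> \<tau> (start z)"
        using start_val_mono xz * by auto
      have "start y \<in> T"
      proof (cases "\<tau> (start x) = \<tau> (start y) \<or> \<tau> (start y) = \<tau> (start z)")
        case True
        then have "start x = start y \<or> start y = start z" using injB s by (meson inj_onD)
        then show ?thesis using xz by auto
      next
        case False
        then have "\<tau> (start x) < \<tau> (start y) \<and> \<tau> (start y) < \<tau> (start z)" using le by auto
        then show ?thesis using m xz s unfolding module_on_def by blast
      qed
      then show "y \<in> U" using * by (simp add: U_def)
    qed (auto simp: U_def)
    moreover have "U \<noteq> {}" using TU c2 by auto
    moreover have "U \<noteq> B"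
    proof
      assume "U = B"
      have "starts \<subseteq> T"
      proof
        fix x assume x: "x \<in> starts"
        then have "x \<in> U" using \<open>U = B\<close> starts_sub by auto
        then show "x \<in> T" using start_id[OF x] by (simp add: U_def)
      qed
      then show False using ne Ts by auto
    qed
    moreover have "U \<subseteq> B" by (auto simp: U_def)
    ultimately obtain a' b' where U: "U = {a'..b'}"
      and suc: "\<And>x. a' \<le> x \<Longrightarrow> x < b' \<Longrightarrow> \<tau> (Suc x) = Suc (\<tau> x)"
      using sub_block_increasing[of U] by blast
    obtain x y where xy: "x \<in> T" "y \<in> T" "x < y" using card_ge2_obtain[OF c2] .
    then have b: "a' \<le> x" "y \<le> b'" "y \<in> starts" "x \<in> starts" using TU U Ts by auto
    then have "\<tau> (Suc (y - 1)) = Suc (\<tau> (y - 1))" using suc[of "y - 1"] xy by auto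
    moreover have "y \<noteq> a" using xy b starts_sub by force
    ultimately show False using b xy by (auto simp: starts_def)
  qed
qed

text \<open>A decreasing set meets each run at most once, so it can be moved to the starts. These
  form a simple pattern, which is not increasing because the block is not. If it is not decreasing
  either, the bound k applies; if it is decreasing, it has at most two points.\<close>

lemma decreasing_card:
  assumes sb: "simple_bound n \<tau> k" and D: "D \<subseteq> B" "decreasing_on D \<tau>"
  shows "card D \<le> max k 2"
proof -
  have st: "start x \<in> B" if "x \<in> B" for x using start_in[OF that] starts_sub by blast
  have ne: "start x \<noteq> start y" if "x \<in> D" "y \<in> D" "x < y" for x y
  proof
    assume e: "start x = start y"
    have "x \<in> B" "y \<in> B" using that D by auto
    then have "\<tau> x < \<tau> y"
      using run[of y x] run[of y y] start_in[of x] start_in[of y] e that by auto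
    moreover have "\<tau> y < \<tau> x" using D(2) that by (simp add: monotone_on_def)
    ultimately show False by simp
  qed
  have injD: "inj_on start D"
    by (rule inj_onI) (metis ne linorder_neqE_nat)
  have dec: "decreasing_on (start ` D) \<tau>"
    unfolding monotone_on_def
  proof (intro ballI impI)
    fix u v assume "u \<in> start ` D" "v \<in> start ` D" and uv: "u < v"
    then obtain x y where xy: "x \<in> D" "y \<in> D" "u = start x" "v = start y" by auto
    have B: "x \<in> B" "y \<in> B" using xy D by auto
    have "x < y" using start_mono[OF B(2,1)] uv xy by (meson leD leI)
    then have "\<tau> y < \<tau> x" using D(2) xy by (auto simp: monotone_on_def)
    then have "\<tau> v \<le> \<tau> u" using start_val_mono B xy by simp
    moreover have "\<tau> u \<noteq> \<tau> v" using inj_onD[OF injB] st B uv xy by (metis less_irrefl)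
    ultimately show "\<tau> v < \<tau> u" by simp
  qed
  have sub: "start ` D \<subseteq> starts" using D start_in by blast
  have "card (start ` D) \<le> max k 2"
  proof (cases "decreasing_on starts \<tau>")
    case True
    have "card starts \<le> 2"
    proof (cases "starts = {}")
      case False
      let ?M = "Max starts"
      have M: "?M \<in> starts" using finite_starts False by simp
      have le: "x \<le> ?M" if "x \<in> starts" for x using finite_starts that by simp
      \<comment> \<open>In a decreasing pattern the last point also has the least value, so the
        remaining points are convex in both orders.\<close>
      have "module_on \<tau> starts (starts - {?M})"
        unfolding module_on_def
      proof (intro conjI ballI impI)
        fix x z y assume "x \<in> starts - {?M}" "z \<in> starts - {?M}" "y \<in> starts" "x < y \<and> y < z"
        then show "y \<in> starts - {?M}" using le[of z] by auto
      next
        fix x z y assume *: "x \<in> starts - {?M}" "z \<in> starts - {?M}" "y \<in> starts" "\<tau> x < \<tau> y \<and> \<tau> y < \<tau> z"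
        then have "x < ?M" using le[of x] by (auto intro: le_neq_implies_less)
        then have "\<tau> ?M < \<tau> x" using True * M unfolding monotone_on_def by blast
        then show "y \<in> starts - {?M}" using * by auto
      qed auto
      then have "card (starts - {?M}) \<le> 1 \<or> starts - {?M} = starts"
        using starts_simple by (auto simp: simple_on_def)
      then have "card (starts - {?M}) \<le> 1" using M by auto
      then show ?thesis using finite_starts M by (simp add: card_Diff_singleton)
    qed simp
    then show ?thesis using card_mono[OF finite_starts sub] by simp
  next
    case nd: False
    have ni: "\<not> increasing_on starts \<tau>"
    proof
      assume inc: "increasing_on starts \<tau>"
      have "increasing_on B \<tau>"
        unfolding monotone_on_def
      proof (intro ballI impI)
        fix x y assume B: "x \<in> B" "y \<in> B" and l: "x < y"
        show "\<tau> x < \<tau> y"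
        proof (cases "start x = start y")
          case True
          then show ?thesis using run[of y x] run[of y y] start_in[of x] start_in[of y] l B by auto
        next
          case False
          then have "start x < start y" using start_mono[OF B] l by simp
          then have "\<tau> (start x) < \<tau> (start y)" using inc start_in B by (auto simp: monotone_on_def)
          then have "\<not> \<tau> y < \<tau> x" using start_val_mono[OF B(2,1)] by auto
          moreover have "\<tau> x \<noteq> \<tau> y" using inj_onD[OF injB _ B] l by auto
          ultimately show ?thesis by simp
        qed
      qed
      then show False using unsorted by simp
    qed
    have "starts \<subseteq> {1..n}" using starts_sub B_sub by blast
    then have "pattern_bound \<tau> starts k" using sb by (simp add: simple_bound_def)
    then have "card (start ` D) \<le> k"
      using starts_simple ni nd sub dec by (auto simp: pattern_bound_def)
    then show ?thesis by simp
  qed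
  then show ?thesis using card_image[OF injD] by simp
qed

end

text \<open>The interval {1..n} is itself a contiguous block. The auxiliary \<open>p\<close> is
  needed because an array may hold anything outside {1..n}, whereas a permutation is the identity
  there.\<close>

lemma sorted_or_block:
  assumes "bij_betw \<tau> {1..n} {1..n}" "\<And>a b. b \<le> n \<Longrightarrow> \<not> unsorted_block \<tau> a b" "x \<in> {1..n}"
  shows "\<tau> x = x"
proof -
  define p where "p x = (if x \<in> {1..n} then \<tau> x else x)" for x
  have n: "1 \<le> n" using assms(3) by simp
  have "contiguous \<tau> 1 n"
    by (rule contiguousI) (use assms(1) n in \<open>auto simp: bij_betw_def\<close>)
  then have "increasing_on {1..n} \<tau>" using assms(2)[of n 1] n by (simp add: unsorted_block_def)
  then have "increasing_on {1..n} p" by (auto simp: monotone_on_def p_def)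
  moreover have "bij_betw p {1..n} {1..n}"
    using assms(1) by (rule bij_betw_cong[THEN iffD1, rotated]) (simp add: p_def)
  then have "p permutes {1..n}" by (rule bij_imp_permutes) (auto simp: p_def)
  ultimately have "p = id" by (rule increasing_permutes_id[rotated])
  then have "p x = x" by simp
  then show ?thesis using assms(3) by (simp add: p_def)
qed

lemma card_linexts_sorted:
  assumes "\<And>x. x \<in> {1..n} \<Longrightarrow> \<tau> x = x"
  shows "card (linexts {1..n} \<tau>) = 1"
proof -
  have "linexts {1..n} \<tau> = {id}"
  proof (intro set_eqI iffI)
    fix \<rho> assume "\<rho> \<in> linexts {1..n} \<tau>"
    then have "\<rho> permutes {1..n}" "increasing_on {1..n} \<rho>"
      using assms by (auto simp: linexts_def monotone_on_def)
    then show "\<rho> \<in> {id}" using increasing_permutes_id by simp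
  qed (auto simp: linexts_def permutes_id)
  then show ?thesis by simp
qed

section \<open>Counting linear extensions by dynamic programming\<close>

text \<open>Linear extensions as words: the elements are listed from bottom to top, which makes
  removing the topmost element a recursion.\<close>

definition linlists :: "(nat \<Rightarrow> nat) \<Rightarrow> nat set \<Rightarrow> nat list set" where
  "linlists \<tau> S = {xs. distinct xs \<and> set xs = S \<and> sorted_wrt (\<lambda>x y. \<not> (y < x \<and> \<tau> y < \<tau> x)) xs}"

abbreviation top_of :: "(nat \<Rightarrow> nat) \<Rightarrow> nat set \<Rightarrow> nat \<Rightarrow> bool" where
  "top_of \<tau> S x \<equiv> x \<in> S \<and> \<not> (\<exists>y\<in>S. x < y \<and> \<tau> x < \<tau> y)"

lemma finite_linlists: "finite S \<Longrightarrow> finite (linlists \<tau> S)"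
  by (rule finite_subset[OF _ finite_subset_distinct[of S]]) (auto simp: linlists_def)

lemma card_linlists_empty: "card (linlists \<tau> {}) = 1"
proof -
  have "linlists \<tau> {} = {[]}" by (auto simp: linlists_def)
  then show ?thesis by simp
qed

text \<open>The last entry of a word is a maximal element of the poset, and the rest of the word is
  an arbitrary word on the remaining elements.\<close>

lemma card_linlists_step:
  assumes "finite S" "S \<noteq> {}"
  shows "card (linlists \<tau> S) = (\<Sum>x | top_of \<tau> S x. card (linlists \<tau> (S - {x})))"
proof -
  let ?M = "{x. top_of \<tau> S x}"
  have eq: "linlists \<tau> S = (\<Union>x\<in>?M. (\<lambda>xs. xs @ [x]) ` linlists \<tau> (S - {x}))"
  proof (intro set_eqI iffI)
    fix xs assume xs: "xs \<in> linlists \<tau> S"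
    with assms(2) have "xs \<noteq> []" by (auto simp: linlists_def)
    then obtain ys x where e: "xs = ys @ [x]" by (cases xs rule: rev_cases) auto
    have "top_of \<tau> S x" using xs unfolding e linlists_def by (auto simp: sorted_wrt_append)
    moreover have "ys \<in> linlists \<tau> (S - {x})" using xs unfolding e linlists_def by (auto simp: sorted_wrt_append)
    ultimately show "xs \<in> (\<Union>x\<in>?M. (\<lambda>xs. xs @ [x]) ` linlists \<tau> (S - {x}))" using e by auto
  next
    fix xs assume "xs \<in> (\<Union>x\<in>?M. (\<lambda>xs. xs @ [x]) ` linlists \<tau> (S - {x}))"
    then show "xs \<in> linlists \<tau> S" by (auto simp: linlists_def sorted_wrt_append)
  qed
  have "finite ?M" by (rule finite_subset[OF _ assms(1)]) auto
  then have "card (linlists \<tau> S) = (\<Sum>x\<in>?M. card ((\<lambda>xs. xs @ [x]) ` linlists \<tau> (S - {x})))"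
    unfolding eq using finite_linlists assms(1) by (intro card_UN_disjoint) auto
  then show ?thesis by (simp add: card_image inj_on_def)
qed

text \<open>An extension assigns a rank to each position; the corresponding word reads off the
  inverse at the ranks a, ..., b.\<close>

lemma card_linexts_linlists:
  "card (linexts {a..b} \<tau>) = card (linlists \<tau> {a..b})"
proof -
  let ?B = "{a..b}" and ?L = "\<lambda>\<gamma>. map (inv \<gamma>) [a..<Suc b]"
  have "bij_betw ?L (linexts ?B \<tau>) (linlists \<tau> ?B)"
  proof (rule bij_betw_imageI)
    show "inj_on ?L (linexts ?B \<tau>)"
    proof (rule inj_onI)
      fix \<gamma> \<gamma>' assume g: "\<gamma> \<in> linexts ?B \<tau>" "\<gamma>' \<in> linexts ?B \<tau>" and e: "?L \<gamma> = ?L \<gamma>'"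
      have p: "\<gamma> permutes ?B" "\<gamma>' permutes ?B" using g by (auto simp: linexts_def)
      have "inv \<gamma> x = inv \<gamma>' x" for x
      proof (cases "x \<in> ?B")
        case True
        then have "x \<in> set [a..<Suc b]" by auto
        then show ?thesis using e by (meson map_eq_conv)
      next
        case False
        then show ?thesis using permutes_not_in[OF permutes_inv[OF p(1)]] permutes_not_in[OF permutes_inv[OF p(2)]] by simp
      qed
      then have "inv \<gamma> = inv \<gamma>'" by auto
      then show "\<gamma> = \<gamma>'" using permutes_inv_inv p by metis
    qed
    show "?L ` linexts ?B \<tau> = linlists \<tau> ?B"
    proof (intro set_eqI iffI)
      fix xs assume "xs \<in> ?L ` linexts ?B \<tau>"
      then obtain \<gamma> where g: "\<gamma> \<in> linexts ?B \<tau>" and xs: "xs = ?L \<gamma>" by auto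
      have p: "\<gamma> permutes ?B" using g by (simp add: linexts_def)
      have "distinct xs" unfolding xs distinct_map using permutes_inj_on[OF permutes_inv[OF p]] by auto
      moreover have "set xs = ?B" using permutes_image[OF permutes_inv[OF p]] unfolding xs set_map set_upt atLeastLessThanSuc_atLeastAtMost .
      moreover have "sorted_wrt (\<lambda>x y. \<not> (y < x \<and> \<tau> y < \<tau> x)) xs"
        unfolding xs sorted_wrt_map
      proof (rule sorted_wrt_mono_rel[OF _ sorted_wrt_upt])
        fix i j assume ij: "i \<in> set [a..<Suc b]" "j \<in> set [a..<Suc b]" "i < j"
        then have "inv \<gamma> i \<in> ?B" "inv \<gamma> j \<in> ?B"
          using permutes_in_image[OF permutes_inv[OF p], of i] permutes_in_image[OF permutes_inv[OF p], of j] by auto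
        then have "inv \<gamma> j < inv \<gamma> i \<and> \<tau> (inv \<gamma> j) < \<tau> (inv \<gamma> i) \<Longrightarrow> \<gamma> (inv \<gamma> j) < \<gamma> (inv \<gamma> i)"
          using g by (auto simp: linexts_def)
        then show "\<not> (inv \<gamma> j < inv \<gamma> i \<and> \<tau> (inv \<gamma> j) < \<tau> (inv \<gamma> i))"
          using ij by (auto simp: permutes_inverses[OF p])
      qed
      ultimately show "xs \<in> linlists \<tau> ?B" by (simp add: linlists_def)
    next
      fix xs assume "xs \<in> linlists \<tau> ?B"
      then have xs: "distinct xs" "set xs = ?B" "sorted_wrt (\<lambda>x y. \<not> (y < x \<and> \<tau> y < \<tau> x)) xs"
        by (auto simp: linlists_def)
      have len: "length xs = Suc b - a" using distinct_card[OF xs(1)] xs(2) by simp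
      define \<beta> where "\<beta> i = (if i \<in> ?B then xs ! (i - a) else i)" for i
      have "inj_on \<beta> ?B"
        unfolding \<beta>_def by (rule inj_onI) (use nth_eq_iff_index_eq[OF xs(1)] len in auto)
      moreover have "\<beta> ` ?B \<subseteq> ?B"
        using nth_mem[of _ xs] xs(2) len by (auto simp: \<beta>_def)
      ultimately have "bij_betw \<beta> ?B ?B" by (simp add: bij_betw_def endo_inj_surj)
      then have bp: "\<beta> permutes ?B" by (rule bij_imp_permutes) (auto simp: \<beta>_def)
      define \<gamma> where "\<gamma> = inv \<beta>"
      have ig: "inv \<gamma> = \<beta>" unfolding \<gamma>_def using permutes_inv_inv[OF bp] .
      have gp: "\<gamma> permutes ?B" unfolding \<gamma>_def using permutes_inv[OF bp] .
      have "xs = ?L \<gamma>"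
        unfolding ig by (rule nth_equalityI) (auto simp: len \<beta>_def simp del: upt_Suc)
      moreover have "\<gamma> x < \<gamma> y" if "x \<in> ?B" "y \<in> ?B" "x < y" "\<tau> x < \<tau> y" for x y
      proof (rule ccontr)
        assume nl: "\<not> \<gamma> x < \<gamma> y"
        have "\<gamma> x \<noteq> \<gamma> y" using permutes_inj[OF gp] that by (auto dest: injD)
        with nl have l: "\<gamma> y < \<gamma> x" by simp
        have gB: "\<gamma> x \<in> ?B" "\<gamma> y \<in> ?B" using that permutes_in_image[OF gp] by auto
        have "\<beta> (\<gamma> x) = x" "\<beta> (\<gamma> y) = y" unfolding \<gamma>_def by (simp_all add: permutes_inverses[OF bp])
        then have "xs ! (\<gamma> x - a) = x" "xs ! (\<gamma> y - a) = y" using gB by (auto simp: \<beta>_def)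
        moreover have "\<gamma> y - a < \<gamma> x - a" "\<gamma> x - a < length xs" using gB l len by auto
        ultimately show False using sorted_wrt_nth_less[OF xs(3), of "\<gamma> y - a" "\<gamma> x - a"] that by simp
      qed
      then have "\<gamma> \<in> linexts ?B \<tau>" using gp by (simp add: linexts_def)
      ultimately show "xs \<in> ?L ` linexts ?B \<tau>" by blast
    qed
  qed
  then show ?thesis by (rule bij_betw_same_card)
qed

text \<open>
  Cells of the table are indexed by the thresholds \<open>d c\<close>: only those elements of chain \<open>c\<close> are kept
  whose position is at most \<open>d c\<close>.
\<close>

locale chains =
  fixes \<tau> :: "nat \<Rightarrow> nat" and B :: "nat set" and col :: "nat \<Rightarrow> nat" and K :: nat
  assumes finB: "finite B" and zero: "0 \<notin> B"
    and col_in: "x \<in> B \<Longrightarrow> col x < K" and col_out: "x \<notin> B \<Longrightarrow> K \<le> col x"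
    and chain: "x \<in> B \<Longrightarrow> y \<in> B \<Longrightarrow> col x = col y \<Longrightarrow> x < y \<Longrightarrow> \<tau> x < \<tau> y"
begin

definition kept :: "(nat \<Rightarrow> nat) \<Rightarrow> nat set" where
  "kept d = {x \<in> B. x \<le> d (col x)}"

abbreviation ways :: "(nat \<Rightarrow> nat) \<Rightarrow> nat" where
  "ways d \<equiv> card (linlists \<tau> (kept d))"

lemma kept_cong: "(\<And>c. c < K \<Longrightarrow> d c = d' c) \<Longrightarrow> kept d = kept d'"
  using col_in by (auto simp: kept_def)

lemma kept_silent: "col (d c) \<noteq> c \<Longrightarrow> 0 < d c \<Longrightarrow> kept (d(c := d c - 1)) = kept d"
  unfolding kept_def by (intro Collect_cong conj_cong refl) (auto simp: le_eq_less_or_eq split: if_splits)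

lemma ways_zero: "(\<And>c. c < K \<Longrightarrow> d c = 0) \<Longrightarrow> ways d = 1"
proof -
  assume "\<And>c. c < K \<Longrightarrow> d c = 0"
  then have "kept d = {}" using zero col_in unfolding kept_def by fastforce
  then show ?thesis by (simp add: card_linlists_empty)
qed

definition free :: "(nat \<Rightarrow> nat) \<Rightarrow> nat \<Rightarrow> bool" where
  "free d c \<longleftrightarrow> 0 < d c \<and> \<not> (\<exists>e<K. d c < d e \<and> \<tau> (d c) < \<tau> (d e))"

text \<open>When every positive threshold is the position of a kept element of its own chain, that
  element dominates all kept elements of the chain. Hence an element is maximal iff it is such a top
  and no other top lies above it, and removing it lowers one threshold by 1. A positive threshold
  makes the set nonempty, as the recursion demands.\<close>

lemma ways_step:
  assumes tops: "\<And>c. c < K \<Longrightarrow> 0 < d c \<Longrightarrow> col (d c) = c" and nz: "c0 < K" "0 < d c0"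
  shows "ways d = (\<Sum>c | c < K \<and> free d c. ways (d(c := d c - 1)))"
proof -
  have inB: "d c \<in> B" if "c < K" "0 < d c" for c
    using tops[OF that] that col_out[of "d c"] by fastforce
  have inK: "d c \<in> kept d" if "c < K" "0 < d c" for c
    using inB[OF that] tops[OF that] by (simp add: kept_def)
  have fin: "finite (kept d)" using finB by (simp add: kept_def)
  have ne: "kept d \<noteq> {}" using inK nz by blast
  have le: "x \<le> d (col x)" "col x < K" "x \<in> B" "0 < d (col x)" if "x \<in> kept d" for x
  proof -
    show "x \<le> d (col x)" "col x < K" "x \<in> B" using that col_in by (auto simp: kept_def)
    then show "0 < d (col x)" using zero by (cases x) auto
  qed
  have val: "x = d (col x) \<or> x < d (col x) \<and> \<tau> x < \<tau> (d (col x))" if "x \<in> kept d" for x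
  proof (cases "x = d (col x)")
    case False
    then have "x < d (col x)" using le(1)[OF that] by simp
    then show ?thesis
      using chain[OF le(3)[OF that] inB[OF le(2)[OF that] le(4)[OF that]]] tops[OF le(2)[OF that] le(4)[OF that]]
      by simp
  qed simp
  have top: "top_of \<tau> (kept d) x \<longleftrightarrow> (\<exists>c<K. free d c \<and> x = d c)" for x
  proof
    assume t: "top_of \<tau> (kept d) x"
    then have x: "x \<in> kept d" by simp
    have "x = d (col x)" using val[OF x] inK[OF le(2)[OF x] le(4)[OF x]] t by blast
    moreover have "free d (col x)"
      unfolding free_def
    proof (intro conjI notI)
      show "0 < d (col x)" by (rule le(4)[OF x])
      assume "\<exists>e<K. d (col x) < d e \<and> \<tau> (d (col x)) < \<tau> (d e)"
      then obtain e where "e < K" "x < d e" "\<tau> x < \<tau> (d e)" using \<open>x = d (col x)\<close> by auto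
      then show False using t inK[of e] by auto
    qed
    ultimately show "\<exists>c<K. free d c \<and> x = d c" using le(2)[OF x] by blast
  next
    assume "\<exists>c<K. free d c \<and> x = d c"
    then obtain c where c: "c < K" "free d c" "x = d c" by blast
    have "\<not> (x < y \<and> \<tau> x < \<tau> y)" if y: "y \<in> kept d" for y
    proof
      assume l: "x < y \<and> \<tau> x < \<tau> y"
      have "y \<le> d (col y) \<and> \<tau> y \<le> \<tau> (d (col y))" using val[OF y] by auto
      then have "d c < d (col y) \<and> \<tau> (d c) < \<tau> (d (col y))" using l c by auto
      then show False using c le(2)[OF y] by (auto simp: free_def)
    qed
    then show "top_of \<tau> (kept d) x" using c inK[of c] by (auto simp: free_def)
  qed
  have img: "{x. top_of \<tau> (kept d) x} = d ` {c. c < K \<and> free d c}" using top by auto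
  have inj: "inj_on d {c. c < K \<and> free d c}"
    by (rule inj_onI) (metis (mono_tags, lifting) free_def mem_Collect_eq tops)
  have rem: "kept d - {d c} = kept (d(c := d c - 1))" if "c < K" "free d c" for c
  proof -
    have "0 < d c" using that by (simp add: free_def)
    then show ?thesis using tops[OF that(1)] by (auto simp: kept_def le_eq_less_or_eq split: if_splits)
  qed
  have "ways d = (\<Sum>x\<in>d ` {c. c < K \<and> free d c}. card (linlists \<tau> (kept d - {x})))"
    using card_linlists_step[OF fin ne, of \<tau>] unfolding img .
  also have "\<dots> = (\<Sum>c | c < K \<and> free d c. card (linlists \<tau> (kept d - {d c})))"
    using sum.reindex[OF inj] by simp
  also have "\<dots> = (\<Sum>c | c < K \<and> free d c. ways (d(c := d c - 1)))"
    using rem by (intro sum.cong) auto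
  finally show ?thesis .
qed

end

text \<open>One less than the length of a longest decreasing sequence that starts at a or later and
  ends at x. Its level sets are increasing, as in the easy half of the duality between chains and
  antichains; the inserted 0 is the case of no larger predecessor.\<close>

fun chain_index :: "(nat \<Rightarrow> nat) \<Rightarrow> nat \<Rightarrow> nat \<Rightarrow> nat" where
  "chain_index \<tau> a x = Max (insert 0 ((\<lambda>y. Suc (chain_index \<tau> a y)) ` {y \<in> {a..<x}. \<tau> x < \<tau> y}))"

declare chain_index.simps [simp del]

lemma chain_index_step:
  assumes "a \<le> y" "y < x" "\<tau> x < \<tau> y"
  shows "chain_index \<tau> a y < chain_index \<tau> a x"
proof -
  have "Suc (chain_index \<tau> a y) \<le> chain_index \<tau> a x"
    by (subst (2) chain_index.simps) (rule Max_ge, use assms in auto)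
  then show ?thesis by simp
qed

text \<open>Following the predecessors that attain the maximum yields a decreasing set, so a bound
  on decreasing sets bounds the number of chains.\<close>

lemma chain_index_decreasing:
  "a \<le> x \<Longrightarrow> \<exists>D\<subseteq>{a..x}. decreasing_on D \<tau> \<and> x \<in> D \<and> card D = Suc (chain_index \<tau> a x)"
proof (induction x rule: less_induct)
  case (less x)
  let ?A = "(\<lambda>y. Suc (chain_index \<tau> a y)) ` {y \<in> {a..<x}. \<tau> x < \<tau> y}"
  have fin: "finite ?A" by simp
  have "Max (insert 0 ?A) \<in> insert 0 ?A" using fin by (intro Max_in) auto
  then have "chain_index \<tau> a x = 0 \<or> chain_index \<tau> a x \<in> ?A"
    by (subst (asm) chain_index.simps[symmetric], subst (asm) chain_index.simps[symmetric]) auto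
  then show ?case
  proof
    assume "chain_index \<tau> a x = 0"
    then show ?thesis using less.prems by (intro exI[of _ "{x}"]) (auto simp: monotone_on_def)
  next
    assume "chain_index \<tau> a x \<in> ?A"
    then obtain y where y: "a \<le> y" "y < x" "\<tau> x < \<tau> y" "chain_index \<tau> a x = Suc (chain_index \<tau> a y)" by auto
    obtain D where D: "D \<subseteq> {a..y}" "decreasing_on D \<tau>" "y \<in> D" "card D = Suc (chain_index \<tau> a y)"
      using less.IH[OF y(2,1)] by auto
    have finD: "finite D" using D(1) finite_subset by blast
    have le: "\<tau> y \<le> \<tau> z" "z \<le> y" if "z \<in> D" for z
      using D that by (cases "z = y"; force simp: monotone_on_def)+
    have "decreasing_on (insert x D) \<tau>"
      using D(2) le y by (force simp: monotone_on_def)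
    moreover have "x \<notin> D" using le y by force
    ultimately show ?thesis
      using D finD y less.prems by (intro exI[of _ "insert x D"]) auto
  qed
qed

lemma block_chains:
  assumes "1 \<le> a" and inj: "inj_on \<tau> {a..b}"
    and w: "\<And>D. D \<subseteq> {a..b} \<Longrightarrow> decreasing_on D \<tau> \<Longrightarrow> card D \<le> K"
    and col: "\<And>x. x \<in> {a..b} \<Longrightarrow> col x = chain_index \<tau> a x" and out: "\<And>x. x \<notin> {a..b} \<Longrightarrow> K \<le> col x"
  shows "chains \<tau> {a..b} col K"
proof
  fix x assume x: "x \<in> {a..b}"
  then obtain D where D: "D \<subseteq> {a..x}" "decreasing_on D \<tau>" "card D = Suc (chain_index \<tau> a x)"
    using chain_index_decreasing[of a x \<tau>] by auto
  then have "card D \<le> K" using w[of D] x by fastforce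
  then show "col x < K" using D col[OF x] by simp
next
  fix x y assume *: "x \<in> {a..b}" "y \<in> {a..b}" "col x = col y" "x < y"
  then have "\<not> \<tau> y < \<tau> x" using chain_index_step[of a x y \<tau>] col by auto
  moreover have "\<tau> x \<noteq> \<tau> y" using * inj by (metis inj_onD less_irrefl)
  ultimately show "\<tau> x < \<tau> y" by simp
qed (use assms in auto)

text \<open>The address of a table cell: thresholds below M are the digits of a numeral in base M,
  the digit c having weight \<open>M ^ c\<close>.\<close>

definition code :: "nat \<Rightarrow> nat \<Rightarrow> (nat \<Rightarrow> nat) \<Rightarrow> nat" where
  "code M K d = (\<Sum>c<K. d c * M ^ c)"

lemma code_upd:
  assumes "c < K"
  shows "code M K (d(c := v)) + d c * M ^ c = code M K d + v * M ^ c"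
proof -
  have "code M K e = e c * M ^ c + (\<Sum>i\<in>{..<K} - {c}. e i * M ^ i)" for e
    using assms by (simp add: code_def sum.remove)
  then show ?thesis by simp
qed

lemma code_less: "(\<And>c. c < K \<Longrightarrow> d c < M) \<Longrightarrow> code M K d < M ^ K"
proof (induction K)
  case (Suc K)
  then have "code M K d + 1 \<le> M ^ K" "d K + 1 \<le> M" by (simp_all add: Suc_leI)
  then have "code M K d + 1 + d K * M ^ K \<le> M ^ K + d K * M ^ K" by simp
  also have "\<dots> = (d K + 1) * M ^ K" by simp
  also have "\<dots> \<le> M * M ^ K" using \<open>d K + 1 \<le> M\<close> by (rule mult_right_mono) simp
  finally show ?case by (simp add: code_def)
qed (simp add: code_def)

lemma code_inj:
  "(\<And>c. c < K \<Longrightarrow> d c < M \<and> e c < M) \<Longrightarrow> code M K d = code M K e \<Longrightarrow> c < K \<Longrightarrow> d c = e c"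
proof (induction K)
  case (Suc K)
  have lt: "code M K d < M ^ K" "code M K e < M ^ K" using Suc.prems(1) by (auto intro: code_less)
  have eq: "code M K d + d K * M ^ K = code M K e + e K * M ^ K"
    using Suc.prems(2) by (simp add: code_def)
  then have "(code M K d + d K * M ^ K) div M ^ K = (code M K e + e K * M ^ K) div M ^ K" by simp
  moreover have "M ^ K \<noteq> 0" using lt by (metis not_less_zero)
  ultimately have "d K = e K" using lt by simp
  with eq have "code M K d = code M K e" by simp
  then show ?case using Suc \<open>d K = e K\<close> by (cases "c = K") auto
qed simp

lemma code_max: "0 < M \<Longrightarrow> code M K (\<lambda>_. M - 1) = M ^ K - 1"
proof (induction K)
  case (Suc K)
  then have "code M (Suc K) (\<lambda>_. M - 1) = M ^ K - 1 + (M - 1) * M ^ K" by (simp add: code_def)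
  also have "\<dots> = M ^ Suc K - 1" using Suc.prems by (cases M) auto
  finally show ?case .
qed (simp add: code_def)

section \<open>A calculus for programs with running times\<close>

text \<open>The time t already spent is threaded through, and the postcondition sees the total.
  Halting is part of the claim.\<close>

definition wp :: "com \<Rightarrow> (state \<Rightarrow> nat \<Rightarrow> bool) \<Rightarrow> state \<Rightarrow> nat \<Rightarrow> bool" where
  "wp c Q s t \<longleftrightarrow> (\<exists>u s'. exec c s u s' \<and> Q s' (t + u))"

definition runs :: "com \<Rightarrow> nat \<Rightarrow> (state \<Rightarrow> bool) \<Rightarrow> state \<Rightarrow> bool" where
  "runs c T R s \<longleftrightarrow> (\<exists>t s'. exec c s t s' \<and> t \<le> T \<and> R s')"

fun mods :: "com \<Rightarrow> vname set" where
  "mods Skip = {}"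
| "mods (Assign x i e) = {x}"
| "mods (Seq c c') = mods c \<union> mods c'"
| "mods (Cond b c c') = mods c \<union> mods c'"
| "mods (While b c) = mods c"

definition agree :: "vname set \<Rightarrow> state \<Rightarrow> state \<Rightarrow> bool" where
  "agree W s s' \<longleftrightarrow> (\<forall>x. x \<notin> W \<longrightarrow> s' x = s x)"

lemma agreeD: "agree W s s' \<Longrightarrow> x \<notin> W \<Longrightarrow> s' x = s x"
  by (simp add: agree_def)

lemma exec_agree: "exec c s t s' \<Longrightarrow> agree (mods c) s s'"
  by (induction rule: exec.induct) (auto simp: agree_def)

text \<open>Calls a verified piece of program: besides its postcondition one obtains that the
  variables it does not assign are unchanged, so specifications mention only results.\<close>

lemma runs_wp:
  assumes "runs c T R s" "\<And>s' t'. R s' \<Longrightarrow> agree (mods c) s s' \<Longrightarrow> t' \<le> t + T \<Longrightarrow> Q s' t'"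
  shows "wp c Q s t"
  using assms exec_agree unfolding runs_def wp_def by (meson add_le_cancel_left)

lemma runs_weaken: "runs c T R s \<Longrightarrow> T \<le> T' \<Longrightarrow> (\<And>s'. R s' \<Longrightarrow> R' s') \<Longrightarrow> runs c T' R' s"
  unfolding runs_def by (meson order_trans)

lemma runs_iff_wp: "runs c T R s \<longleftrightarrow> wp c (\<lambda>s' t. t \<le> T \<and> R s') s 0"
  by (simp add: runs_def wp_def)

lemma wp_Skip [simp]: "wp Skip Q s t \<longleftrightarrow> Q s (t + 1)"
  unfolding wp_def using exec.Skip[of s] by (metis exec_SkipE)

lemma wp_Assign [simp]:
  "wp (Assign x i e) Q s t \<longleftrightarrow>
     Q (s(x := (s x)(aval i s := aval e s))) (t + (acost i + acost e + 1))"
  unfolding wp_def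
proof
  assume "\<exists>u s'. exec (Assign x i e) s u s' \<and> Q s' (t + u)"
  then show "Q (s(x := (s x)(aval i s := aval e s))) (t + (acost i + acost e + 1))"
    by (auto elim: exec_AssignE)
next
  assume "Q (s(x := (s x)(aval i s := aval e s))) (t + (acost i + acost e + 1))"
  then show "\<exists>u s'. exec (Assign x i e) s u s' \<and> Q s' (t + u)"
    using exec.Assign by blast
qed

lemma wp_Seq [simp]: "wp (Seq c c') Q s t \<longleftrightarrow> wp c (wp c' Q) s t"
proof
  assume "wp (Seq c c') Q s t"
  then obtain u s' where e: "exec (Seq c c') s u s'" "Q s' (t + u)" by (auto simp: wp_def)
  from e(1) show "wp c (wp c' Q) s t"
    by (rule exec_SeqE) (use e(2) in \<open>auto simp: wp_def add.assoc\<close>)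
next
  assume "wp c (wp c' Q) s t"
  then show "wp (Seq c c') Q s t"
    unfolding wp_def by (metis exec.Seq add.assoc)
qed

lemma wp_Cond [simp]:
  "wp (Cond b c c') Q s t \<longleftrightarrow>
     (if bval b s then wp c Q s (t + (bcost b + 1)) else wp c' Q s (t + (bcost b + 1)))"
proof
  assume "wp (Cond b c c') Q s t"
  then obtain u s' where e: "exec (Cond b c c') s u s'" "Q s' (t + u)" by (auto simp: wp_def)
  from e(1) show "if bval b s then wp c Q s (t + (bcost b + 1)) else wp c' Q s (t + (bcost b + 1))"
    by (rule exec_CondE) (use e(2) in \<open>auto simp: wp_def add.assoc intro!: exI\<close>)
next
  assume "if bval b s then wp c Q s (t + (bcost b + 1)) else wp c' Q s (t + (bcost b + 1))"
  then show "wp (Cond b c c') Q s t"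
    unfolding wp_def using exec.CondTrue[of b s c _ _ c'] exec.CondFalse[of b s c' _ _ c]
    by (metis (no_types, lifting) add.assoc)
qed

abbreviation Var :: "vname \<Rightarrow> aexp" where "Var x \<equiv> Elem x (Const 0)"

abbreviation Store :: "vname \<Rightarrow> aexp \<Rightarrow> com" (infix "::=" 62) where "x ::= e \<equiv> Assign x (Const 0) e"

abbreviation Seq_infix :: "com \<Rightarrow> com \<Rightarrow> com" (infixr ";;" 60) where "c ;; c' \<equiv> Seq c c'"

abbreviation If_then :: "bexp \<Rightarrow> com \<Rightarrow> com" where "If_then b c \<equiv> Cond b c Skip"

abbreviation Leq :: "aexp \<Rightarrow> aexp \<Rightarrow> bexp" where "Leq e e' \<equiv> Neg (Less e' e)"

definition for_loop :: "vname \<Rightarrow> aexp \<Rightarrow> com \<Rightarrow> com" where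
  "for_loop i e c = (i ::= Const 0) ;; While (Less (Var i) e) (c ;; i ::= Plus (Var i) (Const 1))"

lemma mods_for_loop [simp]: "mods (for_loop i e c) = insert i (mods c)"
  by (auto simp: for_loop_def)

text \<open>The bound e is evaluated anew in every round, hence the condition that the body cannot
  change its value. A round costs the body, \<open>acost e + 4\<close> for the test and 6 for the
  increment, which explains the 10; the initialisation and the last test are paid by the extra round
  in \<open>m + 1\<close>.\<close>

lemma runs_for:
  assumes I0: "I 0 s"
    and ind: "\<And>j s f. I j (s(i := f)) \<longleftrightarrow> I j s"
    and ni: "i \<notin> mods c"
    and ub: "\<And>s'. agree (insert i (mods c)) s s' \<Longrightarrow> aval e s' = m"
    and body: "\<And>j s'. j < m \<Longrightarrow> I j s' \<Longrightarrow> s' i 0 = j \<Longrightarrow> agree (insert i (mods c)) s s' \<Longrightarrow>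
      runs c C (I (Suc j)) s'"
    and fin: "\<And>s'. I m s' \<Longrightarrow> agree (insert i (mods c)) s s' \<Longrightarrow> R s'"
    and T: "(m + 1) * (C + acost e + 10) \<le> T"
  shows "runs (for_loop i e c) T R s"
proof -
  let ?b = "Less (Var i) e" and ?c = "c ;; i ::= Plus (Var i) (Const 1)"
  have loop: "\<exists>t s''. exec (While ?b ?c) s' t s'' \<and> t \<le> (m - j) * (C + acost e + 10) + acost e + 4 \<and> R s''"
    if "j \<le> m" "I j s'" "s' i 0 = j" "agree (insert i (mods c)) s s'" for j s'
    using that
  proof (induction "m - j" arbitrary: j s')
    case 0
    then have "\<not> bval ?b s'" using ub[of s'] by simp
    from exec.WhileFalse[OF this] show ?case using 0 fin[of s'] by (fastforce intro!: exI)
  next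
    case (Suc l)
    then have b: "bval ?b s'" using ub[of s'] by simp
    from Suc obtain t1 s1 where 1: "exec c s' t1 s1" "t1 \<le> C" "I (Suc j) s1"
      using body[of j s'] by (fastforce simp: runs_def)
    have a1: "agree (mods c) s' s1" by (rule exec_agree[OF 1(1)])
    let ?s2 = "s1(i := (s1 i)(aval (Const 0) s1 := aval (Plus (Var i) (Const 1)) s1))"
    have e2: "exec ?c s' (t1 + 6) ?s2"
      using exec.Seq[OF 1(1) exec.Assign[of i "Const 0" "Plus (Var i) (Const 1)" s1]]
      by (simp add: eval_nat_numeral)
    have "s1 i 0 = j" using agreeD[OF a1 ni] Suc.prems by simp
    then have 2: "?s2 i 0 = Suc j" by simp
    have "agree (insert i (mods c)) s ?s2"
      using a1 Suc.prems(4) by (auto simp: agree_def)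
    moreover have "I (Suc j) ?s2" using 1(3) ind by simp
    ultimately obtain t2 s'' where 3: "exec (While ?b ?c) ?s2 t2 s''"
      "t2 \<le> (m - Suc j) * (C + acost e + 10) + acost e + 4" "R s''"
      using Suc.hyps(1)[of "Suc j" ?s2, OF _ _ _ 2] Suc.hyps(2) by (metis Suc_diff_Suc Suc_leI diff_is_0_eq' leI nat.distinct(1) nat.inject)
    have "exec (While ?b ?c) s' (bcost ?b + 1 + (t1 + 6) + t2) s''"
      by (rule exec.WhileTrue[OF b e2 3(1)])
    moreover have "m - j = Suc (m - Suc j)" using Suc.hyps(2) by simp
    then have "bcost ?b + 1 + (t1 + 6) + t2 \<le> (m - j) * (C + acost e + 10) + acost e + 4"
      using 3(2) 1(2) by simp
    ultimately show ?case using 3(3) by blast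
  qed
  let ?s = "s(i := (s i)(aval (Const 0) s := aval (Const 0) s))"
  have "I 0 ?s" using I0 ind by simp
  then obtain t s' where *: "exec (While ?b ?c) ?s t s'" "t \<le> m * (C + acost e + 10) + acost e + 4" "R s'"
    using loop[of 0 ?s] by (auto simp: agree_def)
  have "exec (for_loop i e c) s (3 + t) s'"
    unfolding for_loop_def using exec.Seq[OF exec.Assign *(1)] by (simp add: eval_nat_numeral)
  moreover have "3 + t \<le> T" using *(2) T by (simp add: algebra_simps)
  ultimately show ?thesis using *(3) by (auto simp: runs_def)
qed

lemma nested_bound: "1 \<le> (N::nat) \<Longrightarrow> p \<le> N * a \<Longrightarrow> N * (p + b) \<le> N * N * (a + b)"
proof -
  assume *: "1 \<le> N" "p \<le> N * a"
  then have "p + b \<le> N * a + N * b" by (intro add_mono) simp_all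
  then show ?thesis by (simp add: mult.assoc distrib_left[symmetric])
qed

section \<open>The phases of the program\<close>

text \<open>Loops start at 0, so with \<open>m\<close> equal to n + 1 the cells 0 to n are treated.
  Cell 0 of both inputs contains 0 and behaves like a fixed point.\<close>

definition inverse_prog :: com where
  "inverse_prog = for_loop ''i'' (Var ''m'')
     (Assign ''inv1'' (Elem ''sigma1'' (Var ''i'')) (Var ''i''))"

lemma runs_inverse:
  assumes "s ''m'' 0 = M" "inj_on (s ''sigma1'') {..<M}"
  shows "runs inverse_prog ((M + 1) * 20) (\<lambda>s'. \<forall>x<M. s' ''inv1'' (s ''sigma1'' x) = x) s"
  unfolding inverse_prog_def
proof (rule runs_for[where I = "\<lambda>j s'. \<forall>x<j. s' ''inv1'' (s ''sigma1'' x) = x" and m = M and C = 6])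
  fix j s' assume j: "j < M" "s' ''i'' 0 = j" and I: "\<forall>x<j. s' ''inv1'' (s ''sigma1'' x) = x"
    and a: "agree (insert ''i'' (mods (Assign ''inv1'' (Elem ''sigma1'' (Var ''i'')) (Var ''i'')))) s s'"
  have "s' ''sigma1'' = s ''sigma1''" using agreeD[OF a] by simp
  moreover have "s ''sigma1'' x \<noteq> s ''sigma1'' j" if "x < j" for x
    using that inj_onD[OF assms(2), of x j] j(1) by auto
  ultimately show "runs (Assign ''inv1'' (Elem ''sigma1'' (Var ''i'')) (Var ''i'')) 6
      (\<lambda>s'. \<forall>x<Suc j. s' ''inv1'' (s ''sigma1'' x) = x) s'"
    using j I by (auto simp: runs_iff_wp less_Suc_eq)
qed (use assms(1) in \<open>auto simp: agree_def\<close>)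

definition relative_prog :: com where
  "relative_prog = for_loop ''i'' (Var ''m'')
     (Assign ''tau'' (Var ''i'') (Elem ''inv1'' (Elem ''sigma2'' (Var ''i''))))"

lemma runs_relative:
  assumes "s ''m'' 0 = M"
  shows "runs relative_prog ((M + 1) * 20) (\<lambda>s'. \<forall>x<M. s' ''tau'' x = s ''inv1'' (s ''sigma2'' x)) s"
  unfolding relative_prog_def
proof (rule runs_for[where I = "\<lambda>j s'. \<forall>x<j. s' ''tau'' x = s ''inv1'' (s ''sigma2'' x)" and m = M and C = 7])
  fix j s' assume j: "j < M" "s' ''i'' 0 = j" and I: "\<forall>x<j. s' ''tau'' x = s ''inv1'' (s ''sigma2'' x)"
    and a: "agree (insert ''i'' (mods (Assign ''tau'' (Var ''i'') (Elem ''inv1'' (Elem ''sigma2'' (Var ''i'')))))) s s'"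
  have "s' ''inv1'' = s ''inv1''" "s' ''sigma2'' = s ''sigma2''" using agreeD[OF a] by simp_all
  then show "runs (Assign ''tau'' (Var ''i'') (Elem ''inv1'' (Elem ''sigma2'' (Var ''i'')))) 7
      (\<lambda>s'. \<forall>x<Suc j. s' ''tau'' x = s ''inv1'' (s ''sigma2'' x)) s'"
    using j I by (auto simp: runs_iff_wp less_Suc_eq)
qed (use assms(1) in \<open>auto simp: agree_def\<close>)

text \<open>
  If \<open>\<sigma>\<^sub>1 \<prec> \<sigma>\<^sub>2\<close> fails, the interval is empty; the start value 0 of the product then makes the
  final result 0.
\<close>

definition order_inner :: com where
  "order_inner = for_loop ''y'' (Var ''m'')
     (If_then
        (And (Less (Var ''x'') (Var ''y''))
          (And (Less (Elem ''sigma2'' (Var ''x'')) (Elem ''sigma2'' (Var ''y'')))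
            (Leq (Elem ''tau'' (Var ''y'')) (Elem ''tau'' (Var ''x'')))))
        (''acc'' ::= Const 0))"

definition order_prog :: com where
  "order_prog = for_loop ''x'' (Var ''m'') order_inner"

lemma mods_order_inner [simp]: "mods order_inner = {''y'', ''acc''}"
  by (auto simp: order_inner_def)

lemma runs_order_inner:
  fixes s :: state
  assumes "s ''m'' 0 = M"
  defines "bad \<equiv> \<lambda>x y. x < y \<and> s ''sigma2'' x < s ''sigma2'' y \<and> s ''tau'' y \<le> s ''tau'' x"
  shows "runs order_inner ((M + 1) * 50)
    (\<lambda>s'. s' ''acc'' 0 = (if \<exists>y<M. bad (s ''x'' 0) y then 0 else s ''acc'' 0)) s"
  unfolding order_inner_def
proof (rule runs_for[where I = "\<lambda>j s'. s' ''acc'' 0 = (if \<exists>y<j. bad (s ''x'' 0) y then 0 else s ''acc'' 0)"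
      and m = M and C = 35], goal_cases)
  case (5 j s')
  have "s' ''x'' = s ''x''" "s' ''sigma2'' = s ''sigma2''" "s' ''tau'' = s ''tau''"
    using agreeD[OF 5(4)] by simp_all
  then show ?case
    using 5(2,3) by (auto simp: runs_iff_wp less_Suc_eq bad_def)
qed (use assms(1) in \<open>auto simp: agree_def\<close>)

lemma runs_order:
  fixes s :: state
  assumes "s ''m'' 0 = M" "s ''acc'' 0 = 1"
  shows "runs order_prog ((M + 1) * (M + 1) * 70)
    (\<lambda>s'. s' ''acc'' 0 = of_bool (\<forall>x y. x < y \<and> y < M \<and> s ''sigma2'' x < s ''sigma2'' y \<longrightarrow> s ''tau'' x < s ''tau'' y)) s"
proof -
  define good where "good x \<longleftrightarrow> (\<forall>y<M. x < y \<and> s ''sigma2'' x < s ''sigma2'' y \<longrightarrow> s ''tau'' x < s ''tau'' y)" for x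
  have all: "(\<forall>x<M. good x) \<longleftrightarrow>
      (\<forall>x y. x < y \<and> y < M \<and> s ''sigma2'' x < s ''sigma2'' y \<longrightarrow> s ''tau'' x < s ''tau'' y)"
    unfolding good_def using less_trans by blast
  show ?thesis
    unfolding order_prog_def all[symmetric]
  proof (rule runs_for[where I = "\<lambda>j s'. s' ''acc'' 0 = of_bool (\<forall>x<j. good x)"
        and m = M and C = "(M + 1) * 50"], goal_cases)
    case (5 j s')
    have eq: "s' ''m'' = s ''m''" "s' ''sigma2'' = s ''sigma2''" "s' ''tau'' = s ''tau''"
      using agreeD[OF 5(4)] by simp_all
    have bad: "(\<exists>y<M. x < y \<and> s' ''sigma2'' x < s' ''sigma2'' y \<and> s' ''tau'' y \<le> s' ''tau'' x) \<longleftrightarrow> \<not> good x" for x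
      unfolding good_def eq by (auto simp: not_less)
    show ?case
      by (rule runs_weaken[OF runs_order_inner[of s' M, unfolded bad]])
        (use 5(2,3) assms eq in \<open>auto simp: less_Suc_eq\<close>)
  next
    case 7
    show ?case using nested_bound[of "M + 1" "(M + 1) * 50" 50 "acost (Var ''m'') + 10"] by (simp add: add.assoc)
  qed (use assms in \<open>auto simp: agree_def of_bool_def\<close>)
qed

text \<open>Multiplication by M is M-fold addition: each power is accumulated from the preceding
  one.\<close>

definition power_inner :: com where
  "power_inner = for_loop ''i'' (Var ''m'')
     (Assign ''pw'' (Plus (Var ''c'') (Const 1))
       (Plus (Elem ''pw'' (Plus (Var ''c'') (Const 1))) (Elem ''pw'' (Var ''c''))))"

definition power_prog :: "nat \<Rightarrow> com" where
  "power_prog K = for_loop ''c'' (Const K)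
     (Assign ''pw'' (Plus (Var ''c'') (Const 1)) (Const 0) ;; power_inner)"

lemma mods_power_inner [simp]: "mods power_inner = {''i'', ''pw''}"
  by (auto simp: power_inner_def)

lemma runs_power_inner:
  assumes "s ''m'' 0 = M" "s ''pw'' (Suc (s ''c'' 0)) = 0"
  shows "runs power_inner ((M + 1) * 40)
    (\<lambda>s'. s' ''pw'' = (s ''pw'')(Suc (s ''c'' 0) := M * s ''pw'' (s ''c'' 0))) s"
  unfolding power_inner_def
proof (rule runs_for[where I = "\<lambda>j s'. s' ''pw'' = (s ''pw'')(Suc (s ''c'' 0) := j * s ''pw'' (s ''c'' 0))"
      and m = M and C = 20], goal_cases)
  case (5 j s')
  have "s' ''c'' = s ''c''" using agreeD[OF 5(4)] by simp
  then show ?case using 5(2) by (auto simp: runs_iff_wp)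
qed (use assms in \<open>auto simp: agree_def\<close>)

lemma runs_power:
  assumes "s ''m'' 0 = M" "s ''pw'' 0 = 1"
  shows "runs (power_prog K) ((K + 1) * ((M + 1) * 70)) (\<lambda>s'. \<forall>c\<le>K. s' ''pw'' c = M ^ c) s"
  unfolding power_prog_def
proof (rule runs_for[where I = "\<lambda>j s'. \<forall>c\<le>j. s' ''pw'' c = M ^ c"
      and m = K and C = "(M + 1) * 40 + 10"], goal_cases)
  case (5 j s')
  have m: "s' ''m'' = s ''m''" using agreeD[OF 5(4)] by simp
  show ?case
    unfolding runs_iff_wp
    apply simp
    apply (rule runs_wp[OF runs_power_inner[where M = M]])
    using m 5(2,3) assms by (auto simp: le_Suc_eq)
next
  case 7
  show ?case by (rule mult_left_mono) simp_all
qed (use assms in \<open>auto simp: agree_def\<close>)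

definition prologue :: "nat \<Rightarrow> com" where
  "prologue K = ''m'' ::= Plus (Var ''n'') (Const 1) ;; inverse_prog ;; relative_prog ;;
     ''acc'' ::= Const 1 ;; order_prog ;; ''pw'' ::= Const 1 ;; power_prog K"

lemma prologue_bound:
  fixes N K :: nat
  assumes "1 \<le> N"
  shows "N * 20 + N * 20 + N * N * 70 + (K + 1) * (N * 70) + 20 \<le> N * N * (200 + 70 * K)"
proof -
  define L where "L = N * N"
  have le: "N \<le> L" "1 \<le> L" using assms by (auto simp: L_def)
  have "(K + 1) * (N * 70) \<le> (K + 1) * (L * 70)" using le by (intro mult_le_mono) simp_all
  also have "\<dots> = L * 70 + L * (70 * K)" by (simp add: algebra_simps)
  finally show ?thesis using le unfolding L_def[symmetric] distrib_left by linarith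
qed

lemma runs_prologue:
  assumes p1: "\<sigma>1 permutes {1..n}" and p2: "\<sigma>2 permutes {1..n}"
  defines "\<pi> \<equiv> inv \<sigma>1 \<circ> \<sigma>2" and "M \<equiv> n + 1"
  shows "runs (prologue K) ((M + 1) * (M + 1) * (200 + 70 * K))
    (\<lambda>s'. s' ''m'' 0 = M \<and> (\<forall>x\<le>n. s' ''tau'' x = \<pi> x) \<and> (\<forall>c\<le>K. s' ''pw'' c = M ^ c) \<and>
       s' ''acc'' 0 = of_bool (weak_ok n \<sigma>2 \<pi>)) (perm_pair_input n \<sigma>1 \<sigma>2)"
proof -
  let ?s = "perm_pair_input n \<sigma>1 \<sigma>2"
  \<comment> \<open>Thus the input arrays agree with the permutations on all cells below M,
    including cell 0.\<close>
  have z: "\<sigma>1 0 = 0" "\<sigma>2 0 = 0" using permutes_not_in[OF p1, of 0] permutes_not_in[OF p2, of 0] by auto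
  have in1: "?s ''sigma1'' x = \<sigma>1 x" if "x < M" for x
    using that z by (cases x) (auto simp: perm_pair_input_def M_def)
  have in2: "?s ''sigma2'' x = \<sigma>2 x" if "x < M" for x
    using that z by (cases x) (auto simp: perm_pair_input_def M_def)
  have inn: "?s ''n'' 0 = n" by (simp add: perm_pair_input_def)
  have rng: "\<sigma>2 x < M" if "x < M" for x
    using that z permutes_in_image[OF p2, of x] by (cases x) (auto simp: M_def)
  have inj: "inj_on (?s ''sigma1'') {..<M}"
    using permutes_inj[OF p1] in1 by (auto simp: inj_on_def inj_def)
  have rng1: "inv \<sigma>1 v < M" if "v < M" for v
  proof (cases "v = 0")
    case True
    then show ?thesis using permutes_not_in[OF permutes_inv[OF p1], of 0] by (simp add: M_def)
  next
    case False
    then have "inv \<sigma>1 v \<in> {1..n}"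
      using that permutes_in_image[OF permutes_inv[OF p1], of v] by (simp add: M_def)
    then show ?thesis by (simp add: M_def)
  qed
  have rng2: "\<sigma>1 (inv \<sigma>1 v) = v" for v by (rule permutes_inverses(1)[OF p1])
  have wk: "(\<forall>x y. x < y \<and> y < M \<and> f x < f y \<longrightarrow> g x < g y) \<longleftrightarrow> weak_ok n \<sigma>2 \<pi>"
    if "\<And>x. x < M \<Longrightarrow> f x = \<sigma>2 x" "\<And>x. x < M \<Longrightarrow> g x = \<pi> x" for f g
  proof -
    have "(x < y \<and> y < M \<and> f x < f y \<longrightarrow> g x < g y) \<longleftrightarrow> (x < y \<and> y \<le> n \<and> \<sigma>2 x < \<sigma>2 y \<longrightarrow> \<pi> x < \<pi> y)" for x y
      using that[of x] that[of y] by (cases "x < y \<and> y < M") (auto simp: M_def)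
    then show ?thesis by (simp add: weak_ok_def)
  qed
  define w :: nat where "w = of_bool (weak_ok n \<sigma>2 \<pi>)"
  define T where "T = (M + 1) * (M + 1) * (200 + 70 * K)"
  show ?thesis
    unfolding runs_iff_wp prologue_def w_def[symmetric] T_def[symmetric]
    apply (simp add: inn)
    apply (rule runs_wp[OF runs_inverse[where M = M]])
      apply (simp add: M_def)
     apply (simp add: inj)
    apply (simp only: wp_Seq)
    apply (rule runs_wp[OF runs_relative[where M = M]])
     apply (simp add: agree_def inverse_prog_def M_def)
    apply (simp only: wp_Seq wp_Assign aval.simps acost.simps)
    apply (rule runs_wp[OF runs_order[where M = M]])
      apply (simp add: agree_def inverse_prog_def relative_prog_def M_def)
     apply simp
    apply (simp only: wp_Seq wp_Assign aval.simps acost.simps)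
    apply (rule runs_wp[OF runs_power[where M = M]])
      apply (simp add: agree_def inverse_prog_def relative_prog_def order_prog_def M_def)
     apply simp
    subgoal premises pr for s1 t1 s2 t2 s3 t3 s4 t4
    proof -
      have s1: "s1 x = ?s x" if "x \<notin> {''m'', ''i'', ''inv1''}" for x
        using agreeD[OF pr(2), of x] that by (simp add: inverse_prog_def)
      have s2: "s2 x = s1 x" if "x \<notin> {''i'', ''tau''}" for x
        using agreeD[OF pr(5), of x] that by (simp add: relative_prog_def)
      have s3: "s3 x = s2 x" if "x \<notin> {''x'', ''y'', ''acc''}" for x
        using agreeD[OF pr(8), of x] that by (simp add: order_prog_def)
      have s4: "s4 x = s3 x" if "x \<notin> {''c'', ''i'', ''pw''}" for x
        using agreeD[OF pr(11), of x] that by (simp add: power_prog_def)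
      have "s1 ''m'' 0 = M" using agreeD[OF pr(2), of "''m''"] by (simp add: inverse_prog_def M_def)
      then have m: "s4 ''m'' 0 = M" by (simp add: s2 s3 s4)
      have i1: "s1 ''inv1'' v = inv \<sigma>1 v" if "v < M" for v
      proof -
        have "s1 ''inv1'' (?s ''sigma1'' (inv \<sigma>1 v)) = inv \<sigma>1 v" using pr(1)[rule_format, OF rng1[OF that]] by simp
        then show ?thesis using in1[OF rng1[OF that]] rng2 by simp
      qed
      have t2': "s2 ''tau'' x = \<pi> x" if "x < M" for x
        using pr(4) that i1[OF rng[OF that]] in2[OF that] by (simp add: s1 \<pi>_def)
      have "s3 ''acc'' 0 = w"
        unfolding w_def using pr(7) wk[of "s2 ''sigma2''" "s2 ''tau''"] t2' in2 by (simp add: s1 s2)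
      then have "s4 ''acc'' 0 = w" by (simp add: s4)
      moreover have "s4 ''tau'' x = \<pi> x" if "x \<le> n" for x
        using t2'[of x] that by (simp add: s3 s4 M_def)
      moreover have "t4 \<le> T"
        unfolding T_def using pr(3) pr(6) pr(9) pr(12) prologue_bound[of "M + 1" K] by linarith
      ultimately show ?thesis using m pr(10) by simp
    qed
    done
qed

text \<open>Both branches are merged into one state with a conditional value and one common time
  bound, so a series of conditional updates gives a single path.\<close>

lemma wp_cond_store:
  assumes "\<And>u. u \<le> t + (bcost b + acost e + 3) \<Longrightarrow>
    Q (s(x := (s x)(0 := if bval b s then aval e s else s x 0))) u"
  shows "wp (If_then b (x ::= e)) Q s t"
proof -
  have "s(x := (s x)(0 := s x 0)) = s" by simp
  then show ?thesis
    using assms[of "t + (bcost b + acost e + 3)"] assms[of "t + (bcost b + 2)"]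
    by (cases "bval b s") (simp_all add: eval_nat_numeral add.assoc)
qed

section \<open>Search for a minimal unsorted block\<close>

definition search_inv ::
    "(nat \<Rightarrow> nat) \<Rightarrow> nat \<Rightarrow> (nat \<Rightarrow> nat \<Rightarrow> bool) \<Rightarrow> nat \<Rightarrow> nat \<Rightarrow> nat \<Rightarrow> nat \<Rightarrow> bool" where
  "search_inv \<tau> n P found lo hi base \<longleftrightarrow>
     (if found = 0 then \<forall>a b. P a b \<longrightarrow> \<not> unsorted_block \<tau> a b
      else minimal_block \<tau> lo hi \<and> hi \<le> n \<and> base = Min (\<tau> ` {lo..hi}))"

text \<open>Intervals are examined with the right end growing and, for a fixed right end, the left
  end shrinking. Every proper subinterval of {a..b} therefore comes before it, which makes the first
  unsorted block found minimal.\<close>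

lemma search_inv_step:
  assumes "search_inv \<tau> n (\<lambda>a' b'. b' < b \<or> b' = b \<and> Suc a \<le> a') found lo hi base" "b \<le> n"
  shows "found = 0 \<Longrightarrow> unsorted_block \<tau> a b \<Longrightarrow> search_inv \<tau> n P 1 a b (Min (\<tau> ` {a..b}))"
    and "\<not> (found = 0 \<and> unsorted_block \<tau> a b) \<Longrightarrow>
      search_inv \<tau> n (\<lambda>a' b'. b' < b \<or> b' = b \<and> a \<le> a') found lo hi base"
proof -
  assume f: "found = 0" and u: "unsorted_block \<tau> a b"
  then have no: "\<not> unsorted_block \<tau> a' b'" if "b' < b \<or> b' = b \<and> Suc a \<le> a'" for a' b'
    using assms(1) that f unfolding search_inv_def by auto
  have "minimal_block \<tau> a b"
    unfolding minimal_block_def using u no by (metis Suc_leI le_neq_implies_less)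
  then show "search_inv \<tau> n P 1 a b (Min (\<tau> ` {a..b}))"
    using assms(2) by (simp add: search_inv_def)
next
  assume "\<not> (found = 0 \<and> unsorted_block \<tau> a b)"
  then show "search_inv \<tau> n (\<lambda>a' b'. b' < b \<or> b' = b \<and> a \<le> a') found lo hi base"
    using assms(1) unfolding search_inv_def by (metis Suc_leI le_neq_implies_less)
qed

lemma increasing_on_extend:
  assumes "a < b"
  shows "increasing_on {a..b} \<tau> \<longleftrightarrow> increasing_on {Suc a..b} \<tau> \<and> \<tau> a < \<tau> (Suc a)"
proof
  assume "increasing_on {a..b} \<tau>"
  then show "increasing_on {Suc a..b} \<tau> \<and> \<tau> a < \<tau> (Suc a)"
    using assms by (auto simp: monotone_on_def)
next
  assume *: "increasing_on {Suc a..b} \<tau> \<and> \<tau> a < \<tau> (Suc a)"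
  show "increasing_on {a..b} \<tau>"
  proof (rule increasing_onI_Suc)
    fix x assume "a \<le> x" "x < b"
    then show "\<tau> x < \<tau> (Suc x)" using * by (cases "x = a") (auto simp: monotone_on_def)
  qed
qed

definition search_test :: com where
  "search_test =
     If_then
       (And (Less (Var ''found'') (Const 1))
         (And (Less (Const 0) (Var ''des''))
           (And (Leq (Var ''mx'') (Plus (Var ''mn'') (Minus (Var ''b'') (Var ''a''))))
             (Leq (Plus (Var ''mn'') (Minus (Var ''b'') (Var ''a''))) (Var ''mx'')))))
       (''lo'' ::= Var ''a'' ;; ''hi'' ::= Var ''b'' ;; ''base'' ::= Var ''mn'' ;; ''found'' ::= Const 1)"

text \<open>The counter \<open>j\<close> runs upwards, so a descends from b - 1. Extending the
  interval by one position to the left updates minimum, maximum and the mark of a descent in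
  constant time, which keeps the whole search quadratic.\<close>

definition search_body :: com where
  "search_body =
     ''a'' ::= Minus (Minus (Var ''b'') (Const 1)) (Var ''j'') ;;
     If_then (Leq (Elem ''tau'' (Plus (Var ''a'') (Const 1))) (Elem ''tau'' (Var ''a''))) (''des'' ::= Const 1) ;;
     If_then (Less (Elem ''tau'' (Var ''a'')) (Var ''mn'')) (''mn'' ::= Elem ''tau'' (Var ''a'')) ;;
     If_then (Less (Var ''mx'') (Elem ''tau'' (Var ''a''))) (''mx'' ::= Elem ''tau'' (Var ''a'')) ;;
     search_test"

definition search_inner :: com where
  "search_inner = for_loop ''j'' (Minus (Var ''b'') (Const 1)) search_body"

definition search_prog :: com where
  "search_prog =
     ''found'' ::= Const 0 ;;
     for_loop ''b'' (Var ''m'')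
       (''mn'' ::= Elem ''tau'' (Var ''b'') ;; ''mx'' ::= Elem ''tau'' (Var ''b'') ;;
        ''des'' ::= Const 0 ;; search_inner)"

abbreviation search_state :: "(nat \<Rightarrow> nat) \<Rightarrow> nat \<Rightarrow> (nat \<Rightarrow> nat \<Rightarrow> bool) \<Rightarrow> state \<Rightarrow> bool" where
  "search_state \<tau> n P s \<equiv> search_inv \<tau> n P (s ''found'' 0) (s ''lo'' 0) (s ''hi'' 0) (s ''base'' 0)"

definition scan_inv :: "(nat \<Rightarrow> nat) \<Rightarrow> nat \<Rightarrow> nat \<Rightarrow> nat \<Rightarrow> state \<Rightarrow> bool" where
  "scan_inv \<tau> n b a s \<longleftrightarrow>
     s ''mn'' 0 = Min (\<tau> ` {a..b}) \<and> s ''mx'' 0 = Max (\<tau> ` {a..b}) \<and>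
     s ''des'' 0 = (if increasing_on {a..b} \<tau> then 0 else 1) \<and>
     search_state \<tau> n (\<lambda>a' b'. b' < b \<or> b' = b \<and> a \<le> a') s"

lemma mods_search_body [simp]:
  "mods search_body = {''a'', ''des'', ''mn'', ''mx'', ''lo'', ''hi'', ''base'', ''found''}"
  by (auto simp: search_body_def search_test_def)

lemma mods_search_inner [simp]: "mods search_inner = insert ''j'' (mods search_body)"
  by (simp add: search_inner_def)

lemma mods_search_prog [simp]: "mods search_prog = insert ''b'' (insert ''j'' (mods search_body))"
  by (auto simp: search_prog_def)

lemma runs_search_body:
  assumes b: "s ''b'' 0 = b" "b \<le> n" and j: "s ''j'' 0 = j" "j < b - 1"
    and I: "scan_inv (s ''tau'') n b (b - j) s"
  shows "runs search_body 200 (scan_inv (s ''tau'') n b (b - Suc j)) s"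
proof -
  let ?\<tau> = "s ''tau''"
  define a where "a = b - Suc j"
  have a: "1 \<le> a" "a < b" "b - j = Suc a" "b - Suc 0 - j = a" using j by (auto simp: a_def)
  have set: "{a..b} = insert a {Suc a..b}" using a by auto
  have mn: "Min (?\<tau> ` {a..b}) = min (?\<tau> a) (Min (?\<tau> ` {Suc a..b}))"
    and mx: "Max (?\<tau> ` {a..b}) = max (?\<tau> a) (Max (?\<tau> ` {Suc a..b}))"
    unfolding set image_insert using a by (subst Min_insert Max_insert; simp)+
  note inc = increasing_on_extend[OF a(2), of ?\<tau>]
  have I': "s ''mn'' 0 = Min (?\<tau> ` {Suc a..b})" "s ''mx'' 0 = Max (?\<tau> ` {Suc a..b})"
    "s ''des'' 0 = (if increasing_on {Suc a..b} ?\<tau> then 0 else 1)"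
    and S: "search_state ?\<tau> n (\<lambda>a' b'. b' < b \<or> b' = b \<and> Suc a \<le> a') s"
    using I unfolding scan_inv_def a(3) by auto
  have ub: "unsorted_block ?\<tau> a b \<longleftrightarrow> \<not> increasing_on {a..b} ?\<tau> \<and> Max (?\<tau> ` {a..b}) = Min (?\<tau> ` {a..b}) + (b - a)"
    using a by (simp add: unsorted_block_def contiguous_def)
  define mn' mx' des' where "mn' = Min (?\<tau> ` {a..b})" and "mx' = Max (?\<tau> ` {a..b})"
    and "des' = (if increasing_on {a..b} ?\<tau> then 0 else 1 :: nat)"
  have mn'': "mn' = (if ?\<tau> a < s ''mn'' 0 then ?\<tau> a else s ''mn'' 0)"
    and mx'': "mx' = (if s ''mx'' 0 < ?\<tau> a then ?\<tau> a else s ''mx'' 0)"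
    and des'': "des' = (if ?\<tau> (Suc a) \<le> ?\<tau> a then 1 else s ''des'' 0)"
    unfolding mn'_def mx'_def des'_def mn mx I' inc by (auto simp: min_def max_def)
  note step = search_inv_step[OF S b(2)]
  have new: "search_inv ?\<tau> n (\<lambda>a' b'. b' < b \<or> b' = b \<and> a \<le> a') 1 a b mn'"
    if "s ''found'' 0 = 0" "0 < des'" "mx' = mn' + (b - a)"
    unfolding mn'_def by (rule step(1)) (use that in \<open>auto simp: ub mn'_def mx'_def des'_def split: if_splits\<close>)
  have old: "search_state ?\<tau> n (\<lambda>a' b'. b' < b \<or> b' = b \<and> a \<le> a') s"
    if "\<not> (s ''found'' 0 = 0 \<and> 0 < des' \<and> mx' = mn' + (b - a))"
    by (rule step(2)) (use that in \<open>auto simp: ub mn'_def mx'_def des'_def split: if_splits\<close>)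
  define Q where "Q s' t \<longleftrightarrow> t \<le> 200 \<and> scan_inv ?\<tau> n b a s'" for s' and t :: nat
  have test: "wp search_test Q s3 u"
    if v: "s3 ''a'' 0 = a" "s3 ''b'' 0 = b" "s3 ''mn'' 0 = mn'" "s3 ''mx'' 0 = mx'" "s3 ''des'' 0 = des'"
      and o: "s3 ''found'' 0 = s ''found'' 0" "s3 ''lo'' 0 = s ''lo'' 0" "s3 ''hi'' 0 = s ''hi'' 0"
        "s3 ''base'' 0 = s ''base'' 0" and u: "u \<le> 100" for s3 u
  proof (cases "s ''found'' 0 = 0 \<and> 0 < des' \<and> mx' = mn' + (b - a)")
    case True
    then show ?thesis
      using v o u new unfolding search_test_def
      by (simp add: Q_def scan_inv_def mn'_def mx'_def des'_def)
  next
    case False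
    then have "\<not> (s ''found'' 0 < 1 \<and> 0 < des' \<and> \<not> mn' + (b - a) < mx' \<and> \<not> mx' < mn' + (b - a))"
      by auto
    then show ?thesis
      using v o u old[OF False] unfolding search_test_def
      by (auto simp: Q_def scan_inv_def mn'_def mx'_def des'_def)
  qed
  have "wp search_body Q s 0"
    unfolding search_body_def
    apply (simp only: wp_Seq wp_Assign)
    apply (rule wp_cond_store)
    apply (simp only: wp_Seq)
    apply (rule wp_cond_store)
    apply (simp only: wp_Seq)
    apply (rule wp_cond_store)
    apply (rule test)
             apply (simp_all add: b(1) j(1) mn'' mx'' des'' not_less flip: a_def)
    done
  moreover have "Q = (\<lambda>s' t. t \<le> 200 \<and> scan_inv ?\<tau> n b a s')" by (intro ext) (simp add: Q_def)
  ultimately show ?thesis unfolding runs_iff_wp a_def[symmetric] by simp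
qed

lemma runs_search_inner:
  assumes b: "s ''b'' 0 = b" "b \<le> n" and I: "scan_inv (s ''tau'') n b b s"
  shows "runs search_inner ((n + 1) * 220) (search_state (s ''tau'') n (\<lambda>a' b'. b' < Suc b)) s"
  unfolding search_inner_def
proof (rule runs_for[where I = "\<lambda>j. scan_inv (s ''tau'') n b (b - j)" and m = "b - 1" and C = 200], goal_cases)
  case 1
  show ?case using I by simp
next
  case 2
  show ?case by (simp add: scan_inv_def)
next
  case 3
  show ?case by simp
next
  case (4 s')
  show ?case using agreeD[OF 4, of "''b''"] b by simp
next
  case (5 j s')
  have "s' ''b'' = s ''b''" "s' ''tau'' = s ''tau''" using agreeD[OF 5(4)] by simp_all
  then show ?case using runs_search_body[of s' b n j] 5 b by simp
next
  case (6 s')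
  then have S: "search_state (s ''tau'') n (\<lambda>a' b'. b' < b \<or> b' = b \<and> b - (b - 1) \<le> a') s'"
    by (simp add: scan_inv_def)
  have "\<not> unsorted_block (s ''tau'') a' b'"
    if "\<forall>a' b'. b' < b \<or> b' = b \<and> b - (b - 1) \<le> a' \<longrightarrow> \<not> unsorted_block (s ''tau'') a' b'" "b' < Suc b" for a' b'
  proof
    assume u: "unsorted_block (s ''tau'') a' b'"
    then have "1 \<le> a'" by (simp add: unsorted_block_def)
    \<comment> \<open>The bound b - (b - 1) is 1 for positive b and 0 for b = 0, so it never exceeds
      a left end, which is at least 1.\<close>
    then have "b' < b \<or> b' = b \<and> b - (b - 1) \<le> a'" using that(2) by auto
    then show False using that(1) u by blast
  qed
  then show ?case using S unfolding search_inv_def by (metis (no_types, lifting))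
next
  case 7
  have "b - 1 + 1 \<le> n + 1" using b(2) by linarith
  moreover have "200 + acost (Minus (Var ''b'') (Const 1)) + 10 \<le> 220" by simp
  ultimately show ?case by (rule mult_le_mono)
qed

lemma runs_search:
  assumes m: "s ''m'' 0 = n + 1"
  shows "runs search_prog ((n + 2) * (n + 2) * 300)
    (search_state (s ''tau'') n (\<lambda>a' b'. b' \<le> n)) s"
proof -
  let ?c = "''mn'' ::= Elem ''tau'' (Var ''b'') ;; ''mx'' ::= Elem ''tau'' (Var ''b'') ;;
        ''des'' ::= Const 0 ;; search_inner"
  let ?s = "s(''found'' := (s ''found'')(0 := 0))"
  have loop: "runs (for_loop ''b'' (Var ''m'') ?c) ((n + 2) * ((n + 1) * 220 + 40))
     (search_state (s ''tau'') n (\<lambda>a' b'. b' \<le> n)) ?s"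
  proof (rule runs_for[where I = "\<lambda>j. search_state (s ''tau'') n (\<lambda>a' b'. b' < j)" and m = "n + 1"
        and C = "(n + 1) * 220 + 25"], goal_cases)
    case (5 j s')
    have t: "s' ''tau'' = s ''tau''" using agreeD[OF 5(4), of "''tau''"] by simp
    define v where "v = s ''tau'' j"
    let ?s1 = "s'(''mn'' := (s' ''mn'')(0 := v), ''mx'' := (s' ''mx'')(0 := v), ''des'' := (s' ''des'')(0 := 0))"
    have ci: "scan_inv (?s1 ''tau'') n j j ?s1"
    proof -
      \<comment> \<open>Intervals with at most one position are increasing, so the scan towards the
        left may start with a = b counted as examined.\<close>
      have "\<not> unsorted_block (s ''tau'') a' b'"
        if "b' < j \<or> b' = j \<and> j \<le> a'" "\<forall>a' b'. b' < j \<longrightarrow> \<not> unsorted_block (s ''tau'') a' b'" for a' b'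
        using that by (auto simp: unsorted_block_def monotone_on_def)
      then have "search_state (s ''tau'') n (\<lambda>a' b'. b' < j \<or> b' = j \<and> j \<le> a') s'"
        using 5(2) unfolding search_inv_def by presburger
      then show ?thesis by (simp add: scan_inv_def t v_def monotone_on_def)
    qed
    show ?case
      unfolding runs_iff_wp
      apply (simp only: wp_Seq wp_Assign)
      apply (rule runs_wp[OF runs_search_inner[where b = j and n = n]])
      using 5(1,3) ci by (simp_all add: t flip: v_def)
  next
    case (6 s')
    then show ?case by (simp add: less_Suc_eq_le)
  next
    case 7
    show ?case by (intro mult_le_mono) simp_all
  qed (use m in \<open>auto simp: agree_def search_inv_def\<close>)
  have bound: "(n + 2) * ((n + 1) * 220 + 40) + 10 \<le> (n + 2) * (n + 2) * 300"
    by (simp add: algebra_simps)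
  show ?thesis
    unfolding runs_iff_wp search_prog_def
    apply (simp only: wp_Seq wp_Assign aval.simps acost.simps)
    apply (rule runs_wp[OF loop])
    subgoal for s' t' using bound by linarith
    done
qed

section \<open>Computing the chain partition of the block\<close>

definition chain_inner :: com where
  "chain_inner = for_loop ''y'' (Var ''x'')
     (If_then
       (And (Leq (Var ''lo'') (Var ''y''))
         (And (Less (Elem ''tau'' (Var ''x'')) (Elem ''tau'' (Var ''y'')))
           (Leq (Var ''cx'') (Elem ''col'' (Var ''y'')))))
       (''cx'' ::= Plus (Elem ''col'' (Var ''y'')) (Const 1)))"

text \<open>Colour K marks the positions outside the block: no chain has that number, so a threshold
  at such a position is recognised as silent.\<close>

definition chain_prog :: "nat \<Rightarrow> com" where
  "chain_prog K = for_loop ''x'' (Var ''m'')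
     (''cx'' ::= Const K ;;
      If_then (And (Leq (Var ''lo'') (Var ''x'')) (Leq (Var ''x'') (Var ''hi'')))
        (''cx'' ::= Const 0 ;; chain_inner) ;;
      Assign ''col'' (Var ''x'') (Var ''cx''))"

lemma mods_chain_inner [simp]: "mods chain_inner = {''y'', ''cx''}"
  by (auto simp: chain_inner_def)

lemma mods_chain_prog [simp]: "mods (chain_prog K) = {''x'', ''y'', ''cx'', ''col''}"
  by (auto simp: chain_prog_def)

text \<open>The loop evaluates the maximum in the recursion of \<open>chain_index\<close> as a
  running maximum; earlier colours are already in the array.\<close>

lemma runs_chain_inner:
  assumes x: "s ''x'' 0 = x" and cx: "s ''cx'' 0 = 0" and lo: "s ''lo'' 0 = lo"
    and col: "\<And>y. lo \<le> y \<Longrightarrow> y < x \<Longrightarrow> s ''col'' y = chain_index (s ''tau'') lo y"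
  shows "runs chain_inner ((x + 1) * 60) (\<lambda>s'. s' ''cx'' 0 = chain_index (s ''tau'') lo x) s"
proof -
  let ?A = "\<lambda>j. (\<lambda>y. Suc (chain_index (s ''tau'') lo y)) ` {y \<in> {lo..<j}. s ''tau'' x < s ''tau'' y}"
  show ?thesis
    unfolding chain_inner_def
  proof (rule runs_for[where I = "\<lambda>j s'. s' ''cx'' 0 = Max (insert 0 (?A j))" and m = x and C = 40], goal_cases)
    case (4 s')
    show ?case using agreeD[OF 4, of "''x''"] x by simp
  next
    case (5 j s')
    have eq: "s' ''x'' = s ''x''" "s' ''tau'' = s ''tau''" "s' ''col'' = s ''col''" "s' ''lo'' = s ''lo''"
      using agreeD[OF 5(4)] by simp_all
    let ?t = "s ''tau''"
    let ?c = "If_then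
       (And (Leq (Var ''lo'') (Var ''y''))
         (And (Less (Elem ''tau'' (Var ''x'')) (Elem ''tau'' (Var ''y'')))
           (Leq (Var ''cx'') (Elem ''col'' (Var ''y'')))))
       (''cx'' ::= Plus (Elem ''col'' (Var ''y'')) (Const 1))"
    show ?case
    proof (cases "lo \<le> j \<and> ?t x < ?t j")
      case True
      then have "{y \<in> {lo..<Suc j}. ?t x < ?t y} = insert j {y \<in> {lo..<j}. ?t x < ?t y}"
        by (auto simp: less_Suc_eq)
      then have "Max (insert 0 (?A (Suc j))) = Max (insert (Suc (chain_index ?t lo j)) (insert 0 (?A j)))"
        by (simp add: insert_commute)
      also have "\<dots> = max (Suc (chain_index ?t lo j)) (Max (insert 0 (?A j)))"
        by (rule Max_insert) simp_all
      finally have "Max (insert 0 (?A (Suc j))) = max (Suc (chain_index ?t lo j)) (s' ''cx'' 0)"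
        using 5(2) by simp
      moreover have "runs ?c 40 (\<lambda>s''. s'' ''cx'' 0 = Z) s'"
        if "Z = max (Suc (chain_index ?t lo j)) (s' ''cx'' 0)" for Z
        unfolding that using True eq x lo col[of j] 5(1,3) by (simp add: runs_iff_wp max_def)
      ultimately show ?thesis by blast
    next
      case False
      then have "{y \<in> {lo..<Suc j}. ?t x < ?t y} = {y \<in> {lo..<j}. ?t x < ?t y}"
        by (auto simp: less_Suc_eq)
      then have "Max (insert 0 (?A (Suc j))) = s' ''cx'' 0" using 5(2) by simp
      moreover have "runs ?c 40 (\<lambda>s''. s'' ''cx'' 0 = Z) s'" if "Z = s' ''cx'' 0" for Z
        unfolding that using False eq x lo 5(3) by (auto simp: runs_iff_wp)
      ultimately show ?thesis by blast
    qed
  next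
    case (6 s')
    then show ?case by (simp only: chain_index.simps[of _ lo x])
  qed (simp_all add: cx)
qed

lemma runs_chain:
  assumes m: "s ''m'' 0 = n + 1" and lo: "s ''lo'' 0 = lo" and hi: "s ''hi'' 0 = hi" "hi \<le> n"
  shows "runs (chain_prog K) ((n + 2) * (n + 2) * 120)
    (\<lambda>s'. \<forall>x\<le>n. s' ''col'' x = (if lo \<le> x \<and> x \<le> hi then chain_index (s ''tau'') lo x else K)) s"
  unfolding chain_prog_def
proof (rule runs_for[where I = "\<lambda>j s'. \<forall>x<j. s' ''col'' x = (if lo \<le> x \<and> x \<le> hi then chain_index (s ''tau'') lo x else K)"
      and m = "n + 1" and C = "(n + 2) * 60 + 45"], goal_cases)
  case (4 s')
  show ?case using agreeD[OF 4, of "''m''"] m by simp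
next
  case (5 j s')
  have eq: "s' ''tau'' = s ''tau''" "s' ''lo'' = s ''lo''" "s' ''hi'' = s ''hi''"
    using agreeD[OF 5(4)] by simp_all
  have le: "(j + 1) * 60 \<le> (n + 2) * 60" using 5(1) by simp
  show ?case
  proof (cases "lo \<le> j \<and> j \<le> hi")
    case False
    then show ?thesis
      using 5(2,3) eq lo hi by (auto simp: runs_iff_wp less_Suc_eq)
  next
    case True
    then have nl: "\<not> j < lo" "\<not> hi < j" by simp_all
    show ?thesis
      unfolding runs_iff_wp
      apply (simp only: wp_Seq wp_Assign wp_Cond)
      apply (simp add: 5(3) eq lo hi nl)
      apply (rule runs_wp[OF runs_chain_inner[where x = j and lo = lo]])
          apply (simp_all add: 5(3) eq lo)
      using 5(2) hi True 5(1) apply simp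
      using 5(1,2) hi True le apply (auto simp: agree_def less_Suc_eq 5(3))
      done
  qed
next
  case 7
  have "(n + 1 + 1) * ((n + 2) * 60 + 45 + acost (Var ''m'') + 10) = (n + 2) * ((n + 2) * 60 + 57)" by simp
  also have "\<dots> \<le> (n + 2) * (n + 2) * (60 + 57)" by (rule nested_bound) simp_all
  finally show ?case by simp
qed auto

definition sort_prog :: com where
  "sort_prog = for_loop ''x'' (Var ''m'')
     (If_then (And (Leq (Var ''lo'') (Var ''x'')) (Leq (Var ''x'') (Var ''hi'')))
        (Assign ''tau'' (Var ''x'') (Plus (Var ''base'') (Minus (Var ''x'') (Var ''lo'')))))"

lemma mods_sort_prog [simp]: "mods sort_prog = {''x'', ''tau''}"
  by (auto simp: sort_prog_def)

lemma runs_sort: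
  assumes m: "s ''m'' 0 = n + 1" and lo: "s ''lo'' 0 = lo" and hi: "s ''hi'' 0 = hi" "hi \<le> n"
    and base: "s ''base'' 0 = c"
  shows "runs sort_prog ((n + 2) * 50) (\<lambda>s'. s' ''tau'' = sort_block lo hi c (s ''tau'')) s"
  unfolding sort_prog_def
proof (rule runs_for[where I = "\<lambda>j s'. s' ''tau'' = (\<lambda>x. if x < j then sort_block lo hi c (s ''tau'') x else s ''tau'' x)"
      and m = "n + 1" and C = 30], goal_cases)
  case (4 s')
  show ?case using agreeD[OF 4, of "''m''"] m by simp
next
  case (5 j s')
  have "s' ''lo'' = s ''lo''" "s' ''hi'' = s ''hi''" "s' ''base'' = s ''base''"
    using agreeD[OF 5(4)] by simp_all
  then show ?case
    using 5(2,3) lo hi base by (auto simp: runs_iff_wp sort_block_def fun_eq_iff less_Suc_eq)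
next
  case (6 s')
  then show ?case using hi by (auto simp: sort_block_def fun_eq_iff)
qed auto

section \<open>Evaluation of the table\<close>

definition odometer :: "nat \<Rightarrow> com" where
  "odometer K = for_loop ''c'' (Const K)
     (If_then (Less (Const 0) (Var ''carry''))
       (Cond (Less (Elem ''d'' (Var ''c'')) (Var ''n''))
         (Assign ''d'' (Var ''c'') (Plus (Elem ''d'' (Var ''c'')) (Const 1)) ;; ''carry'' ::= Const 0)
         (Assign ''d'' (Var ''c'') (Const 0))))"

lemma mods_odometer [simp]: "mods (odometer K) = {''c'', ''d'', ''carry''}"
  by (auto simp: odometer_def)

text \<open>Addition of 1 to a numeral in base n + 1: the code plus the carry weighted with
  \<open>(n + 1) ^ j\<close> is invariant. The hypothesis on the code excludes an overflow, so the
  final carry is 0.\<close>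

lemma runs_odometer:
  assumes n: "s ''n'' 0 = n" and carry: "s ''carry'' 0 = 1" and d: "\<forall>c<K. s ''d'' c \<le> n"
    and lt: "code (n + 1) K (s ''d'') + 1 < (n + 1) ^ K"
  shows "runs (odometer K) ((K + 1) * 60)
    (\<lambda>s'. (\<forall>c<K. s' ''d'' c \<le> n) \<and> code (n + 1) K (s' ''d'') = code (n + 1) K (s ''d'') + 1) s"
proof -
  let ?M = "n + 1"
  let ?I = "\<lambda>j s'. (\<forall>c<K. s' ''d'' c \<le> n) \<and> s' ''carry'' 0 \<le> (1 :: nat) \<and>
      code ?M K (s' ''d'') + s' ''carry'' 0 * ?M ^ j = code ?M K (s ''d'') + 1"
  show ?thesis
    unfolding odometer_def
  proof (rule runs_for[where I = ?I and m = K and C = 30], goal_cases)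
    case 1
    show ?case using d carry by simp
  next
    case (5 j s')
    have n': "s' ''n'' 0 = n" using agreeD[OF 5(4), of "''n''"] n by simp
    let ?d = "s' ''d''"
    have up: "code ?M K (?d(j := v)) + ?d j * ?M ^ j = code ?M K ?d + v * ?M ^ j" for v
      by (rule code_upd[OF 5(1)])
    consider "s' ''carry'' 0 = 0" | "s' ''carry'' 0 = 1" "?d j < n" | "s' ''carry'' 0 = 1" "?d j = n"
      using 5(1,2) by (metis le_neq_implies_less less_one)
    then show ?case
    proof cases
      case 1
      then show ?thesis using 5(2,3) by (simp add: runs_iff_wp)
    next
      case 2
      have "code ?M K (?d(j := Suc (?d j))) = code ?M K ?d + ?M ^ j" using up[of "Suc (?d j)"] by simp
      then show ?thesis using 2 5(2,3) n' by (simp add: runs_iff_wp)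
    next
      case 3
      have "code ?M K (?d(j := 0)) + ?M ^ Suc j = code ?M K ?d + ?M ^ j" using up[of 0] 3(2) by simp
      then show ?thesis using 3 5(2,3) n' by (simp add: runs_iff_wp)
    qed
  next
    case (6 s')
    have "s' ''carry'' 0 = 0"
    proof (rule ccontr)
      assume "s' ''carry'' 0 \<noteq> 0"
      then have "s' ''carry'' 0 = 1" using 6(1) by linarith
      then show False using 6(1) lt by simp
    qed
    then show ?case using 6(1) by simp
  qed auto
qed

text \<open>
  A threshold that is not the position of an element of its own chain can be lowered by 1 without
  changing the elements kept.  Such a threshold is stored in \<open>sil\<close>; the value \<open>K\<close> means that there
  is none.
\<close>

definition silent_loop :: "nat \<Rightarrow> com" where
  "silent_loop K = for_loop ''c'' (Const K)
     (If_then
       (And (Less (Const 0) (Elem ''d'' (Var ''c'')))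
         (Neg (And (Leq (Elem ''col'' (Elem ''d'' (Var ''c''))) (Var ''c''))
            (Leq (Var ''c'') (Elem ''col'' (Elem ''d'' (Var ''c'')))))))
       (''sil'' ::= Var ''c''))"

lemma mods_silent_loop [simp]: "mods (silent_loop K) = {''c'', ''sil''}"
  by (auto simp: silent_loop_def)

lemma runs_silent:
  assumes "s ''sil'' 0 = K"
  shows "runs (silent_loop K) ((K + 1) * 60)
    (\<lambda>s'. (s' ''sil'' 0 = K \<and> (\<forall>c<K. 0 < s ''d'' c \<longrightarrow> s ''col'' (s ''d'' c) = c)) \<or>
       (s' ''sil'' 0 < K \<and> 0 < s ''d'' (s' ''sil'' 0) \<and>
        s ''col'' (s ''d'' (s' ''sil'' 0)) \<noteq> s' ''sil'' 0)) s"
  unfolding silent_loop_def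
proof (rule runs_for[where I = "\<lambda>j s'. (s' ''sil'' 0 = K \<and> (\<forall>c<j. 0 < s ''d'' c \<longrightarrow> s ''col'' (s ''d'' c) = c)) \<or>
       (s' ''sil'' 0 < K \<and> 0 < s ''d'' (s' ''sil'' 0) \<and>
        s ''col'' (s ''d'' (s' ''sil'' 0)) \<noteq> s' ''sil'' 0)" and m = K and C = 40], goal_cases)
  case 1
  show ?case using assms by simp
next
  case (5 j s')
  have eq: "s' ''d'' = s ''d''" "s' ''col'' = s ''col''" using agreeD[OF 5(4)] by simp_all
  show ?case
  proof (cases "0 < s ''d'' j \<and> s ''col'' (s ''d'' j) \<noteq> j")
    case True
    then show ?thesis using 5(1,3) by (simp add: runs_iff_wp eq)
  next
    case False
    then have "\<not> (0 < s ''d'' j \<and> (s ''col'' (s ''d'' j) \<le> j \<longrightarrow> \<not> j \<le> s ''col'' (s ''d'' j)))"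
      by auto
    then show ?thesis using False 5(2,3) by (auto simp: runs_iff_wp eq not_less less_Suc_eq)
  qed
qed auto

definition free_loop :: "nat \<Rightarrow> com" where
  "free_loop K = for_loop ''e'' (Const K)
     (If_then
       (And (Less (Elem ''d'' (Var ''c'')) (Elem ''d'' (Var ''e'')))
         (Less (Elem ''tau'' (Elem ''d'' (Var ''c''))) (Elem ''tau'' (Elem ''d'' (Var ''e'')))))
       (''fr'' ::= Const 0))"

lemma mods_free_loop [simp]: "mods (free_loop K) = {''e'', ''fr''}"
  by (auto simp: free_loop_def)

lemma runs_free:
  fixes s :: state
  assumes "s ''fr'' 0 = 1"
  defines "blocked \<equiv> \<lambda>c e. s ''d'' c < s ''d'' e \<and> s ''tau'' (s ''d'' c) < s ''tau'' (s ''d'' e)"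
  shows "runs (free_loop K) ((K + 1) * 60)
    (\<lambda>s'. s' ''fr'' 0 = (if \<exists>e<K. blocked (s ''c'' 0) e then 0 else 1)) s"
  unfolding free_loop_def
proof (rule runs_for[where I = "\<lambda>j s'. s' ''fr'' 0 = (if \<exists>e<j. blocked (s ''c'' 0) e then 0 else 1)"
      and m = K and C = 40], goal_cases)
  case 1
  show ?case using assms by simp
next
  case (5 j s')
  have eq: "s' ''d'' = s ''d''" "s' ''tau'' = s ''tau''" "s' ''c'' = s ''c''"
    using agreeD[OF 5(4)] by simp_all
  show ?case using 5(2,3) by (auto simp: runs_iff_wp eq less_Suc_eq blocked_def)
qed auto

definition sum_loop :: "nat \<Rightarrow> com" where
  "sum_loop K = for_loop ''c'' (Const K)
     (If_then (Less (Const 0) (Elem ''d'' (Var ''c'')))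
       (''fr'' ::= Const 1 ;; free_loop K ;;
        If_then (Less (Const 0) (Var ''fr''))
          (''sum'' ::= Plus (Var ''sum'')
             (Elem ''f'' (Minus (Plus (Var ''p'') (Const 1)) (Elem ''pw'' (Var ''c'')))))))"

lemma mods_sum_loop [simp]: "mods (sum_loop K) = {''c'', ''e'', ''fr'', ''sum''}"
  by (auto simp: sum_loop_def)

text \<open>The counter \<open>p\<close> starts at 0 while cell 0 is the base case, hence the
  address \<open>p\<close> + 1. With a silent threshold the cell is a copy of one earlier cell; only
  without one does the sum over the free chains apply.\<close>

definition cell_prog :: "nat \<Rightarrow> com" where
  "cell_prog K =
     ''sil'' ::= Const K ;; silent_loop K ;;
     Cond (Less (Var ''sil'') (Const K))
       (Assign ''f'' (Plus (Var ''p'') (Const 1))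
         (Elem ''f'' (Minus (Plus (Var ''p'') (Const 1)) (Elem ''pw'' (Var ''sil'')))))
       (''sum'' ::= Const 0 ;; sum_loop K ;; Assign ''f'' (Plus (Var ''p'') (Const 1)) (Var ''sum''))"

lemma mods_cell_prog [simp]: "mods (cell_prog K) = {''c'', ''e'', ''fr'', ''sum'', ''sil'', ''f''}"
  by (auto simp: cell_prog_def)

text \<open>Values that an earlier block left in \<open>f\<close> do no harm: look-ups go to smaller
  addresses, all rewritten before in the current pass.\<close>

definition table_prog :: "nat \<Rightarrow> com" where
  "table_prog K =
     Assign ''f'' (Const 0) (Var ''acc'') ;;
     for_loop ''c'' (Const K) (Assign ''d'' (Var ''c'') (Const 0)) ;;
     for_loop ''p'' (Minus (Elem ''pw'' (Const K)) (Const 1))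
       (''carry'' ::= Const 1 ;; odometer K ;; cell_prog K) ;;
     ''acc'' ::= Elem ''f'' (Minus (Elem ''pw'' (Const K)) (Const 1))"

lemma mods_table_prog [simp]:
  "mods (table_prog K) = {''acc'', ''p'', ''d'', ''carry'', ''c'', ''e'', ''fr'', ''sum'', ''sil'', ''f''}"
  by (auto simp: table_prog_def)

lemma code_dec:
  assumes "c < K" "0 < d c"
  shows "code M K (d(c := d c - 1)) = code M K d - M ^ c" "M ^ c \<le> code M K d"
proof -
  have "code M K (d(c := d c - 1)) + d c * M ^ c = code M K d + (d c - 1) * M ^ c"
    by (rule code_upd[OF assms(1)])
  moreover have "d c * M ^ c = (d c - 1) * M ^ c + M ^ c"
    using assms(2) by (cases "d c") simp_all
  ultimately have "code M K (d(c := d c - 1)) + M ^ c = code M K d" by linarith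
  then show "code M K (d(c := d c - 1)) = code M K d - M ^ c" "M ^ c \<le> code M K d" by linarith+
qed

context chains
begin

definition ready :: "nat \<Rightarrow> state \<Rightarrow> bool" where
  "ready n s \<longleftrightarrow> s ''n'' 0 = n \<and> s ''tau'' = \<tau> \<and> (\<forall>x\<le>n. s ''col'' x = col x) \<and>
     (\<forall>c\<le>K. s ''pw'' c = (n + 1) ^ c)"

text \<open>Quantifying over threshold functions instead of addresses avoids a decoding map; digits
  beyond K are irrelevant to both sides.\<close>

definition table :: "nat \<Rightarrow> nat \<Rightarrow> nat \<Rightarrow> state \<Rightarrow> bool" where
  "table n A j s \<longleftrightarrow>
     (\<forall>e. (\<forall>c<K. e c \<le> n) \<longrightarrow> code (n + 1) K e \<le> j \<longrightarrow> s ''f'' (code (n + 1) K e) = A * ways e)"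

lemma runs_sum:
  assumes r: "ready n s" and z: "s ''sum'' 0 = 0" and p: "s ''p'' 0 = p"
  shows "runs (sum_loop K) ((K + 1) * (K + 1) * 140)
    (\<lambda>s'. s' ''sum'' 0 = (\<Sum>c | c < K \<and> free (s ''d'') c. s ''f'' (p + 1 - (n + 1) ^ c))) s"
  unfolding sum_loop_def
proof (rule runs_for[where I = "\<lambda>j s'. s' ''sum'' 0 = (\<Sum>c | c < j \<and> free (s ''d'') c. s ''f'' (p + 1 - (n + 1) ^ c))"
      and m = K and C = "(K + 1) * 60 + 40"], goal_cases)
  case (5 j s')
  let ?d = "s ''d''" and ?g = "\<lambda>c. s ''f'' (p + 1 - (n + 1) ^ c)"
  have eq: "s' ''d'' = s ''d''" "s' ''tau'' = s ''tau''" "s' ''f'' = s ''f''" "s' ''pw'' = s ''pw''" "s' ''p'' = s ''p''"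
    using agreeD[OF 5(4)] by simp_all
  have pw: "s ''pw'' j = (n + 1) ^ j" and tau: "s ''tau'' = \<tau>" using r 5(1) by (auto simp: ready_def)
  have split: "(\<Sum>c | c < Suc j \<and> free ?d c. ?g c) = (if free ?d j then s' ''sum'' 0 + ?g j else s' ''sum'' 0)"
  proof (cases "free ?d j")
    case True
    then have "{c. c < Suc j \<and> free ?d c} = insert j {c. c < j \<and> free ?d c}" by auto
    then show ?thesis using True 5(2) by simp
  next
    case False
    then have "{c. c < Suc j \<and> free ?d c} = {c. c < j \<and> free ?d c}" by (auto simp: less_Suc_eq)
    then show ?thesis using False 5(2) by simp
  qed
  show ?case
  proof (cases "0 < ?d j")
    case False
    then have "\<not> free ?d j" by (simp add: free_def)
    then show ?thesis unfolding split using False 5(3) eq by (simp add: runs_iff_wp)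
  next
    case True
    then have fr: "free ?d j \<longleftrightarrow> \<not> (\<exists>e<K. ?d j < ?d e \<and> \<tau> (?d j) < \<tau> (?d e))" by (simp add: free_def)
    define Z where "Z = (if free ?d j then s' ''sum'' 0 + ?g j else s' ''sum'' 0)"
    show ?thesis
      unfolding split Z_def[symmetric] runs_iff_wp
      apply (simp only: wp_Cond wp_Seq wp_Assign)
      apply (simp add: 5(3) eq True del: wp_Cond flip: One_nat_def)
      apply (rule runs_wp[OF runs_free])
       apply simp
      subgoal premises pr for s1 t1
      proof -
        have a: "s1 x = s' x" if "x \<notin> {''e'', ''fr''}" for x
          using agreeD[OF pr(2), of x] that by simp
        have "s1 ''fr'' 0 = (if free ?d j then 1 else 0)"
          using pr(1) by (auto simp: fr eq tau 5(3))
        then show ?thesis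
          using pr(3) by (simp add: a eq 5(3) p pw Z_def)
      qed
      done
  qed
next
  case 7
  have "(K + 1) * ((K + 1) * 60 + 40 + acost (Const K) + 10) = (K + 1) * ((K + 1) * 60 + 51)" by simp
  also have "\<dots> \<le> (K + 1) * (K + 1) * (60 + 51)" by (rule nested_bound) simp_all
  finally show ?case by simp
qed (use z in auto)

lemma runs_cell:
  assumes r: "ready n s" and B: "B \<subseteq> {..n}" and p: "s ''p'' 0 = p"
    and d: "\<forall>c<K. s ''d'' c \<le> n" and cd: "code (n + 1) K (s ''d'') = Suc p"
    and t: "table n A p s"
  shows "runs (cell_prog K) ((K + 1) * (K + 1) * 250) (table n A (Suc p)) s"
proof -
  let ?d = "s ''d''" and ?M = "n + 1"
  have col: "s ''col'' (?d c) = col (?d c)" if "c < K" for c using r d that by (simp add: ready_def)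
  have pw: "s ''pw'' c = ?M ^ c" if "c \<le> K" for c using r that by (simp add: ready_def)
  \<comment> \<open>Lowering the digit c subtracts its weight, which is at least 1, so the look-up
    falls into the part of the table already filled.\<close>
  have prev: "s ''f'' (Suc p - ?M ^ c) = A * ways (?d(c := ?d c - 1))" if c: "c < K" "0 < ?d c" for c
  proof -
    have e: "code ?M K (?d(c := ?d c - 1)) = Suc p - ?M ^ c" using code_dec[of c K ?d ?M] c cd by simp
    have "Suc p - ?M ^ c \<le> p" using one_le_power[of ?M c] by linarith
    moreover have "\<forall>i<K. (?d(c := ?d c - 1)) i \<le> n" using d by (auto intro: diff_le_self le_trans)
    ultimately show ?thesis using t e unfolding table_def by metis
  qed
  have fin: "table n A (Suc p) s'" if f: "s' ''f'' = (s ''f'')(Suc p := A * ways ?d)" for s'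
    unfolding table_def
  proof (intro allI impI)
    fix e assume e: "\<forall>c<K. e c \<le> n" "code ?M K e \<le> Suc p"
    show "s' ''f'' (code ?M K e) = A * ways e"
    \<comment> \<open>Functions with the same address agree below K, so a single write settles all
      of them.\<close>
    proof (cases "code ?M K e = Suc p")
      case True
      then have "e c = ?d c" if "c < K" for c
        using code_inj[of K e ?M ?d c] e d cd that by (simp add: less_Suc_eq_le)
      then have "kept e = kept ?d" by (rule kept_cong)
      then show ?thesis using True f by simp
    next
      case False
      then show ?thesis using e t f by (simp add: table_def)
    qed
  qed
  let ?s = "s(''sil'' := (s ''sil'')(0 := K))"
  have bound: "(K + 1) * 60 + (K + 1) * (K + 1) * 140 + 50 \<le> (K + 1) * (K + 1) * 250"
    by (simp add: algebra_simps)
  show ?thesis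
    unfolding runs_iff_wp cell_prog_def
    apply (simp only: wp_Seq wp_Assign aval.simps)
    apply (rule runs_wp[OF runs_silent])
     apply simp
    subgoal premises pr for s1 t1
    proof -
      have a: "s1 x = s x" if "x \<notin> {''c'', ''sil''}" for x
        using agreeD[OF pr(2), of x] that by simp
      from pr(1) show ?thesis
      proof (elim disjE)
        assume *: "s1 ''sil'' 0 < K \<and> 0 < ?s ''d'' (s1 ''sil'' 0) \<and>
          ?s ''col'' (?s ''d'' (s1 ''sil'' 0)) \<noteq> s1 ''sil'' 0"
        define c where "c = s1 ''sil'' 0"
        have c: "c < K" "0 < ?d c" "col (?d c) \<noteq> c" using * col by (auto simp: c_def)
        have "ways ?d = ways (?d(c := ?d c - 1))" using kept_silent[of ?d c] c by simp
        then have v: "s ''f'' (Suc p - ?M ^ c) = A * ways ?d" using prev[OF c(1,2)] by simp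
        show ?thesis
          using pr(3) c v bound by (simp add: a p pw fin flip: c_def)
      next
        assume *: "s1 ''sil'' 0 = K \<and> (\<forall>c<K. 0 < ?s ''d'' c \<longrightarrow> ?s ''col'' (?s ''d'' c) = c)"
        have tops: "col (?d c) = c" if "c < K" "0 < ?d c" for c using * that col[OF that(1)] by simp
        \<comment> \<open>The address p + 1 is not 0, so some digit is positive and the recursion is
          not at its base.\<close>
        have "\<exists>c<K. 0 < ?d c"
        proof (rule ccontr)
          assume "\<not> (\<exists>c<K. 0 < ?d c)"
          then have "code ?M K ?d = 0" by (simp add: code_def)
          then show False using cd by simp
        qed
        then obtain c0 where c0: "c0 < K" "0 < ?d c0" by blast
        have "(\<Sum>c | c < K \<and> free ?d c. s ''f'' (Suc p - ?M ^ c)) =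
            (\<Sum>c | c < K \<and> free ?d c. A * ways (?d(c := ?d c - 1)))"
          by (rule sum.cong) (use prev in \<open>auto simp: free_def\<close>)
        also have "\<dots> = A * ways ?d"
          using ways_step[of ?d c0, OF tops c0] by (simp add: sum_distrib_left)
        finally have v: "(\<Sum>c | c < K \<and> free ?d c. s ''f'' (Suc p - ?M ^ c)) = A * ways ?d" .
        let ?s1 = "s1(''sum'' := (s1 ''sum'')(0 := 0))"
        have r1: "ready n ?s1" using r by (simp add: ready_def a)
        show ?thesis
          apply (simp only: wp_Cond wp_Seq wp_Assign)
          apply (simp add: * del: One_nat_def)
          apply (rule runs_wp[OF runs_sum[where p = p and n = n]])
             apply (rule r1[simplified])
            apply simp
           apply (simp add: a p)
          subgoal premises pr2 for s2 t2
          proof -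
            have a2: "s2 x = s1 x" if "x \<notin> {''c'', ''e'', ''fr'', ''sum''}" for x
              using agreeD[OF pr2(2), of x] that by simp
            have "s2 ''sum'' 0 = A * ways ?d" using pr2(1) v by (simp add: a)
            then show ?thesis
              using pr2(3) pr(3) bound by (simp add: a2 a p fin)
          qed
          done
      qed
    qed
    done
qed

lemma runs_table:
  assumes r: "ready n s" and B: "B \<subseteq> {..n}" and A: "s ''acc'' 0 = A"
  shows "runs (table_prog K) ((n + 1) ^ K * ((K + 1) * (K + 1) * 500))
    (\<lambda>s'. s' ''acc'' 0 = A * card (linlists \<tau> B)) s"
proof -
  let ?M = "n + 1"
  let ?s1 = "s(''f'' := (s ''f'')(0 := A))"
  have zero: "runs (for_loop ''c'' (Const K) (Assign ''d'' (Var ''c'') (Const 0))) ((K + 1) * 20)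
      (\<lambda>s'. \<forall>c<K. s' ''d'' c = 0) ?s1"
  proof (rule runs_for[where I = "\<lambda>j s'. \<forall>c<j. s' ''d'' c = 0" and m = K and C = 5], goal_cases)
    case (5 j s')
    then show ?case by (auto simp: runs_iff_wp less_Suc_eq)
  qed auto
  let ?step = "''carry'' ::= Const 1 ;; odometer K ;; cell_prog K"
  let ?I = "\<lambda>j s'. ready n s' \<and> (\<forall>c<K. s' ''d'' c \<le> n) \<and> code ?M K (s' ''d'') = j \<and> table n A j s'"
  have pos: "0 < ?M ^ K" by simp
  have main: "runs (for_loop ''p'' (Minus (Elem ''pw'' (Const K)) (Const 1)) ?step)
      (?M ^ K * ((K + 1) * (K + 1) * 400)) (?I (?M ^ K - 1)) s2"
    if s2: "ready n s2" "\<forall>c<K. s2 ''d'' c = 0" "s2 ''f'' 0 = A" for s2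
  proof (rule runs_for[where I = ?I and m = "?M ^ K - 1" and C = "(K + 1) * (K + 1) * 350"], goal_cases)
    case 1
    have c0: "code ?M K (s2 ''d'') = 0" using s2(2) by (simp add: code_def)
    have "table n A 0 s2"
      unfolding table_def
    proof (intro allI impI)
      fix e assume e: "\<forall>c<K. e c \<le> n" "code ?M K e \<le> 0"
      have "e c = 0" if "c < K" for c
        using code_inj[of K e ?M "\<lambda>_. 0" c] e that by (simp add: less_Suc_eq_le code_def)
      then have "ways e = 1" by (rule ways_zero)
      then show "s2 ''f'' (code ?M K e) = A * ways e" using e s2(3) by simp
    qed
    then show ?case using s2 c0 by simp
  next
    case (4 s')
    then show ?case using s2(1) agreeD[OF 4, of "''pw''"] by (simp add: ready_def)
  next
    case (5 j s')
    let ?s3 = "s'(''carry'' := (s' ''carry'')(0 := 1))"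
    have lt: "Suc j < ?M ^ K" using 5(1) by simp
    have bound: "(K + 1) * 60 + (K + 1) * (K + 1) * 250 + 10 \<le> (K + 1) * (K + 1) * 350"
      by (simp add: algebra_simps)
    show ?case
      unfolding runs_iff_wp
      apply (simp only: wp_Seq wp_Assign aval.simps)
      apply (rule runs_wp[OF runs_odometer[where n = n]])
          apply (use 5(2) in \<open>simp add: ready_def\<close>)
         apply simp
        apply (use 5(2) in simp)
       apply (use 5(2) lt in simp)
      subgoal premises pr for s4 t4
      proof -
        have a: "s4 x = s' x" if "x \<notin> {''c'', ''d'', ''carry''}" for x
          using agreeD[OF pr(2), of x] that by simp
        have r4: "ready n s4" using 5(2) by (simp add: ready_def a)
        have t4: "table n A j s4" using 5(2) by (simp add: table_def a)
        have c4: "code ?M K (s4 ''d'') = Suc j" "\<forall>c<K. s4 ''d'' c \<le> n" using pr(1) 5(2) by simp_all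
        have p4: "s4 ''p'' 0 = j" using 5(3) by (simp add: a)
        show ?thesis
        proof (rule runs_wp[OF runs_cell[OF r4 B p4 c4(2,1) t4]])
          fix s5 t5
          assume t5: "table n A (Suc j) s5" and a5: "agree (mods (cell_prog K)) s4 s5"
            and u: "t5 \<le> t4 + (K + 1) * (K + 1) * 250"
          have a: "s5 x = s4 x" if "x \<notin> {''c'', ''e'', ''fr'', ''sum'', ''sil'', ''f''}" for x
            using agreeD[OF a5, of x] that by simp
          have "ready n s5" using r4 by (simp add: ready_def a)
          moreover have "t5 \<le> (K + 1) * (K + 1) * 350" using u pr(3) bound by simp
          ultimately show "t5 \<le> (K + 1) * (K + 1) * 350 \<and> ?I (Suc j) s5"
            using t5 c4 by (simp add: a)
        qed
      qed
      done
  next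
    case (6 s')
    then show ?case by simp
  next
    case 7
    have "?M ^ K - 1 + 1 = ?M ^ K" using pos by simp
    then show ?case by simp
  qed (auto simp: ready_def table_def)
  \<comment> \<open>The last cell has all digits equal to n, and no position of B exceeds n.\<close>
  have Mx: "ways (\<lambda>_. n) = card (linlists \<tau> B)"
  proof -
    have "kept (\<lambda>_. n) = B" using B by (auto simp: kept_def)
    then show ?thesis by simp
  qed
  have bound: "(K + 1) * 20 + ?M ^ K * ((K + 1) * (K + 1) * 400) + 40 \<le> ?M ^ K * ((K + 1) * (K + 1) * 500)"
  proof -
    have "(K + 1) * 20 + 40 \<le> (K + 1) * (K + 1) * 100" by (simp add: algebra_simps)
    also have "\<dots> \<le> ?M ^ K * ((K + 1) * (K + 1) * 100)" using pos by simp
    finally have "(K + 1) * 20 + 40 \<le> ?M ^ K * ((K + 1) * (K + 1) * 100)" .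
    moreover have "?M ^ K * ((K + 1) * (K + 1) * 500) =
        ?M ^ K * ((K + 1) * (K + 1) * 400) + ?M ^ K * ((K + 1) * (K + 1) * 100)"
      unfolding distrib_left[symmetric] by simp
    ultimately show ?thesis by linarith
  qed
  show ?thesis
    unfolding runs_iff_wp table_prog_def
    apply (simp only: wp_Seq wp_Assign aval.simps A)
    apply (rule runs_wp[OF zero])
    subgoal premises pr for s2 t2
    proof -
      have a: "s2 x = ?s1 x" if "x \<notin> {''c'', ''d''}" for x
        using agreeD[OF pr(2), of x] that by simp
      have r2: "ready n s2" using r by (simp add: ready_def a)
      have f2: "s2 ''f'' 0 = A" by (simp add: a)
      show ?thesis
        unfolding wp_Seq
      proof (rule runs_wp[OF main[OF r2 pr(1) f2]])
        fix s3 t3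
        assume I: "?I (?M ^ K - 1) s3" and t3: "t3 \<le> t2 + ?M ^ K * ((K + 1) * (K + 1) * 400)"
        have "code ?M K (\<lambda>_. n) = ?M ^ K - 1" using code_max[of ?M K] by simp
        moreover have "table n A (?M ^ K - 1) s3" using I by blast
        ultimately have "s3 ''f'' (?M ^ K - 1) = A * ways (\<lambda>_. n)"
          unfolding table_def by (metis order_refl)
        moreover have "s3 ''pw'' K = ?M ^ K" using I by (simp add: ready_def)
        ultimately show "wp (''acc'' ::= Elem ''f'' (Minus (Elem ''pw'' (Const K)) (Const 1)))
            (\<lambda>s' t. t \<le> ?M ^ K * ((K + 1) * (K + 1) * 500) \<and> s' ''acc'' 0 = A * card (linlists \<tau> B)) s3 t3"
          using t3 pr(3) bound by (simp add: Mx)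
      qed
    qed
    done
qed

end

section \<open>The counting program\<close>

definition contract_prog :: "nat \<Rightarrow> com" where
  "contract_prog K = search_prog ;;
     If_then (Less (Const 0) (Var ''found'')) (chain_prog K ;; table_prog K ;; sort_prog)"

definition count_prog :: "nat \<Rightarrow> com" where
  "count_prog K = prologue K ;; for_loop ''it'' (Var ''m'') (contract_prog K) ;;
     ''result'' ::= Var ''acc''"

text \<open>The product of the accumulator and the number of extensions still to be counted stays
  equal to R. The last line measures progress: after t rounds the array is sorted or has at least t
  successions.\<close>

definition contract_inv :: "nat \<Rightarrow> nat \<Rightarrow> nat \<Rightarrow> nat \<Rightarrow> state \<Rightarrow> bool" where
  "contract_inv n k R t s \<longleftrightarrow>
     bij_betw (s ''tau'') {1..n} {1..n} \<and> simple_bound n (s ''tau'') k \<and>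
     s ''acc'' 0 * card (linexts {1..n} (s ''tau'')) = R \<and>
     ((\<forall>x\<in>{1..n}. s ''tau'' x = x) \<or> t \<le> card (successions n (s ''tau'')))"

lemma simple_bound_cong:
  assumes "\<And>x. x \<in> {1..n} \<Longrightarrow> f x = g x" "simple_bound n f k"
  shows "simple_bound n g k"
  unfolding simple_bound_def
proof (intro allI impI)
  fix S assume S: "S \<subseteq> {1..n}"
  show "pattern_bound g S k"
  proof (rule pattern_bound_iso[where g = id and \<pi>' = f])
    show "pattern_bound f (id ` S) k" using assms(2) S by (simp add: simple_bound_def)
    show "g x < g y \<longleftrightarrow> f (id x) < f (id y)" if "x \<in> S" "y \<in> S" for x y
      using assms(1)[OF subsetD[OF S that(1)]] assms(1)[OF subsetD[OF S that(2)]] by simp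
  qed simp
qed

text \<open>Without a block the array is sorted and the round changes nothing that matters. With
  one, the table multiplies the accumulator by the factor of the block, and sorting removes the same
  factor from the remaining count.\<close>

lemma runs_contract:
  fixes n k :: nat
  defines "K \<equiv> max k 2"
  assumes n: "s ''n'' 0 = n" and m: "s ''m'' 0 = n + 1" and pw: "\<forall>c\<le>K. s ''pw'' c = (n + 1) ^ c"
    and I: "contract_inv n k R t s"
  shows "runs (contract_prog K) ((n + 2) * (n + 2) * 500 + (n + 1) ^ K * ((K + 1) * (K + 1) * 500))
    (contract_inv n k R (Suc t)) s"
proof -
  let ?\<tau> = "s ''tau''"
  have bij: "bij_betw ?\<tau> {1..n} {1..n}" and sb: "simple_bound n ?\<tau> k"
    and acc: "s ''acc'' 0 * card (linexts {1..n} ?\<tau>) = R"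
    and sc: "(\<forall>x\<in>{1..n}. ?\<tau> x = x) \<or> t \<le> card (successions n ?\<tau>)"
    using I by (auto simp: contract_inv_def)
  define L P where "L = (n + 2) * (n + 2)" and "P = (n + 1) ^ K * ((K + 1) * (K + 1) * 500)"
  have L: "(n + 2) * 50 \<le> L * 50" "4 \<le> L" by (auto simp: L_def)
  show ?thesis
    unfolding runs_iff_wp contract_prog_def L_def[symmetric] P_def[symmetric]
    apply (simp only: wp_Seq)
    apply (rule runs_wp[OF runs_search[where s = s and n = n, OF m]])
    unfolding L_def[symmetric]
    subgoal premises pr for s1 t1
    proof -
      have a: "s1 x = s x" if "x \<notin> {''b'', ''j'', ''a'', ''des'', ''mn'', ''mx'', ''lo'', ''hi'', ''base'', ''found''}" for x
        using agreeD[OF pr(2), of x] that by simp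
      show ?thesis
      proof (cases "s1 ''found'' 0 = 0")
        case True
        then have "?\<tau> x = x" if "x \<in> {1..n}" for x
          using sorted_or_block[OF bij _ that] pr(1) by (simp add: search_inv_def)
        then have "contract_inv n k R (Suc t) s1"
          using bij sb acc by (simp add: contract_inv_def a)
        then show ?thesis using True pr(3) L by simp
      next
        case False
        define lo hi where "lo = s1 ''lo'' 0" and "hi = s1 ''hi'' 0"
        have found_block: "minimal_block ?\<tau> lo hi" "hi \<le> n" "s1 ''base'' 0 = Min (?\<tau> ` {lo..hi})"
          using pr(1) False by (auto simp: search_inv_def lo_def hi_def)
        interpret min_block n ?\<tau> lo hi
          by unfold_locales (use bij found_block in auto)
        \<comment> \<open>The colour array is specified only for cells up to n; this total function
          agrees with it there and gives colour K to all positions outside the block.\<close>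
        define col where "col x = (if lo \<le> x \<and> x \<le> hi then chain_index ?\<tau> lo x else K)" for x
        interpret chains ?\<tau> "{lo..hi}" col K
        proof (rule block_chains)
          show "1 \<le> lo" by (rule unsorted(1))
          show "inj_on ?\<tau> {lo..hi}" by (rule injB)
          show "card D \<le> K" if "D \<subseteq> {lo..hi}" "decreasing_on D ?\<tau>" for D
            using decreasing_card[OF sb that] by (simp add: K_def)
        qed (auto simp: col_def)
        have B: "{lo..hi} \<subseteq> {..n}" using found_block(2) by auto
        have "wp (chain_prog K ;; table_prog K ;; sort_prog)
            (\<lambda>s' t'. t' \<le> L * 500 + P \<and> contract_inv n k R (Suc t) s') s1 (t1 + 5)"
          apply (simp only: wp_Seq)
          apply (rule runs_wp[OF runs_chain[where n = n and lo = lo and hi = hi]])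
             apply (simp add: a m)
            apply (simp add: lo_def)
           apply (simp add: hi_def)
          apply (rule found_block(2))
          unfolding L_def[symmetric]
          subgoal premises pr2 for s2 t2
          proof -
            have a2: "s2 x = s1 x" if "x \<notin> {''x'', ''y'', ''cx'', ''col''}" for x
              using agreeD[OF pr2(2), of x] that by simp
            have r: "ready n s2"
              using pr2(1) n pw by (simp add: ready_def a2 a col_def)
            show ?thesis
              unfolding wp_Seq
              apply (rule runs_wp[OF runs_table[OF r B refl]])
              unfolding P_def[symmetric]
              subgoal premises pr3 for s3 t3
              proof -
                have a3: "s3 x = s2 x" if "x \<notin> {''acc'', ''p'', ''d'', ''carry'', ''c'', ''e'', ''fr'', ''sum'', ''sil'', ''f''}" for x
                  using agreeD[OF pr3(2), of x] that by simp
                have acc3: "s3 ''acc'' 0 = s ''acc'' 0 * card (linexts {lo..hi} ?\<tau>)"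
                  using pr3(1) by (simp add: a2 a card_linexts_linlists)
                show ?thesis
                  apply (rule runs_wp[OF runs_sort[where n = n and lo = lo and hi = hi and c = "Min (?\<tau> ` {lo..hi})"]])
                      apply (simp add: a a2 a3 m)
                     apply (simp add: lo_def a2 a3)
                    apply (simp add: hi_def a2 a3)
                   apply (rule found_block(2))
                   apply (simp add: a2 a3 found_block(3))
                  subgoal premises pr4 for s4 t4
                  proof -
                    let ?\<tau>' = "sort_block lo hi (Min (?\<tau> ` {lo..hi})) ?\<tau>"
                    have tau4: "s4 ''tau'' = ?\<tau>'" using pr4(1) by (simp add: a a2 a3)
                    have acc4: "s4 ''acc'' 0 = s ''acc'' 0 * card (linexts {lo..hi} ?\<tau>)"
                      using agreeD[OF pr4(2), of "''acc''"] acc3 by simp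
                    have "s4 ''acc'' 0 * card (linexts {1..n} ?\<tau>') = R"
                      using acc card_linexts_factor by (simp add: acc4 mult.assoc)
                    moreover have "Suc t \<le> card (successions n ?\<tau>')"
                    proof -
                      have "\<not> (\<forall>x\<in>{1..n}. ?\<tau> x = x)"
                      proof
                        assume "\<forall>x\<in>{1..n}. ?\<tau> x = x"
                        then have "increasing_on {lo..hi} ?\<tau>"
                          using B_sub by (auto simp: monotone_on_def subset_iff)
                        then show False using unsorted(3) by simp
                      qed
                      then have "t \<le> card (successions n ?\<tau>)" using sc by blast
                      then show ?thesis using sort_successions[OF unsorted(3)] by simp
                    qed
                    ultimately have "contract_inv n k R (Suc t) s4"
                      using sort_bij sort_simple_bound[OF sb] by (simp add: contract_inv_def tau4)
                    moreover have "t4 \<le> L * 500 + P"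
                      using pr(3) pr2(3) pr3(3) pr4(3) L by linarith
                    ultimately show ?thesis by simp
                  qed
                  done
              qed
              done
          qed
          done
        then show ?thesis using False by (simp add: eval_nat_numeral)
      qed
    qed
    done
qed

lemma mods_contract_prog:
  "mods (contract_prog K) \<inter> {''n'', ''m'', ''pw'', ''it''} = {}"
  by (simp add: contract_prog_def)

section \<open>Total running time and correctness\<close>

lemma count_bound:
  fixes N k :: nat
  defines "K \<equiv> max k 2" and "e \<equiv> max 4 (k + 1)"
  assumes N: "2 \<le> N"
  shows "N * N * (200 + 70 * K) + N * (N * N * 500 + (N - 1) ^ K * ((K + 1) * (K + 1) * 500) + 20) + 20
    \<le> (2000 + 1000 * ((K + 1) * (K + 1))) * N ^ e"
proof -
  define q where "q = (K + 1) * (K + 1)"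
  define E where "E = N ^ e"
  have pw: "N ^ i \<le> E" if "i \<le> e" for i
    unfolding E_def using that N by (intro power_increasing) auto
  have p0: "1 \<le> E" using pw[of 0] by simp
  have p1: "N \<le> E" using pw[of 1] by (simp add: e_def)
  have p2: "N * N \<le> E" using pw[of 2] by (simp add: e_def power2_eq_square)
  have p3: "N * (N * N) \<le> E" using pw[of 3] by (simp add: e_def power3_eq_cube mult.assoc)
  \<comment> \<open>One factor N counts the rounds, the power is the size of the table. The exponent
    K + 1 is the maximum of k + 1 and 3, which is at most e.\<close>
  have "N * (N - 1) ^ K \<le> N * N ^ K" by (intro mult_left_mono power_mono) auto
  also have "\<dots> = N ^ Suc K" by simp
  also have "\<dots> \<le> E" by (rule pw) (auto simp: e_def K_def)
  finally have pK: "N * (N - 1) ^ K \<le> E" .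
  have K: "K + 1 \<le> q" by (simp add: q_def)
  have "N * N * (200 + 70 * K) \<le> E * (200 + 70 * q)"
    using p2 K by (intro mult_le_mono) auto
  moreover have "N * (N * N * 500 + (N - 1) ^ K * (q * 500) + 20)
      = N * (N * N) * 500 + (N * (N - 1) ^ K) * (q * 500) + N * 20" by (simp add: algebra_simps)
  moreover have "N * (N * N) * 500 \<le> E * 500" using p3 by simp
  moreover have "(N * (N - 1) ^ K) * (q * 500) \<le> E * (q * 500)" using pK by (rule mult_right_mono) simp
  moreover have "E * (200 + 70 * q) = E * 200 + 70 * (E * q)" "E * (q * 500) = 500 * (E * q)"
    "(2000 + 1000 * q) * E = 2000 * E + 1000 * (E * q)" by (simp_all add: algebra_simps)
  ultimately show ?thesis using p0 p1 unfolding q_def[symmetric] E_def[symmetric] by linarith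
qed

lemma count_prog_correct:
  fixes n k w :: nat
  defines "K \<equiv> max k 2"
  assumes p1: "\<sigma>1 permutes {1..n}" and p2: "\<sigma>2 permutes {1..n}"
    and iw: "has_intrinsic_width n (inv \<sigma>1 \<circ> \<sigma>2) w" and w: "w \<le> k"
  shows "outputs_within (count_prog K) (perm_pair_input n \<sigma>1 \<sigma>2) (card (weak_interval n \<sigma>1 \<sigma>2))
    ((2000 + 1000 * ((K + 1) * (K + 1))) * (n + 2) ^ max 4 (k + 1))"
proof -
  define \<pi> where "\<pi> = inv \<sigma>1 \<circ> \<sigma>2"
  define R where "R = card (weak_interval n \<sigma>1 \<sigma>2)"
  let ?s = "perm_pair_input n \<sigma>1 \<sigma>2"
  let ?C = "(n + 2) * (n + 2) * 500 + (n + 1) ^ K * ((K + 1) * (K + 1) * 500)"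
  have pp: "\<pi> permutes {1..n}" unfolding \<pi>_def by (rule permutes_compose[OF p2 permutes_inv[OF p1]])
  have sb: "simple_bound n \<pi> k"
    using intrinsic_width_simple_bound[OF iw] simple_bound_mono w unfolding \<pi>_def by blast
  have R: "R = of_bool (weak_ok n \<sigma>2 \<pi>) * card (linexts {1..n} \<pi>)"
    using card_weak_interval[OF p1 p2] by (simp add: R_def \<pi>_def)
  have loop: "runs (for_loop ''it'' (Var ''m'') (contract_prog K)) ((n + 2) * (?C + 20))
      (\<lambda>s'. s' ''acc'' 0 = R) s1"
    if s1: "s1 ''n'' 0 = n" "s1 ''m'' 0 = n + 1" "\<forall>x\<le>n. s1 ''tau'' x = \<pi> x"
      "\<forall>c\<le>K. s1 ''pw'' c = (n + 1) ^ c" "s1 ''acc'' 0 = of_bool (weak_ok n \<sigma>2 \<pi>)" for s1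
  proof (rule runs_for[where I = "contract_inv n k R" and m = "n + 1" and C = ?C], goal_cases)
    case 1
    have eq: "\<And>x. x \<in> {1..n} \<Longrightarrow> s1 ''tau'' x = \<pi> x" using s1(3) by simp
    have "bij_betw (s1 ''tau'') {1..n} {1..n}"
      using permutes_imp_bij[OF pp] bij_betw_cong[of "{1..n}" "s1 ''tau''" \<pi>] eq by blast
    moreover have "simple_bound n (s1 ''tau'') k"
      by (rule simple_bound_cong[OF _ sb]) (simp add: eq)
    ultimately show ?case
      using R s1(5) linexts_cong[of "{1..n}" "s1 ''tau''" \<pi>, OF eq] by (simp add: contract_inv_def)
  next
    case 2
    show ?case by (simp add: contract_inv_def)
  next
    case 3
    show ?case using mods_contract_prog by blast
  next
    case (4 s')
    then show ?case using agreeD[OF 4, of "''m''"] s1(2) by (simp add: contract_prog_def)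
  next
    case (5 j s')
    have "s' ''n'' = s1 ''n''" "s' ''m'' = s1 ''m''" "s' ''pw'' = s1 ''pw''"
      using agreeD[OF 5(4)] by (simp_all add: contract_prog_def)
    then show ?case unfolding K_def
      by (intro runs_contract) (use s1 5(2) in \<open>simp_all add: K_def\<close>)
  next
    case (6 s')
    \<comment> \<open>There are at most n - 1 successions, fewer than the n + 1 rounds performed, so
      only the sorted alternative of the invariant remains; it leaves a single linear
      extension.\<close>
    have "card (successions n (s' ''tau'')) \<le> card {1..<n}"
      by (rule card_mono) (auto simp: successions_def)
    then have "\<forall>x\<in>{1..n}. s' ''tau'' x = x" using 6(1) by (auto simp: contract_inv_def)
    then have "card (linexts {1..n} (s' ''tau'')) = 1" by (intro card_linexts_sorted) simp
    then show ?case using 6(1) by (simp add: contract_inv_def)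
  next
    case 7
    show ?case by (intro mult_le_mono) simp_all
  qed
  define T where "T = (2000 + 1000 * ((K + 1) * (K + 1))) * (n + 2) ^ max 4 (k + 1)"
  have bound: "(n + 2) * (n + 2) * (200 + 70 * K) + (n + 2) * (?C + 20) + 20 \<le> T"
    using count_bound[of "n + 2" k] by (simp add: T_def K_def)
  have "wp (count_prog K) (\<lambda>s' t. t \<le> T \<and> s' ''result'' 0 = R) ?s 0"
    unfolding count_prog_def
    apply (simp only: wp_Seq)
    apply (rule runs_wp[OF runs_prologue[OF p1 p2]])
    unfolding \<pi>_def[symmetric]
    subgoal premises pr for s1 t1
    proof -
      have n1: "s1 ''n'' 0 = n"
        using agreeD[OF pr(2), of "''n''"]
        by (simp add: prologue_def inverse_prog_def relative_prog_def order_prog_def power_prog_def perm_pair_input_def)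
      show ?thesis
        unfolding wp_Seq
      proof (rule runs_wp[OF loop[of s1, OF n1]])
        fix s2 :: state and t2 assume "s2 ''acc'' 0 = R" "t2 \<le> t1 + (n + 2) * (?C + 20)"
        then show "wp (''result'' ::= Var ''acc'') (\<lambda>s' t. t \<le> T \<and> s' ''result'' 0 = R) s2 t2"
          using pr(3) bound by simp
      qed (use pr(1) in simp_all)
    qed
    done
  then show ?thesis
    unfolding outputs_within_def wp_def R_def T_def by auto
qed

lemma shifted_power_bigo: "(\<lambda>n. real (C * (n + 2) ^ e)) \<in> O(\<lambda>n. real n ^ e)"
\<comment> \<open>The factor \<open>3 ^ e\<close> comes from n + 2 \<le> 3 n for n \<ge> 1.\<close>
proof (rule bigoI[where c = "real (C * 3 ^ e)"])
  show "eventually (\<lambda>n. norm (real (C * (n + 2) ^ e)) \<le> real (C * 3 ^ e) * norm (real n ^ e)) at_top"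
    using eventually_ge_at_top[of "1 :: nat"]
  proof eventually_elim
    case (elim n)
    have "(n + 2) ^ e \<le> (3 * n) ^ e" using elim by (intro power_mono) auto
    then have "C * (n + 2) ^ e \<le> C * 3 ^ e * n ^ e" by (simp add: power_mult_distrib)
    then have "real (C * (n + 2) ^ e) \<le> real (C * 3 ^ e * n ^ e)" by (rule of_nat_mono)
    then show ?case by simp
  qed
qed

theorem theorem14:
  fixes k :: nat
  assumes "k \<ge> 1"
  shows "\<exists>(P :: com) (T :: nat \<Rightarrow> nat).
           (\<lambda>n. real (T n)) \<in> O(\<lambda>n. real n ^ max 4 (k + 1)) \<and>
           (\<forall>n \<sigma>\<^sub>1 \<sigma>\<^sub>2 w.
              \<sigma>\<^sub>1 permutes {1..n} \<longrightarrow> \<sigma>\<^sub>2 permutes {1..n} \<longrightarrow>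
              has_intrinsic_width n (inv \<sigma>\<^sub>1 \<circ> \<sigma>\<^sub>2) w \<longrightarrow> w \<le> k \<longrightarrow>
              outputs_within P (perm_pair_input n \<sigma>\<^sub>1 \<sigma>\<^sub>2)
                (card (weak_interval n \<sigma>\<^sub>1 \<sigma>\<^sub>2)) (T n))"
proof (intro exI conjI allI impI)
  let ?c = "2000 + 1000 * ((max k 2 + 1) * (max k 2 + 1))"
  show "(\<lambda>n. real (?c * (n + 2) ^ max 4 (k + 1))) \<in> O(\<lambda>n. real n ^ max 4 (k + 1))"
    by (rule shifted_power_bigo)
qed (rule count_prog_correct)

end
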